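(* Let $n\ge1$ be an integer, let $r>0$ be real, let $w,\zeta\in\mathbb{D}^n$, and put $\nu_k=w_k\overline{\zeta}_k$ for $k=1,\ldots,n$. Then $$\pi^{n+1}K_{\Omega_n^r}\big((0,w),(0,\zeta)\big)=\prod_{k=1}^n(1-\nu_k)^{-2}+\sum_{k=1}^n\frac{2(1+\nu_k)}{r(1-\nu_1)^2\cdots(1-\nu_n)^2(1-\nu_k)}.$$ Moreover, if $\nu_1=\nu_2=\cdots=\nu_n$, then $$\pi^{n+1}K_{\Omega_n^r}\big((0,w),(0,\zeta)\big)=\frac{(2n-r)\nu_1+2n+r}{r(1-\nu_1)^{2n+1}}.$$
   Context: $\mathbb{D}=\{z\in\mathbb{C}:|z|<1\}$. For an integer $n\ge1$ and real $r>0$, $\Omega_n^r=\{(z,w)\in\mathbb{C}\times\mathbb{C}^n : |z|^2+|w_1|^r<1,\ldots,|z|^2+|w_n|^r<1\}$. For a bounded domain $D\subset\mathbb{C}^N$, $K_D$ denotes its Bergman kernel, $K_D(z,w)=\sum_j\Phi_j(z)\overline{\Phi_j(w)}$ for any complete orthonormal basis $\{\Phi_j\}$ of the space of holomorphic functions on $D$ square integrable with respect to Lebesgue measure. *)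

theory Defs
  imports "HOL-Analysis.Analysis"
begin

text \<open>
  The space \<open>\<complex> \<times> \<complex>^n\<close> is the type \<^typ>\<open>complex \<times> (complex ^ 'n)\<close> with
  \<open>n = CARD('n)\<close>, which is at least 1 for every finite type \<open>'n\<close>.
  On this type the library only provides the real vector space structure, so multiplication by
  complex scalars is introduced here.
\<close>

definition cscale :: "complex \<Rightarrow> complex \<times> (complex ^ 'n) \<Rightarrow> complex \<times> (complex ^ 'n)" where
  "cscale c p = (c * fst p, c *s snd p)"

text \<open>
  Holomorphy in several variables, meant for open \<open>D\<close>: at each point the real Frechet derivative
  exists and is complex linear (the derivative is real linear by definition, so only homogeneity
  has to be required).
\<close>

definition holomorphic_sev ::
    "(complex \<times> (complex ^ 'n::finite) \<Rightarrow> complex) \<Rightarrow> (complex \<times> (complex ^ 'n)) set \<Rightarrow> bool" where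
  "holomorphic_sev f D \<longleftrightarrow>
     (\<forall>p\<in>D. \<exists>f'. (f has_derivative f') (at p) \<and> (\<forall>c v. f' (cscale c v) = c * f' v))"

definition bergman_space ::
    "(complex \<times> (complex ^ 'n::finite)) set \<Rightarrow> (complex \<times> (complex ^ 'n) \<Rightarrow> complex) set" where
  "bergman_space D =
     {f. holomorphic_sev f D \<and> set_integrable lborel D (\<lambda>p. (cmod (f p))\<^sup>2)}"

definition l2_inner ::
    "(complex \<times> (complex ^ 'n::finite)) set \<Rightarrow> (complex \<times> (complex ^ 'n) \<Rightarrow> complex)
      \<Rightarrow> (complex \<times> (complex ^ 'n) \<Rightarrow> complex) \<Rightarrow> complex" where
  "l2_inner D f g = (LINT p:D|lborel. f p * cnj (g p))"

definition l2_norm ::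
    "(complex \<times> (complex ^ 'n::finite)) set \<Rightarrow> (complex \<times> (complex ^ 'n) \<Rightarrow> complex) \<Rightarrow> real" where
  "l2_norm D f = sqrt (LINT p:D|lborel. (cmod (f p))\<^sup>2)"

text \<open>
  Functions are total, and their values outside \<open>D\<close> are irrelevant.  An orthonormal set cannot
  contain two different functions that agree on \<open>D\<close>, so sets of functions faithfully
  represent orthonormal families.  Completeness: the linear span is dense in the Bergman space.
\<close>

definition complete_orthonormal_basis ::
    "(complex \<times> (complex ^ 'n::finite)) set \<Rightarrow> (complex \<times> (complex ^ 'n) \<Rightarrow> complex) set \<Rightarrow> bool"
where
  "complete_orthonormal_basis D B \<longleftrightarrow>
     B \<subseteq> bergman_space D \<and>
     (\<forall>\<phi>\<in>B. \<forall>\<psi>\<in>B. l2_inner D \<phi> \<psi> = (if \<phi> = \<psi> then 1 else 0)) \<and>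
     (\<forall>f\<in>bergman_space D. \<forall>\<epsilon>>0. \<exists>S c. finite S \<and> S \<subseteq> B \<and>
        l2_norm D (\<lambda>p. f p - (\<Sum>\<phi>\<in>S. c \<phi> * \<phi> p)) < \<epsilon>)"

text \<open>
  The value of the kernel is the one number to which the series converges for every complete
  orthonormal basis.  The sums are unordered, hence absolutely convergent.  The description is
  proper only if some basis exists and the sum does not depend on it, so evaluating the kernel
  includes proving both.
\<close>

definition bergman_kernel ::
    "(complex \<times> (complex ^ 'n::finite)) set
      \<Rightarrow> complex \<times> (complex ^ 'n) \<Rightarrow> complex \<times> (complex ^ 'n) \<Rightarrow> complex" where
  "bergman_kernel D p q =
     (THE k. \<forall>B. complete_orthonormal_basis D B \<longrightarrow>
        ((\<lambda>\<phi>. \<phi> p * cnj (\<phi> q)) has_sum k) B)"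

text \<open>
  For \<open>r > 0\<close> the library convention \<open>0 powr r = 0\<close> agrees with the usual value.
\<close>

definition Omega :: "real \<Rightarrow> (complex \<times> (complex ^ 'n::finite)) set" where
  "Omega r = {(z, w). \<forall>k. (cmod z)\<^sup>2 + cmod (w $ k) powr r < 1}"

end

theory Submission
  imports Defs "HOL-Complex_Analysis.Cauchy_Integral_Formula"
begin

text \<open>
  Let \<open>n\<close> be the dimension of the second factor, \<open>q = (0, \<zeta>)\<close>, and
  \<open>H\<^sub>\<zeta>(z, w) = \<Prod>\<^sub>k (1 - w\<^sub>k cnj \<zeta>\<^sub>k)\<^sup>-\<^sup>2\<close>, which up to a constant is the Bergman
  kernel of the unit polydisc.  The idea is to write down the function that represents the evaluation
  of Bergman functions at \<open>q\<close>: it is \<open>\<pi>^-(n+1)\<close> times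
  \<open>H\<^sub>\<zeta> + (2/r) H'\<^sub>\<zeta>\<close>, where \<open>H'\<^sub>\<zeta>\<close> is the derivative of
  \<open>\<sigma>^n H\<^bsub>\<sigma>\<zeta>\<^esub>\<close> in \<open>\<sigma>\<close> at \<open>\<sigma> = 1\<close>.  It depends on \<open>w\<close> only, because
  the first coordinate of \<open>q\<close> is 0.

  Why it represents the evaluation.  The slice of the domain over a fixed \<open>z\<close> is a polydisc of radius
  \<open>\<rho> = (1 - |z|\<^sup>2)^(1/r)\<close>.  On a polydisc of radius \<open>\<rho>\<close>, integration against
  \<open>cnj H\<^sub>\<zeta>\<close> takes a holomorphic \<open>g\<close> to \<open>\<pi>^n s^n g(s\<zeta>)\<close> with
  \<open>s = \<rho>\<^sup>2\<close> (lemma \<open>polydisc_reproducing\<close>).  So only the values \<open>f(z, s\<zeta>)\<close>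
  remain, with \<open>s\<close> depending on \<open>|z|\<close>; the mean value property in \<open>z\<close> replaces them by
  \<open>f(0, s\<zeta>)\<close>, and with \<open>G(s) = s^n f(0, s\<zeta>)\<close> one gets (\<open>polydisc_kernel_pairing\<close>)
  \<open>\<langle>f, H\<^sub>\<zeta>\<rangle> = \<pi>^(n+1) \<integral>\<^sub>0\<^sup>1 G(t^(2/r)) dt\<close>.
  Replacing \<open>\<zeta>\<close> by \<open>\<sigma>\<zeta>\<close> and multiplying by \<open>\<sigma>^n\<close> turns the integral into
  \<open>B(\<sigma>) = \<integral>\<^sub>0\<^sup>1 G(\<sigma> t^(2/r)) dt\<close>, and substitution shows that
  \<open>\<sigma>^(r/2) B(\<sigma>)\<close> is the integral of \<open>G(\<tau>^(2/r))\<close> over \<open>0 \<le> \<tau> \<le> \<sigma>^(r/2)\<close>.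
  Differentiating at \<open>\<sigma> = 1\<close> gives \<open>B(1) + (2/r) B'(1) = G(1) = f(q)\<close>
  (\<open>dilated_integral_has_vector_derivative\<close>), and the left-hand side is the pairing of \<open>f\<close> with the
  function above (\<open>Omega_kernel_reproducing\<close>).

  Why this determines the kernel.  If \<open>k\<^sub>p\<close> and \<open>k\<^sub>q\<close> represent the evaluations at \<open>p\<close> and
  \<open>q\<close>, then Parseval's identity gives
  \<open>\<Sum> \<phi>(p) cnj \<phi>(q) = \<langle>k\<^sub>q, k\<^sub>p\<rangle> = k\<^sub>q(p)\<close> for every complete orthonormal basis
  (\<open>bergman_kernel_eq_reproducing\<close>).  That some basis exists follows from the separability of the Bergman
  space by the Gram-Schmidt process (\<open>complete_orthonormal_basis_exists\<close>).
\<close>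

section \<open>Holomorphic functions of several variables\<close>

lemma holomorphic_sev_imp_continuous_on:
  assumes "holomorphic_sev f D"
  shows "continuous_on D f"
proof -
  have "isCont f p" if "p \<in> D" for p
    using assms that has_derivative_continuous unfolding holomorphic_sev_def by blast
  then show ?thesis
    by (simp add: continuous_at_imp_continuous_on)
qed

lemma holomorphic_sev_const: "holomorphic_sev (\<lambda>p. c) D"
  unfolding holomorphic_sev_def by (intro ballI exI[of _ "\<lambda>v. 0"]) auto

lemma holomorphic_sev_add:
  assumes "holomorphic_sev f D" "holomorphic_sev g D"
  shows "holomorphic_sev (\<lambda>p. f p + g p) D"
  unfolding holomorphic_sev_def
proof
  fix p assume "p \<in> D"
  then obtain f' g' where "(f has_derivative f') (at p)" "\<And>c v. f' (cscale c v) = c * f' v"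
    "(g has_derivative g') (at p)" "\<And>c v. g' (cscale c v) = c * g' v"
    using assms unfolding holomorphic_sev_def by metis
  then show "\<exists>h. ((\<lambda>p. f p + g p) has_derivative h) (at p) \<and> (\<forall>c v. h (cscale c v) = c * h v)"
    by (intro exI[of _ "\<lambda>v. f' v + g' v"]) (auto intro!: derivative_eq_intros simp: algebra_simps)
qed

lemma holomorphic_sev_mult:
  assumes "holomorphic_sev f D" "holomorphic_sev g D"
  shows "holomorphic_sev (\<lambda>p. f p * g p) D"
  unfolding holomorphic_sev_def
proof
  fix p assume "p \<in> D"
  then obtain f' g' where "(f has_derivative f') (at p)" "\<And>c v. f' (cscale c v) = c * f' v"
    "(g has_derivative g') (at p)" "\<And>c v. g' (cscale c v) = c * g' v"
    using assms unfolding holomorphic_sev_def by metis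
  then show "\<exists>h. ((\<lambda>p. f p * g p) has_derivative h) (at p) \<and> (\<forall>c v. h (cscale c v) = c * h v)"
    by (intro exI[of _ "\<lambda>v. f p * g' v + f' v * g p"])
       (auto intro!: derivative_eq_intros simp: algebra_simps)
qed

lemma holomorphic_sev_inverse:
  assumes "holomorphic_sev f D" "\<And>p. p \<in> D \<Longrightarrow> f p \<noteq> 0"
  shows "holomorphic_sev (\<lambda>p. inverse (f p)) D"
  unfolding holomorphic_sev_def
proof
  fix p assume p: "p \<in> D"
  then obtain f' where f': "(f has_derivative f') (at p)" "\<And>c v. f' (cscale c v) = c * f' v"
    using assms unfolding holomorphic_sev_def by metis
  show "\<exists>h. ((\<lambda>p. inverse (f p)) has_derivative h) (at p) \<and> (\<forall>c v. h (cscale c v) = c * h v)"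
    by (intro exI[of _ "\<lambda>v. - (inverse (f p) * f' v * inverse (f p))"] conjI
          Deriv.has_derivative_inverse[OF assms(2)[OF p] f'(1)])
       (simp add: f'(2))
qed

lemma holomorphic_sev_prod:
  assumes "finite I" "\<And>i. i \<in> I \<Longrightarrow> holomorphic_sev (f i) D"
  shows "holomorphic_sev (\<lambda>p. \<Prod>i\<in>I. f i p) D"
  using assms by (induction) (auto intro: holomorphic_sev_const holomorphic_sev_mult)

lemma holomorphic_sev_sum:
  assumes "finite I" "\<And>i. i \<in> I \<Longrightarrow> holomorphic_sev (f i) D"
  shows "holomorphic_sev (\<lambda>p. \<Sum>i\<in>I. f i p) D"
  using assms by (induction) (auto intro: holomorphic_sev_const holomorphic_sev_add)

lemma holomorphic_sev_coordinate:
  fixes D :: "(complex \<times> (complex ^ 'n::finite)) set"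
  shows "holomorphic_sev (\<lambda>p. snd p $ k) D"
  unfolding holomorphic_sev_def
proof
  fix p :: "complex \<times> (complex ^ 'n)" assume "p \<in> D"
  have "bounded_linear (\<lambda>p::complex \<times> (complex ^ 'n). snd p $ k)"
    using bounded_linear_compose[OF bounded_linear_vec_nth bounded_linear_snd] .
  then show "\<exists>h. ((\<lambda>p. snd p $ k) has_derivative h) (at p) \<and> (\<forall>c v. h (cscale c v) = c * h v)"
    by (intro exI[of _ "\<lambda>p. snd p $ k"] conjI bounded_linear.has_derivative[OF _ has_derivative_ident])
       (auto simp: cscale_def vector_scalar_mult_def)
qed

text \<open>
  Complex linearity of the derivative makes the restriction to a complex line holomorphic in the usual
  sense, so that one-variable theory applies to each coordinate.
\<close>
lemma holomorphic_sev_along_line: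
  assumes "holomorphic_sev f D" "p + cscale u v \<in> D"
  shows "(\<lambda>u. f (p + cscale u v)) field_differentiable (at u)"
proof -
  obtain f' where f': "(f has_derivative f') (at (p + cscale u v))" "\<And>c v. f' (cscale c v) = c * f' v"
    using assms unfolding holomorphic_sev_def by metis
  have "bounded_linear (\<lambda>u. cscale u v)"
  proof (rule linear_conv_bounded_linear[THEN iffD1], rule linearI)
    show "cscale (b1 + b2) v = cscale b1 v + cscale b2 v" for b1 b2
      by (simp add: cscale_def algebra_simps vector_sadd_rdistrib plus_prod_def)
    show "cscale (r *\<^sub>R b) v = r *\<^sub>R cscale b v" for r b
      by (simp add: cscale_def vec_eq_iff scaleR_prod_def)
  qed
  then have "((\<lambda>u. p + cscale u v) has_derivative (\<lambda>u. cscale u v)) (at u)"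
    using bounded_linear_imp_has_derivative[of "\<lambda>u. cscale u v" "at u"]
    by (auto intro!: derivative_eq_intros)
  from diff_chain_at[OF this f'(1)]
  have "((\<lambda>u. f (p + cscale u v)) has_derivative (\<lambda>u. u * f' v)) (at u)"
    by (simp add: o_def f'(2))
  then show ?thesis
    unfolding field_differentiable_def has_field_derivative_def
    by (metis (no_types, lifting) ext mult.commute)
qed

section \<open>The inner product of the Bergman space\<close>

lemma bergman_space_measurable:
  assumes "open D" "f \<in> bergman_space D"
  shows "set_borel_measurable lborel D f"
proof -
  have "continuous_on D f"
    using assms(2) holomorphic_sev_imp_continuous_on by (auto simp: bergman_space_def)
  then show ?thesis
    using assms(1) borel_measurable_continuous_on_indicator[of D f]
    by (simp add: set_borel_measurable_def set_integrable_def)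
qed

lemma bergman_space_integrable:
  assumes "open D" "f \<in> bergman_space D" "g \<in> bergman_space D"
  shows "set_integrable lborel D (\<lambda>p. f p * cnj (g p))"
proof -
  let ?i = "\<lambda>p. indicator D p :: real"
  have *: "?i p *\<^sub>R (x p * cnj (y p)) = (?i p *\<^sub>R x p) * cnj (?i p *\<^sub>R y p)" for p x y
    by (auto simp: indicator_def)
  have m: "(\<lambda>x. ?i x *\<^sub>R h x) \<in> borel_measurable borel" if "h \<in> bergman_space D" for h
    using bergman_space_measurable[OF assms(1) that] by (simp add: set_borel_measurable_def)
  have cm: "cnj \<in> borel_measurable borel"
    by (intro borel_measurable_continuous_onI continuous_intros)
  show ?thesis unfolding set_integrable_def
  proof (rule Bochner_Integration.integrable_bound)
    show "integrable lborel (\<lambda>p. ?i p *\<^sub>R (cmod (f p))\<^sup>2 + ?i p *\<^sub>R (cmod (g p))\<^sup>2)"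
      using assms by (auto simp: bergman_space_def set_integrable_def)
    show "(\<lambda>p. ?i p *\<^sub>R (f p * cnj (g p))) \<in> borel_measurable lborel"
      unfolding * measurable_lborel1
      by (intro borel_measurable_times measurable_compose[OF _ cm])
         (simp_all only: measurable_lborel2 m assms)
    have "cmod a * cmod b \<le> (cmod a)\<^sup>2 + (cmod b)\<^sup>2" for a b
      using sum_squares_bound[of "cmod a" "cmod b"]
      using mult_nonneg_nonneg[of "cmod a" "cmod b"] norm_ge_zero[of a] norm_ge_zero[of b] by linarith
    then show "AE p in lborel. norm (?i p *\<^sub>R (f p * cnj (g p))) \<le> norm (?i p *\<^sub>R (cmod (f p))\<^sup>2 + ?i p *\<^sub>R (cmod (g p))\<^sup>2)"
      by (auto simp: norm_mult indicator_def)
  qed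
qed

lemma bergman_spaceI:
  assumes "open D" "holomorphic_sev f D" "set_integrable lborel D (\<lambda>p. f p * cnj (f p))"
  shows "f \<in> bergman_space D"
proof -
  have "set_integrable lborel D (\<lambda>p. (cmod (f p))\<^sup>2)"
    using set_integrable_norm[OF assms(3)] by (simp add: norm_mult power2_eq_square)
  then show ?thesis using assms by (simp add: bergman_space_def)
qed

lemma bergman_space_zero: "(\<lambda>p. 0) \<in> bergman_space D"
  by (auto simp: bergman_space_def set_integrable_def intro: holomorphic_sev_const)

lemma bergman_space_scale:
  assumes "f \<in> bergman_space D" shows "(\<lambda>p. c * f p) \<in> bergman_space D"
proof -
  have "set_integrable lborel D (\<lambda>p. (cmod (c * f p))\<^sup>2)"
    using assms unfolding bergman_space_def by (auto simp: norm_mult power_mult_distrib)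
  then show ?thesis using assms
    by (auto simp: bergman_space_def intro: holomorphic_sev_const holomorphic_sev_mult)
qed

lemma bergman_space_add:
  assumes "open D" "f \<in> bergman_space D" "g \<in> bergman_space D"
  shows "(\<lambda>p. f p + g p) \<in> bergman_space D"
proof (rule bergman_spaceI)
  show "holomorphic_sev (\<lambda>p. f p + g p) D"
    using assms by (auto simp: bergman_space_def intro: holomorphic_sev_add)
  have "set_integrable lborel D (\<lambda>p. (f p * cnj (f p) + f p * cnj (g p)) + (g p * cnj (f p) + g p * cnj (g p)))"
    using assms by (intro set_integral_add bergman_space_integrable)
  moreover have "(f p + g p) * cnj (f p + g p)
      = (f p * cnj (f p) + f p * cnj (g p)) + (g p * cnj (f p) + g p * cnj (g p))" for p
    by (simp add: algebra_simps)
  ultimately show "set_integrable lborel D (\<lambda>p. (f p + g p) * cnj (f p + g p))"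
    by presburger
qed fact

lemma bergman_space_diff:
  assumes "open D" "f \<in> bergman_space D" "g \<in> bergman_space D"
  shows "(\<lambda>p. f p - g p) \<in> bergman_space D"
  using bergman_space_add[OF assms(1,2) bergman_space_scale[OF assms(3), of "-1"]] by simp

lemma bergman_space_sum:
  assumes "open D" "finite S" "S \<subseteq> bergman_space D"
  shows "(\<lambda>p. \<Sum>\<phi>\<in>S. c \<phi> * \<phi> p) \<in> bergman_space D"
  using assms(2,3)
proof (induction)
  case empty
  then show ?case by (simp add: bergman_space_zero)
next
  case (insert \<phi> S)
  have "(\<lambda>p. c \<phi> * \<phi> p + (\<Sum>\<phi>\<in>S. c \<phi> * \<phi> p)) \<in> bergman_space D"
    using insert by (intro bergman_space_add[OF assms(1)] bergman_space_scale) auto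
  then show ?case using insert by simp
qed

lemma l2_inner_add_left:
  assumes "open D" "f \<in> bergman_space D" "g \<in> bergman_space D" "h \<in> bergman_space D"
  shows "l2_inner D (\<lambda>p. f p + g p) h = l2_inner D f h + l2_inner D g h"
proof -
  have "set_integrable lborel D (\<lambda>p. f p * cnj (h p))" "set_integrable lborel D (\<lambda>p. g p * cnj (h p))"
    by (rule bergman_space_integrable; fact)+
  from set_integral_add(2)[OF this] show ?thesis
    unfolding l2_inner_def distrib_right .
qed

lemma l2_inner_scale_left: "l2_inner D (\<lambda>p. c * f p) h = c * l2_inner D f h"
  unfolding l2_inner_def by (simp add: mult.assoc)

lemma l2_inner_cnj: "cnj (l2_inner D f g) = l2_inner D g f"
proof -
  have "cnj (l2_inner D f g) = (LINT p|lborel. cnj (indicator D p *\<^sub>R (f p * cnj (g p))))"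
    unfolding l2_inner_def set_lebesgue_integral_def by (rule Bochner_Integration.integral_cnj[symmetric])
  then show ?thesis
    unfolding l2_inner_def set_lebesgue_integral_def by (simp add: mult.commute)
qed

lemma l2_inner_diff_left:
  assumes "open D" "f \<in> bergman_space D" "g \<in> bergman_space D" "h \<in> bergman_space D"
  shows "l2_inner D (\<lambda>p. f p - g p) h = l2_inner D f h - l2_inner D g h"
  using l2_inner_add_left[OF assms(1,2) bergman_space_scale[OF assms(3), of "-1"] assms(4)]
    l2_inner_scale_left[of D "-1" g h] by simp

lemma l2_inner_add_right:
  assumes "open D" "f \<in> bergman_space D" "g \<in> bergman_space D" "h \<in> bergman_space D"
  shows "l2_inner D h (\<lambda>p. f p + g p) = l2_inner D h f + l2_inner D h g"
  using l2_inner_add_left[OF assms, THEN arg_cong, of cnj] by (simp add: l2_inner_cnj)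

lemma l2_inner_diff_right:
  assumes "open D" "f \<in> bergman_space D" "g \<in> bergman_space D" "h \<in> bergman_space D"
  shows "l2_inner D h (\<lambda>p. f p - g p) = l2_inner D h f - l2_inner D h g"
  using l2_inner_diff_left[OF assms, THEN arg_cong, of cnj] by (simp add: l2_inner_cnj)

lemma l2_inner_scale_right: "l2_inner D h (\<lambda>p. c * f p) = cnj c * l2_inner D h f"
  using l2_inner_scale_left[of D c f h, THEN arg_cong, of cnj] by (simp add: l2_inner_cnj)

lemma l2_inner_zero_left: "l2_inner D (\<lambda>p. 0) h = 0"
  by (simp add: l2_inner_def)

lemma l2_inner_sum_left:
  assumes "open D" "finite S" "S \<subseteq> bergman_space D" "h \<in> bergman_space D"
  shows "l2_inner D (\<lambda>p. \<Sum>\<phi>\<in>S. c \<phi> * \<phi> p) h = (\<Sum>\<phi>\<in>S. c \<phi> * l2_inner D \<phi> h)"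
  using assms(2,3)
proof (induction)
  case empty
  then show ?case by (simp add: l2_inner_zero_left)
next
  case (insert x F)
  then show ?case
    by (simp add: l2_inner_add_left assms bergman_space_sum bergman_space_scale l2_inner_scale_left)
qed

lemma l2_inner_self: "l2_inner D f f = of_real ((l2_norm D f)\<^sup>2)"
proof -
  have "0 \<le> (LINT p:D|lborel. (cmod (f p))\<^sup>2)"
    unfolding set_lebesgue_integral_def by (intro integral_nonneg_AE) auto
  then have "of_real ((l2_norm D f)\<^sup>2) = (LINT p:D|lborel. complex_of_real ((cmod (f p))\<^sup>2))"
    unfolding l2_norm_def set_integral_complex_of_real by simp
  moreover have "f p * cnj (f p) = complex_of_real ((cmod (f p))\<^sup>2)" for p
    by (simp only: complex_norm_square)
  ultimately show ?thesis
    unfolding l2_inner_def by simp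
qed

lemma l2_norm_nonneg: "0 \<le> l2_norm D f"
  unfolding l2_norm_def set_lebesgue_integral_def
  by (intro real_sqrt_ge_zero integral_nonneg_AE) auto

lemma l2_norm_diff_scale:
  assumes "open D" "f \<in> bergman_space D" "g \<in> bergman_space D"
  shows "(l2_norm D (\<lambda>p. f p - t * g p))\<^sup>2
       = (l2_norm D f)\<^sup>2 - 2 * Re (cnj t * l2_inner D f g) + (cmod t)\<^sup>2 * (l2_norm D g)\<^sup>2"
proof -
  have tg: "(\<lambda>p. t * g p) \<in> bergman_space D" "(\<lambda>p. f p - t * g p) \<in> bergman_space D"
    using assms by (auto intro: bergman_space_scale bergman_space_diff)
  have *: "l2_inner D g f = cnj (l2_inner D f g)"
    by (simp add: l2_inner_cnj)
  have "complex_of_real ((l2_norm D (\<lambda>p. f p - t * g p))\<^sup>2)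
      = l2_inner D f f - cnj t * l2_inner D f g - t * l2_inner D g f + t * cnj t * l2_inner D g g"
    unfolding l2_inner_self[symmetric]
    using assms tg by (simp add: l2_inner_diff_left l2_inner_diff_right l2_inner_scale_left
        l2_inner_scale_right algebra_simps)
  also have "\<dots> = complex_of_real ((l2_norm D f)\<^sup>2) - (cnj t * l2_inner D f g + cnj (cnj t * l2_inner D f g))
       + complex_of_real ((cmod t)\<^sup>2 * (l2_norm D g)\<^sup>2)"
    unfolding l2_inner_self * by (simp add: complex_norm_square[of t, simplified] algebra_simps)
  finally show ?thesis
    unfolding complex_add_cnj by (metis (no_types, lifting) Re_complex_of_real minus_complex.simps(1) plus_complex.simps(1))
qed

text \<open>
  The form is only semidefinite, since it ignores values outside \<open>D\<close>.  Hence the case of a null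
  vector \<open>g\<close> needs its own argument: there \<open>\<parallel>f - t\<langle>f, g\<rangle>g\<parallel>\<^sup>2\<close> is affine in \<open>t\<close> and
  nonnegative, hence constant.
\<close>
lemma l2_cauchy_schwarz:
  assumes "open D" "f \<in> bergman_space D" "g \<in> bergman_space D"
  shows "cmod (l2_inner D f g) \<le> l2_norm D f * l2_norm D g"
proof -
  define z where "z = l2_inner D f g"
  define a where "a = l2_norm D f"
  define b where "b = l2_norm D g"
  have ab: "a \<ge> 0" "b \<ge> 0" by (simp_all add: a_def b_def l2_norm_nonneg)
  have q: "0 \<le> a\<^sup>2 - 2 * t * (cmod z)\<^sup>2 + t\<^sup>2 * (cmod z)\<^sup>2 * b\<^sup>2" for t :: real
  proof -
    have "Re (cnj (of_real t * z) * z) = t * (cmod z)\<^sup>2"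
      unfolding cmod_power2 by (simp add: algebra_simps power2_eq_square)
    then show ?thesis
      using l2_norm_diff_scale[OF assms, of "of_real t * z"] zero_le_power2[of "l2_norm D (\<lambda>p. f p - of_real t * z * g p)"]
      unfolding z_def[symmetric] a_def[symmetric] b_def[symmetric]
      by (simp add: norm_mult power_mult_distrib)
  qed
  have "(cmod z)\<^sup>2 \<le> a\<^sup>2 * b\<^sup>2"
  proof (cases "b = 0")
    case True
    have "(cmod z)\<^sup>2 = 0"
    proof (rule ccontr)
      assume n: "(cmod z)\<^sup>2 \<noteq> 0"
      \<comment> \<open>This parameter makes the affine function in \<open>q\<close> negative.\<close>
      then have "2 * ((a\<^sup>2 + 1) / (cmod z)\<^sup>2) * (cmod z)\<^sup>2 = 2 * (a\<^sup>2 + 1)"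
        by simp
      then show False using q[of "(a\<^sup>2 + 1) / (cmod z)\<^sup>2"] True zero_le_power2[of a]
        by simp
    qed
    then show ?thesis by simp
  next
    case False
    have "0 \<le> a\<^sup>2 - (cmod z)\<^sup>2 / b\<^sup>2"
      using q[of "1 / b\<^sup>2"] False by (simp add: field_simps power2_eq_square)
    then show ?thesis using False by (simp add: field_simps)
  qed
  then show ?thesis
    using ab power2_le_imp_le[of "cmod z" "a * b"] by (simp add: z_def a_def b_def power_mult_distrib)
qed

section \<open>Orthonormal families and Parseval's identity\<close>

definition orthonormal_family ::
    "(complex \<times> (complex ^ 'n::finite)) set \<Rightarrow> (complex \<times> (complex ^ 'n) \<Rightarrow> complex) set \<Rightarrow> bool"
where
  "orthonormal_family D S \<longleftrightarrow> S \<subseteq> bergman_space D \<and>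
     (\<forall>\<phi>\<in>S. \<forall>\<psi>\<in>S. l2_inner D \<phi> \<psi> = (if \<phi> = \<psi> then 1 else 0))"

text \<open>
  What is left of \<open>f\<close> after orthogonal projection to the span of \<open>S\<close>, when \<open>S\<close> is finite and
  orthonormal.
\<close>
definition residual ::
    "(complex \<times> (complex ^ 'n::finite)) set \<Rightarrow> (complex \<times> (complex ^ 'n) \<Rightarrow> complex) set
      \<Rightarrow> (complex \<times> (complex ^ 'n) \<Rightarrow> complex) \<Rightarrow> complex \<times> (complex ^ 'n) \<Rightarrow> complex" where
  "residual D S f = (\<lambda>p. f p - (\<Sum>\<phi>\<in>S. l2_inner D f \<phi> * \<phi> p))"

lemma residual_in_bergman_space:
  assumes "open D" "finite S" "orthonormal_family D S" "f \<in> bergman_space D"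
  shows "residual D S f \<in> bergman_space D"
  using assms unfolding residual_def orthonormal_family_def
  by (intro bergman_space_diff bergman_space_sum) auto

lemma residual_orthogonal:
  assumes "open D" "finite S" "orthonormal_family D S" "f \<in> bergman_space D" "\<psi> \<in> S"
  shows "l2_inner D (residual D S f) \<psi> = 0"
proof -
  have S: "S \<subseteq> bergman_space D" "\<psi> \<in> bergman_space D"
    using assms by (auto simp: orthonormal_family_def)
  have "l2_inner D (residual D S f) \<psi>
      = l2_inner D f \<psi> - (\<Sum>\<phi>\<in>S. l2_inner D f \<phi> * l2_inner D \<phi> \<psi>)"
    unfolding residual_def
    by (simp add: l2_inner_diff_left l2_inner_sum_left bergman_space_sum assms S)
  also have "(\<Sum>\<phi>\<in>S. l2_inner D f \<phi> * l2_inner D \<phi> \<psi>)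
      = (\<Sum>\<phi>\<in>S. if \<phi> = \<psi> then l2_inner D f \<phi> else 0)"
    using assms by (intro sum.cong) (auto simp: orthonormal_family_def)
  also have "\<dots> = l2_inner D f \<psi>"
    using assms by simp
  finally show ?thesis by simp
qed

lemma residual_orthogonal_span:
  assumes "open D" "finite S" "orthonormal_family D S" "f \<in> bergman_space D" "T \<subseteq> S"
  shows "l2_inner D (\<lambda>p. \<Sum>\<phi>\<in>T. c \<phi> * \<phi> p) (residual D S f) = 0"
proof -
  have "l2_inner D \<phi> (residual D S f) = 0" if "\<phi> \<in> T" for \<phi>
    using residual_orthogonal[OF assms(1-4), of \<phi>] that assms(5)
    by (metis complex_cnj_zero l2_inner_cnj subsetD)
  moreover have "finite T" "T \<subseteq> bergman_space D"
    using assms finite_subset by (auto simp: orthonormal_family_def)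
  ultimately show ?thesis
    using assms residual_in_bergman_space[OF assms(1-4)] by (simp add: l2_inner_sum_left)
qed

text \<open>
  This is Bessel's inequality.  As the residual \<open>r\<close> is orthogonal to the span,
  \<open>\<parallel>r\<parallel>\<^sup>2 = \<langle>f, r\<rangle> \<le> \<parallel>f\<parallel> \<parallel>r\<parallel>\<close>.
\<close>
lemma l2_norm_residual_le:
  assumes "open D" "finite S" "orthonormal_family D S" "f \<in> bergman_space D"
  shows "l2_norm D (residual D S f) \<le> l2_norm D f"
proof -
  define r where "r = residual D S f"
  define c where "c = l2_inner D f"
  have r: "r \<in> bergman_space D" "(\<lambda>p. \<Sum>\<phi>\<in>S. c \<phi> * \<phi> p) \<in> bergman_space D"
    using residual_in_bergman_space[OF assms] bergman_space_sum assms
    by (auto simp: r_def orthonormal_family_def)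
  have eq: "r = (\<lambda>p. f p - (\<Sum>\<phi>\<in>S. c \<phi> * \<phi> p))"
    by (simp add: r_def residual_def c_def)
  have "l2_inner D r r = l2_inner D f r - l2_inner D (\<lambda>p. \<Sum>\<phi>\<in>S. c \<phi> * \<phi> p) r"
    using l2_inner_diff_left[OF assms(1) assms(4) r(2) r(1)] by (simp add: eq)
  also have "\<dots> = l2_inner D f r"
    using residual_orthogonal_span[OF assms order_refl] by (simp add: r_def)
  finally have "complex_of_real ((l2_norm D r)\<^sup>2) = l2_inner D f r"
    by (simp only: l2_inner_self)
  then have "(l2_norm D r)\<^sup>2 = cmod (l2_inner D f r)"
    by (metis abs_of_nonneg norm_of_real zero_le_power2)
  also have "\<dots> \<le> l2_norm D f * l2_norm D r"
    by (rule l2_cauchy_schwarz[OF assms(1,4) r(1)])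
  finally have "l2_norm D r * l2_norm D r \<le> l2_norm D f * l2_norm D r"
    by (simp add: power2_eq_square)
  then show ?thesis
    using l2_norm_nonneg[of D r] l2_norm_nonneg[of D f] unfolding r_def[symmetric]
    by (cases "l2_norm D r = 0") auto
qed

text \<open>
  For finite \<open>T\<close> the error of the partial sum is \<open>\<langle>f, r\<rangle>\<close> with \<open>r\<close> the residual of
  \<open>g\<close>.  Since \<open>r\<close> is orthogonal to the span of \<open>T\<close>, any approximation of \<open>f\<close> from
  that span may be subtracted from \<open>f\<close>, so the error is at most \<open>\<epsilon> \<parallel>g\<parallel>\<close> as soon
  as \<open>T\<close> contains the basis functions of one approximation of \<open>f\<close> within \<open>\<epsilon>\<close>.
\<close>
lemma parseval:
  assumes D: "open D" and B: "complete_orthonormal_basis D B"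
    and f: "f \<in> bergman_space D" and g: "g \<in> bergman_space D"
  shows "((\<lambda>\<phi>. l2_inner D f \<phi> * cnj (l2_inner D g \<phi>)) has_sum l2_inner D f g) B"
  unfolding has_sum_def tendsto_iff eventually_finite_subsets_at_top
proof (intro allI impI)
  fix e :: real assume e: "e > 0"
  define \<epsilon> where "\<epsilon> = e / (l2_norm D g + 1)"
  have "\<epsilon> > 0" using e l2_norm_nonneg[of D g] by (simp add: \<epsilon>_def add_nonneg_pos)
  then obtain S c where S: "finite S" "S \<subseteq> B" and
    *: "l2_norm D (\<lambda>p. f p - (\<Sum>\<phi>\<in>S. c \<phi> * \<phi> p)) < \<epsilon>"
    using B f unfolding complete_orthonormal_basis_def by blast
  define h where "h = (\<lambda>p. f p - (\<Sum>\<phi>\<in>S. c \<phi> * \<phi> p))"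
  have "dist (\<Sum>\<phi>\<in>T. l2_inner D f \<phi> * cnj (l2_inner D g \<phi>)) (l2_inner D f g) < e"
    if T: "finite T" "S \<subseteq> T" "T \<subseteq> B" for T
  proof -
    have on: "orthonormal_family D T"
      using B T unfolding complete_orthonormal_basis_def orthonormal_family_def by blast
    then have TD: "T \<subseteq> bergman_space D" "S \<subseteq> bergman_space D"
      using T by (auto simp: orthonormal_family_def)
    define r where "r = residual D T g"
    have r: "r \<in> bergman_space D"
      unfolding r_def using residual_in_bergman_space[OF D T(1) on g] .
    have span: "(\<lambda>p. \<Sum>\<phi>\<in>S. c \<phi> * \<phi> p) \<in> bergman_space D" "h \<in> bergman_space D"
      unfolding h_def using D S TD f by (auto intro!: bergman_space_sum bergman_space_diff)
    have "l2_inner D f r = l2_inner D f g - l2_inner D f (\<lambda>p. \<Sum>\<phi>\<in>T. l2_inner D g \<phi> * \<phi> p)"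
      unfolding r_def residual_def using D f g T TD
      by (intro l2_inner_diff_right bergman_space_sum) auto
    also have "l2_inner D f (\<lambda>p. \<Sum>\<phi>\<in>T. l2_inner D g \<phi> * \<phi> p)
        = cnj (l2_inner D (\<lambda>p. \<Sum>\<phi>\<in>T. l2_inner D g \<phi> * \<phi> p) f)"
      by (simp add: l2_inner_cnj)
    also have "\<dots> = (\<Sum>\<phi>\<in>T. l2_inner D f \<phi> * cnj (l2_inner D g \<phi>))"
      using D f T TD by (subst l2_inner_sum_left) (auto simp: l2_inner_cnj mult.commute)
    finally have "dist (\<Sum>\<phi>\<in>T. l2_inner D f \<phi> * cnj (l2_inner D g \<phi>)) (l2_inner D f g)
        = cmod (l2_inner D f r)"
      by (simp add: dist_norm norm_minus_commute)
    also have "l2_inner D f r = l2_inner D h r"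
      using l2_inner_diff_left[OF D f span(1) r] residual_orthogonal_span[OF D T(1) on g T(2), of c]
      by (simp add: h_def r_def)
    also have "cmod \<dots> \<le> l2_norm D h * l2_norm D r"
      by (rule l2_cauchy_schwarz[OF D span(2) r])
    also have "\<dots> \<le> \<epsilon> * l2_norm D g"
      using * l2_norm_residual_le[OF D T(1) on g] l2_norm_nonneg \<open>\<epsilon> > 0\<close>
      by (intro mult_mono) (auto simp: h_def r_def)
    also have "\<dots> < e"
      using e l2_norm_nonneg[of D g] by (simp add: \<epsilon>_def field_simps add_nonneg_pos)
    finally show ?thesis .
  qed
  with S show "\<exists>X. finite X \<and> X \<subseteq> B \<and> (\<forall>Y. finite Y \<and> X \<subseteq> Y \<and> Y \<subseteq> B \<longrightarrow>
      dist (\<Sum>\<phi>\<in>Y. l2_inner D f \<phi> * cnj (l2_inner D g \<phi>)) (l2_inner D f g) < e)"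
    by blast
qed

text \<open>
  The coefficients of \<open>k\<^sub>p\<close> and \<open>k\<^sub>q\<close> in a basis are the conjugates of the values of the basis
  functions, so the kernel series is the Parseval series of \<open>\<langle>k\<^sub>q, k\<^sub>p\<rangle>\<close>.
\<close>
lemma bergman_kernel_eq_reproducing:
  assumes D: "open D" and ex: "complete_orthonormal_basis D B\<^sub>0"
    and kp: "k\<^sub>p \<in> bergman_space D" "\<And>f. f \<in> bergman_space D \<Longrightarrow> l2_inner D f k\<^sub>p = f p"
    and kq: "k\<^sub>q \<in> bergman_space D" "\<And>f. f \<in> bergman_space D \<Longrightarrow> l2_inner D f k\<^sub>q = f q"
  shows "bergman_kernel D p q = k\<^sub>q p"
proof -
  have sum: "((\<lambda>\<phi>. \<phi> p * cnj (\<phi> q)) has_sum k\<^sub>q p) B" if B: "complete_orthonormal_basis D B" for B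
  proof -
    have "((\<lambda>\<phi>. l2_inner D k\<^sub>q \<phi> * cnj (l2_inner D k\<^sub>p \<phi>)) has_sum l2_inner D k\<^sub>q k\<^sub>p) B"
      using parseval[OF D B kq(1) kp(1)] .
    also have "l2_inner D k\<^sub>q k\<^sub>p = k\<^sub>q p"
      using kp(2)[OF kq(1)] .
    finally show ?thesis
    proof (rule has_sum_cong[THEN iffD1, rotated])
      fix \<phi> assume "\<phi> \<in> B"
      then have "\<phi> \<in> bergman_space D"
        using B by (auto simp: complete_orthonormal_basis_def)
      then have "l2_inner D k\<^sub>q \<phi> = cnj (\<phi> q)" "l2_inner D k\<^sub>p \<phi> = cnj (\<phi> p)"
        using kp(2) kq(2) by (metis l2_inner_cnj)+
      then show "l2_inner D k\<^sub>q \<phi> * cnj (l2_inner D k\<^sub>p \<phi>) = \<phi> p * cnj (\<phi> q)"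
        by simp
    qed
  qed
  show ?thesis
    unfolding bergman_kernel_def using sum ex by (intro the_equality) (blast intro: has_sum_unique)+
qed

section \<open>Separability and existence of an orthonormal basis\<close>

lemma l2_norm_triangle:
  assumes "open D" "f \<in> bergman_space D" "g \<in> bergman_space D"
  shows "l2_norm D (\<lambda>p. f p + g p) \<le> l2_norm D f + l2_norm D g"
proof (rule power2_le_imp_le)
  have "(l2_norm D (\<lambda>p. f p + g p))\<^sup>2
      = (l2_norm D f)\<^sup>2 + 2 * Re (l2_inner D f g) + (l2_norm D g)\<^sup>2"
    using l2_norm_diff_scale[OF assms, of "-1"] by simp
  also have "\<dots> \<le> (l2_norm D f)\<^sup>2 + 2 * (l2_norm D f * l2_norm D g) + (l2_norm D g)\<^sup>2"
    using l2_cauchy_schwarz[OF assms] complex_Re_le_cmod[of "l2_inner D f g"] by simp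
  finally show "(l2_norm D (\<lambda>p. f p + g p))\<^sup>2 \<le> (l2_norm D f + l2_norm D g)\<^sup>2"
    by (simp add: power2_eq_square algebra_simps)
qed (simp add: l2_norm_nonneg)

text \<open>
  The pairs \<open>(U, v)\<close> in \<open>d\<close> describe \<open>f\<close> up to \<open>\<delta>\<close>: on \<open>U\<close> the function is
  nearly equal to the constant \<open>v\<close>, and outside the union of the \<open>U\<close> it has small norm.
  When the \<open>U\<close> range over a countable base and the \<open>v\<close> over a countable dense set there are only
  countably many finite \<open>d\<close>.
\<close>
definition approx_data ::
    "(complex \<times> (complex ^ 'n::finite)) set \<Rightarrow> real \<Rightarrow> (complex \<times> (complex ^ 'n) \<Rightarrow> complex)
      \<Rightarrow> ((complex \<times> (complex ^ 'n)) set \<times> complex) set \<Rightarrow> bool" where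
  "approx_data D \<delta> f d \<longleftrightarrow>
     (\<forall>(U, v)\<in>d. \<forall>p\<in>U \<inter> D. cmod (f p - v) < \<delta>) \<and>
     (LINT p:D - \<Union>(fst ` d)|lborel. (cmod (f p))\<^sup>2) < \<delta>\<^sup>2"

lemma set_integrable_tail:
  assumes "open D" "f \<in> bergman_space D" "open V"
  shows "set_integrable lborel (D - V) (\<lambda>p. (cmod (f p))\<^sup>2)"
proof (rule set_integrable_subset)
  show "set_integrable lborel D (\<lambda>p. (cmod (f p))\<^sup>2)"
    using assms(2) by (simp add: bergman_space_def)
qed (use assms in auto)

text \<open>
  On a set \<open>U\<close> occurring in \<open>d\<close> the functions differ by less than \<open>2\<delta>\<close>, and off these sets
  both are small in norm.
\<close>
lemma approx_data_close:
  assumes D: "open D" "emeasure lborel D < \<infinity>"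
    and f: "f \<in> bergman_space D" "approx_data D \<delta> f d"
    and g: "g \<in> bergman_space D" "approx_data D \<delta> g d"
    and d: "\<And>U v. (U, v) \<in> d \<Longrightarrow> open U"
  shows "(l2_norm D (\<lambda>p. f p - g p))\<^sup>2 \<le> 4 * \<delta>\<^sup>2 * (measure lborel D + 1)"
proof -
  let ?V = "\<Union>(fst ` d)"
  let ?i = "\<lambda>A p. indicator A p :: real"
  have V: "open ?V" using d by (force intro!: open_Union)
  have int: "integrable lborel (\<lambda>p. ?i (D - ?V) p *\<^sub>R (cmod (h p))\<^sup>2)" if "h \<in> bergman_space D" for h
    using set_integrable_tail[OF D(1) that V] by (simp add: set_integrable_def)
  have intD: "integrable lborel (?i D)"
    using D by (simp add: integrable_indicator_iff)
  have fg: "(\<lambda>p. f p - g p) \<in> bergman_space D"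
    using D f g by (auto intro: bergman_space_diff)
  have "(l2_norm D (\<lambda>p. f p - g p))\<^sup>2 = (LINT p|lborel. ?i D p *\<^sub>R (cmod (f p - g p))\<^sup>2)"
    unfolding l2_norm_def set_lebesgue_integral_def
    by (intro real_sqrt_pow2 integral_nonneg_AE) auto
  also have "\<dots> \<le> (LINT p|lborel. (4 * \<delta>\<^sup>2) * ?i D p + (2 * (?i (D - ?V) p *\<^sub>R (cmod (f p))\<^sup>2)
       + 2 * (?i (D - ?V) p *\<^sub>R (cmod (g p))\<^sup>2)))"
  proof (rule integral_mono)
    show "integrable lborel (\<lambda>p. ?i D p *\<^sub>R (cmod (f p - g p))\<^sup>2)"
      using fg by (simp add: bergman_space_def set_integrable_def)
    show "integrable lborel (\<lambda>p. (4 * \<delta>\<^sup>2) * ?i D p + (2 * (?i (D - ?V) p *\<^sub>R (cmod (f p))\<^sup>2)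
       + 2 * (?i (D - ?V) p *\<^sub>R (cmod (g p))\<^sup>2)))"
      by (intro Bochner_Integration.integrable_add integrable_mult_right int f g intD)
    fix p
    show "?i D p *\<^sub>R (cmod (f p - g p))\<^sup>2 \<le> (4 * \<delta>\<^sup>2) * ?i D p + (2 * (?i (D - ?V) p *\<^sub>R (cmod (f p))\<^sup>2)
       + 2 * (?i (D - ?V) p *\<^sub>R (cmod (g p))\<^sup>2))"
    proof (cases "p \<in> D")
      case False
      then show ?thesis by simp
    next
      case True
      show ?thesis
      proof (cases "p \<in> ?V")
        case True
        then obtain U v where "(U, v) \<in> d" "p \<in> U" by auto
        then have "cmod (f p - v) < \<delta>" "cmod (g p - v) < \<delta>"
          using f(2) g(2) \<open>p \<in> D\<close> unfolding approx_data_def by fast+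
        then have "cmod (f p - g p) \<le> 2 * \<delta>"
          using norm_triangle_ineq4[of "f p - v" "g p - v"] by simp
        then have "(cmod (f p - g p))\<^sup>2 \<le> (2 * \<delta>)\<^sup>2"
          by (intro power_mono) auto
        then show ?thesis using True \<open>p \<in> D\<close> by (simp add: power_mult_distrib)
      next
        case False
        have "(cmod (f p - g p))\<^sup>2 \<le> (cmod (f p) + cmod (g p))\<^sup>2"
          by (intro power_mono norm_triangle_ineq4) auto
        also have "\<dots> \<le> 2 * (cmod (f p))\<^sup>2 + 2 * (cmod (g p))\<^sup>2"
          using sum_squares_bound[of "cmod (f p)" "cmod (g p)"] by (simp add: power2_sum)
        finally show ?thesis using False \<open>p \<in> D\<close> by simp (smt (verit) zero_le_power2)
      qed
    qed
  qed
  also have "\<dots> = 4 * \<delta>\<^sup>2 * measure lborel D + (2 * (LINT p:D - ?V|lborel. (cmod (f p))\<^sup>2)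
       + 2 * (LINT p:D - ?V|lborel. (cmod (g p))\<^sup>2))"
    unfolding set_lebesgue_integral_def using int f g intD D
    by (simp add: integral_add integral_mult_right integral_indicator)
  also have "\<dots> \<le> 4 * \<delta>\<^sup>2 * measure lborel D + (2 * \<delta>\<^sup>2 + 2 * \<delta>\<^sup>2)"
    using f(2) g(2) unfolding approx_data_def by (intro add_mono mult_left_mono) auto
  finally show ?thesis by (simp add: algebra_simps)
qed

text \<open>
  By continuity the pairs \<open>(U, v)\<close> with \<open>f\<close> close to \<open>v\<close> on \<open>U\<close> cover \<open>D\<close>.  They can
  be enumerated, and by dominated convergence the norm of \<open>f\<close> off the first \<open>N\<close> of the sets tends to
  0.  The empty set is admitted as \<open>U\<close> so that there is at least one pair even for empty \<open>D\<close>.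
\<close>
lemma approx_data_exists:
  fixes D :: "(complex \<times> (complex ^ 'n::finite)) set"
  assumes D: "open D" and f: "f \<in> bergman_space D" and "\<delta> > 0"
    and basis: "topological_basis \<B>" "countable \<B>" "\<And>U. U \<in> \<B> \<Longrightarrow> open U"
    and Q: "countable Q" "\<And>X. open X \<Longrightarrow> X \<noteq> {} \<Longrightarrow> \<exists>v\<in>Q. v \<in> X"
  shows "\<exists>d. finite d \<and> d \<subseteq> insert {} \<B> \<times> (Q :: complex set) \<and> approx_data D \<delta> f d"
proof -
  define P where "P = {(U, v) \<in> insert {} \<B> \<times> Q. \<forall>p\<in>U \<inter> D. cmod (f p - v) < \<delta>}"
  have "countable (insert {} \<B> \<times> Q)" using basis Q by simp
  then have cP: "countable P"
    by (rule countable_subset[rotated]) (auto simp: P_def)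
  obtain v\<^sub>0 where "v\<^sub>0 \<in> Q" using Q(2)[of UNIV] by auto
  then have neP: "P \<noteq> {}" by (auto simp: P_def)
  have cov: "\<exists>U v. (U, v) \<in> P \<and> p \<in> U" if "p \<in> D" for p
  proof -
    obtain v where v: "v \<in> Q" "v \<in> ball (f p) (\<delta> / 2)"
      using Q(2)[of "ball (f p) (\<delta> / 2)"] \<open>\<delta> > 0\<close> by auto
    have "continuous_on D f"
      using f by (auto simp: bergman_space_def intro: holomorphic_sev_imp_continuous_on)
    then have "open (D \<inter> f -` ball (f p) (\<delta> / 2))"
      using D by (intro continuous_open_preimage) auto
    moreover have "p \<in> D \<inter> f -` ball (f p) (\<delta> / 2)"
      using that \<open>\<delta> > 0\<close> by auto
    ultimately obtain U where U: "U \<in> \<B>" "p \<in> U" "U \<subseteq> D \<inter> f -` ball (f p) (\<delta> / 2)"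
      using topological_basisE[OF basis(1)] by metis
    have "cmod (f q - v) < \<delta>" if "q \<in> U" for q
    proof -
      have "dist (f p) (f q) < \<delta> / 2" "dist (f p) v < \<delta> / 2"
        using U that v by auto
      then show ?thesis
        using dist_triangle_half_r by (metis dist_norm)
    qed
    then have "(U, v) \<in> P" using U v by (auto simp: P_def)
    with U show ?thesis by blast
  qed
  define V where "V N = \<Union>(fst ` from_nat_into P ` {..<N})" for N :: nat
  have inP: "from_nat_into P i \<in> P" for i
    using neP by (rule from_nat_into)
  have oV: "open (V N)" for N
  proof -
    have "open (fst x)" if "x \<in> P" for x using that basis(3) by (auto simp: P_def)
    then show ?thesis unfolding V_def using inP by (intro open_Union) auto
  qed
  have "(\<lambda>N. LINT p|lborel. indicator (D - V N) p *\<^sub>R (cmod (f p))\<^sup>2)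
      \<longlonglongrightarrow> (LINT p|(lborel :: (complex \<times> (complex ^ 'n)) measure). (0::real))"
  proof (rule integral_dominated_convergence[where w = "\<lambda>p. indicator D p *\<^sub>R (cmod (f p))\<^sup>2"])
    show "integrable lborel (\<lambda>p. indicator D p *\<^sub>R (cmod (f p))\<^sup>2)"
      using f by (simp add: bergman_space_def set_integrable_def)
    show "(\<lambda>p. indicator (D - V N) p *\<^sub>R (cmod (f p))\<^sup>2) \<in> borel_measurable lborel" for N
      using set_integrable_tail[OF D f oV[of N]] by (auto simp: set_integrable_def)
    show "AE p in lborel. norm (indicator (D - V N) p *\<^sub>R (cmod (f p))\<^sup>2) \<le> indicator D p *\<^sub>R (cmod (f p))\<^sup>2" for N
      by (auto simp: indicator_def)
    have "(\<lambda>N. indicator (D - V N) p *\<^sub>R (cmod (f p))\<^sup>2) \<longlonglongrightarrow> (0::real)" for p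
    proof (cases "p \<in> D")
      case False
      then show ?thesis by simp
    next
      case True
      then obtain U v where Uv: "(U, v) \<in> P" "p \<in> U" using cov by blast
      then obtain i where i: "from_nat_into P i = (U, v)"
        using from_nat_into_surj[OF cP Uv(1)] by blast
      then have "p \<in> V N" if "N > i" for N
        using that Uv(2) i unfolding V_def by force
      then have "\<forall>\<^sub>F N in sequentially. indicator (D - V N) p *\<^sub>R (cmod (f p))\<^sup>2 = (0::real)"
        by (intro eventually_sequentiallyI[of "Suc i"]) auto
      then show ?thesis by (rule tendsto_eventually)
    qed
    then show "AE p in lborel. (\<lambda>N. indicator (D - V N) p *\<^sub>R (cmod (f p))\<^sup>2) \<longlonglongrightarrow> (0::real)"
      by simp
  qed auto
  then have lim: "(\<lambda>N. LINT p|lborel. indicator (D - V N) p *\<^sub>R (cmod (f p))\<^sup>2) \<longlonglongrightarrow> 0"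
    unfolding Bochner_Integration.integral_zero .
  have "\<delta>\<^sup>2 > 0" using \<open>\<delta> > 0\<close> by simp
  from order_tendstoD(2)[OF lim this] have "\<forall>\<^sub>F N in sequentially. (LINT p|lborel. indicator (D - V N) p *\<^sub>R (cmod (f p))\<^sup>2) < \<delta>\<^sup>2"
    .
  then obtain N where N: "(LINT p:D - V N|lborel. (cmod (f p))\<^sup>2) < \<delta>\<^sup>2"
    unfolding set_lebesgue_integral_def by (auto simp: eventually_sequentially)
  let ?d = "from_nat_into P ` {..<N}"
  have sub: "?d \<subseteq> P" using inP by auto
  then have "approx_data D \<delta> f ?d"
    using N unfolding approx_data_def V_def by (fastforce simp: P_def)
  moreover have "?d \<subseteq> insert {} \<B> \<times> Q" using sub by (auto simp: P_def)
  ultimately show ?thesis by blast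
qed

text \<open>
  Choosing one function for every realised piece of data gives a countable set, and it is dense because
  functions with the same data are close.
\<close>
lemma bergman_space_separable:
  assumes D: "open D" "emeasure lborel D < \<infinity>"
  obtains C where "countable C" "C \<subseteq> bergman_space D"
    "\<And>f \<epsilon>. f \<in> bergman_space D \<Longrightarrow> \<epsilon> > 0 \<Longrightarrow> \<exists>g\<in>C. l2_norm D (\<lambda>p. f p - g p) < \<epsilon>"
proof -
  obtain \<B> :: "(complex \<times> (complex ^ 'a)) set set"
    where \<B>: "countable \<B>" "topological_basis \<B>"
    using ex_countable_basis by blast
  obtain Q :: "complex set"
    where Q: "countable Q" "\<And>X. open X \<Longrightarrow> X \<noteq> {} \<Longrightarrow> \<exists>v\<in>Q. v \<in> X"
    using countable_dense_setE by blast
  define \<D> where "\<D> = {d. finite d \<and> d \<subseteq> insert {} \<B> \<times> Q}"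
  have c\<D>: "countable \<D>"
    unfolding \<D>_def using \<B> Q by (intro countable_Collect_finite_subset) auto
  have op: "open U" if "(U, v) \<in> d" "d \<in> \<D>" for U v d
    using that topological_basis_open[OF \<B>(2)] by (auto simp: \<D>_def)
  define \<delta> where "\<delta> n = inverse (real (Suc n))" for n
  define F where "F = (\<lambda>(n, d). SOME f. f \<in> bergman_space D \<and> approx_data D (\<delta> n) f d)"
  define X where "X = {(n, d). d \<in> \<D> \<and> (\<exists>f. f \<in> bergman_space D \<and> approx_data D (\<delta> n) f d)}"
  have F: "F (n, d) \<in> bergman_space D" "approx_data D (\<delta> n) (F (n, d)) d" if "(n, d) \<in> X" for n d
    using that someI_ex[of "\<lambda>f. f \<in> bergman_space D \<and> approx_data D (\<delta> n) f d"]
    by (auto simp: X_def F_def)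
  have "countable X"
    by (rule countable_subset[of _ "UNIV \<times> \<D>"]) (auto simp: X_def c\<D>)
  then have "countable (F ` X)" by simp
  moreover have "F ` X \<subseteq> bergman_space D" using F by auto
  moreover have "\<exists>g\<in>F ` X. l2_norm D (\<lambda>p. f p - g p) < \<epsilon>"
    if f: "f \<in> bergman_space D" and "\<epsilon> > 0" for f \<epsilon>
  proof -
    \<comment> \<open>The distance bound \<open>4\<delta>\<^sup>2(|D| + 1)\<close> is at most \<open>(\<delta>M)\<^sup>2\<close>.\<close>
    define M where "M = 2 * (measure lborel D + 1)"
    have M: "M > 0" "measure lborel D + 1 \<ge> 1" by (simp_all add: M_def add_nonneg_pos)
    obtain n where n: "\<delta> n < \<epsilon> / M"
      using reals_Archimedean[of "\<epsilon> / M"] \<open>\<epsilon> > 0\<close> M by (auto simp: \<delta>_def)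
    have "\<delta> n > 0" by (simp add: \<delta>_def)
    then obtain d where d: "d \<in> \<D>" "approx_data D (\<delta> n) f d"
      using approx_data_exists[OF D(1) f _ \<B>(2,1) topological_basis_open[OF \<B>(2)] Q, of "\<delta> n"]
      unfolding \<D>_def by blast
    then have X: "(n, d) \<in> X" using f by (auto simp: X_def)
    have "(l2_norm D (\<lambda>p. f p - F (n, d) p))\<^sup>2 \<le> 4 * (\<delta> n)\<^sup>2 * (measure lborel D + 1)"
      using approx_data_close[OF D f d(2) F[OF X]] op d(1) by blast
    also have "\<dots> \<le> 4 * (\<delta> n)\<^sup>2 * (measure lborel D + 1)\<^sup>2"
      using M(2) by (intro mult_left_mono self_le_power) auto
    also have "\<dots> = (\<delta> n * M)\<^sup>2"
      unfolding M_def power_mult_distrib by simp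
    finally have "l2_norm D (\<lambda>p. f p - F (n, d) p) \<le> \<delta> n * M"
      using \<open>\<delta> n > 0\<close> M(1) by (auto dest: power2_le_imp_le)
    also have "\<dots> < \<epsilon>" using n M(1) by (simp add: field_simps)
    finally show ?thesis using X by blast
  qed
  ultimately show ?thesis using that by blast
qed

text \<open>
  One step of the Gram-Schmidt process.  A function whose residual has norm 0 is already spanned, up to a
  null set; otherwise the normalised residual is added.
\<close>
lemma orthonormal_family_extend:
  assumes D: "open D" and S: "finite S" "orthonormal_family D S" and f: "f \<in> bergman_space D"
  shows "\<exists>T c. finite T \<and> orthonormal_family D T \<and> S \<subseteq> T \<and>
           l2_norm D (\<lambda>p. f p - (\<Sum>\<phi>\<in>T. c \<phi> * \<phi> p)) = 0"
proof -
  define r where "r = residual D S f"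
  define t where "t = l2_norm D r"
  have r: "r \<in> bergman_space D"
    unfolding r_def using residual_in_bergman_space[OF D S f] .
  show ?thesis
  proof (cases "t = 0")
    case True
    then show ?thesis
      using S by (intro exI[of _ S] exI[of _ "l2_inner D f"]) (simp add: t_def r_def residual_def)
  next
    case False
    define u where "u = (\<lambda>p. (1 / of_real t) * r p)"
    have u: "u \<in> bergman_space D"
      unfolding u_def by (rule bergman_space_scale[OF r])
    have us: "l2_inner D u \<phi> = 0" "l2_inner D \<phi> u = 0" if "\<phi> \<in> S" for \<phi>
    proof -
      show *: "l2_inner D u \<phi> = 0"
        using residual_orthogonal[OF D S f that] unfolding u_def r_def l2_inner_scale_left by simp
      then show "l2_inner D \<phi> u = 0" by (metis complex_cnj_zero l2_inner_cnj)
    qed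
    have uu: "l2_inner D u u = 1"
      using False unfolding u_def l2_inner_scale_left l2_inner_scale_right l2_inner_self t_def[symmetric]
      by (simp add: power2_eq_square)
    have "u \<notin> S" using us uu by force
    define c where "c \<phi> = (if \<phi> = u then of_real t else l2_inner D f \<phi>)" for \<phi>
    have "(\<Sum>\<phi>\<in>S. c \<phi> * \<phi> p) = (\<Sum>\<phi>\<in>S. l2_inner D f \<phi> * \<phi> p)" for p
      using \<open>u \<notin> S\<close> by (intro sum.cong) (auto simp: c_def)
    then have "f p - (\<Sum>\<phi>\<in>insert u S. c \<phi> * \<phi> p) = r p - of_real t * u p" for p
      using S \<open>u \<notin> S\<close> by (simp add: c_def r_def residual_def)
    also have "\<dots> p = 0" for p using False by (simp add: u_def)
    finally have "l2_norm D (\<lambda>p. f p - (\<Sum>\<phi>\<in>insert u S. c \<phi> * \<phi> p)) = 0"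
      by (simp add: l2_norm_def)
    moreover have "orthonormal_family D (insert u S)"
      using S(2) u us uu \<open>u \<notin> S\<close> unfolding orthonormal_family_def by auto
    ultimately show ?thesis using S by (intro exI[of _ "insert u S"] exI[of _ c]) auto
  qed
qed

text \<open>
  The Gram-Schmidt process along a dense sequence yields an increasing chain of finite orthonormal families
  whose union spans all members of the sequence.
\<close>
lemma complete_orthonormal_basis_exists:
  assumes D: "open D" "emeasure lborel D < \<infinity>"
  shows "\<exists>B. complete_orthonormal_basis D B"
proof -
  obtain C where C: "countable C" "C \<subseteq> bergman_space D"
    "\<And>f \<epsilon>. f \<in> bergman_space D \<Longrightarrow> \<epsilon> > 0 \<Longrightarrow> \<exists>g\<in>C. l2_norm D (\<lambda>p. f p - g p) < \<epsilon>"
    using bergman_space_separable[OF D] by metis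
  have "C \<noteq> {}" using C(3)[OF bergman_space_zero, of 1] by auto
  define e where "e = from_nat_into C"
  have e: "e n \<in> bergman_space D" for n
    using from_nat_into[OF \<open>C \<noteq> {}\<close>] C(2) by (auto simp: e_def)
  have "\<exists>S. \<forall>n. (finite (S n) \<and> orthonormal_family D (S n)) \<and>
      (S n \<subseteq> S (Suc n) \<and> (\<exists>c. l2_norm D (\<lambda>p. e n p - (\<Sum>\<phi>\<in>S (Suc n). c \<phi> * \<phi> p)) = 0))"
  proof (rule dependent_nat_choice)
    show "\<exists>S. finite S \<and> orthonormal_family D S"
      by (intro exI[of _ "{}"]) (simp add: orthonormal_family_def)
    show "\<exists>T. (finite T \<and> orthonormal_family D T) \<and>
      (S \<subseteq> T \<and> (\<exists>c. l2_norm D (\<lambda>p. e n p - (\<Sum>\<phi>\<in>T. c \<phi> * \<phi> p)) = 0))"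
      if "finite S \<and> orthonormal_family D S" for S n
      using orthonormal_family_extend[OF D(1) _ _ e[of n], of S] that by blast
  qed
  then obtain S where S: "\<And>n. finite (S n)" "\<And>n. orthonormal_family D (S n)"
    "\<And>n. S n \<subseteq> S (Suc n)"
    "\<And>n. \<exists>c. l2_norm D (\<lambda>p. e n p - (\<Sum>\<phi>\<in>S (Suc n). c \<phi> * \<phi> p)) = 0"
    by blast
  have mono: "S m \<subseteq> S n" if "m \<le> n" for m n
    using lift_Suc_mono_le[of S, OF S(3) that] .
  define B where "B = (\<Union>n. S n)"
  have "complete_orthonormal_basis D B"
    unfolding complete_orthonormal_basis_def
  proof (intro conjI ballI allI impI)
    show "B \<subseteq> bergman_space D" using S(2) by (auto simp: B_def orthonormal_family_def)
    fix \<phi> \<psi> assume "\<phi> \<in> B" "\<psi> \<in> B"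
    then obtain m n where "\<phi> \<in> S m" "\<psi> \<in> S n" by (auto simp: B_def)
    then have "\<phi> \<in> S (max m n)" "\<psi> \<in> S (max m n)"
      using mono[of m "max m n"] mono[of n "max m n"] by auto
    then show "l2_inner D \<phi> \<psi> = (if \<phi> = \<psi> then 1 else 0)"
      using S(2) by (auto simp: orthonormal_family_def)
  next
    fix f \<epsilon> assume f: "f \<in> bergman_space D" and "(\<epsilon>::real) > 0"
    then obtain g where g: "g \<in> C" "l2_norm D (\<lambda>p. f p - g p) < \<epsilon>" using C(3) by blast
    then obtain n where n: "g = e n"
      using from_nat_into_surj[OF C(1)] by (metis e_def)
    obtain c where c: "l2_norm D (\<lambda>p. e n p - (\<Sum>\<phi>\<in>S (Suc n). c \<phi> * \<phi> p)) = 0"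
      using S(4) by blast
    have "S (Suc n) \<subseteq> bergman_space D" using S(2) by (auto simp: orthonormal_family_def)
    then have "(\<lambda>p. f p - e n p) \<in> bergman_space D"
      "(\<lambda>p. e n p - (\<Sum>\<phi>\<in>S (Suc n). c \<phi> * \<phi> p)) \<in> bergman_space D"
      using D f e S by (auto intro!: bergman_space_diff bergman_space_sum)
    from l2_norm_triangle[OF D(1) this] c g(2)
    have "l2_norm D (\<lambda>p. f p - (\<Sum>\<phi>\<in>S (Suc n). c \<phi> * \<phi> p)) < \<epsilon>"
      by (simp add: n)
    then show "\<exists>S c. finite S \<and> S \<subseteq> B \<and> l2_norm D (\<lambda>p. f p - (\<Sum>\<phi>\<in>S. c \<phi> * \<phi> p)) < \<epsilon>"
      using S(1) by (intro exI[of _ "S (Suc n)"] exI[of _ c]) (auto simp: B_def)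
  qed
  then show ?thesis by blast
qed

section \<open>Integration over discs by circle means\<close>

lemma lborel_complex_eq_distr:
  "(lborel :: complex measure) = distr (lborel :: (real^2) measure) borel (\<lambda>v. Complex (v $ 1) (v $ 2))"
  (is "_ = distr _ _ ?E")
proof (rule lborel_eqI)
  have [measurable]: "?E \<in> borel_measurable borel"
    unfolding Complex_eq by (intro borel_measurable_continuous_onI continuous_intros)
  fix l u :: complex assume lu: "\<And>b. b \<in> Basis \<Longrightarrow> l \<bullet> b \<le> u \<bullet> b"
  have le: "Re l \<le> Re u" "Im l \<le> Im u"
    using lu[of 1] lu[of \<i>] by (simp_all add: Basis_complex_def)
  define L U :: "real^2" where "L = vector [Re l, Im l]" and "U = vector [Re u, Im u]"
  have "?E -` box l u = box L U"
    by (auto simp: in_box_complex_iff mem_box_cart forall_2 L_def U_def)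
  then have "emeasure (distr lborel borel ?E) (box l u) = emeasure lborel (box L U)"
    by (subst emeasure_distr) auto
  also have "\<dots> = (\<Prod>b\<in>Basis. (U - L) \<bullet> b)"
    using le by (intro emeasure_lborel_box) (auto simp: Basis_vec_def UNIV_2 L_def U_def inner_axis)
  also have "(\<Prod>b\<in>Basis. (U - L) \<bullet> b) = (\<Prod>b\<in>Basis. (u - l) \<bullet> b)"
  proof -
    have B: "(Basis :: (real^2) set) = {axis 1 1, axis 2 1}"
      by (auto simp: Basis_vec_def UNIV_2)
    have ne: "axis 1 1 \<noteq> (axis 2 1 :: real^2)"
      by (simp add: axis_eq_axis)
    have "(\<Prod>b\<in>Basis. (U - L) \<bullet> b) = ((U - L) \<bullet> axis 1 1) * ((U - L) \<bullet> axis 2 1)"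
      unfolding B using ne by simp
    then show ?thesis
      by (simp add: Basis_complex_def inner_axis L_def U_def complex_eq_iff)
  qed
  finally show "emeasure (distr lborel borel ?E) (box l u) = (\<Prod>b\<in>Basis. (u - l) \<bullet> b)" .
qed simp

text \<open>
  Transport to \<open>real ^ 2\<close>, where orthogonal maps are known to preserve Lebesgue measure.
\<close>
lemma lborel_complex_rotation:
  assumes c: "cmod c = 1"
  shows "lborel = distr lborel borel (\<lambda>z. c * z)"
proof (rule lborel_eqI)
  let ?E = "\<lambda>v::real^2. Complex (v $ 1) (v $ 2)"
  define R where "R = (\<lambda>v::real^2. (vector [Re (c * ?E v), Im (c * ?E v)] :: real^2))"
  have [measurable]: "?E \<in> borel_measurable borel"
    unfolding Complex_eq by (intro borel_measurable_continuous_onI continuous_intros)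
  have [measurable]: "(\<lambda>z. c * z) \<in> borel_measurable borel"
    by (intro borel_measurable_continuous_onI continuous_intros)
  have cc: "(Re c)\<^sup>2 + (Im c)\<^sup>2 = 1"
    using c by (metis cmod_power2 one_power2)
  have ER: "?E (R v) = c * ?E v" for v
    by (simp add: R_def complex_eq_iff)
  have nE: "cmod (?E v) = norm v" for v
    by (simp add: norm_vec_def L2_set_def sum_2 cmod_def)
  have R: "orthogonal_transformation R"
    unfolding orthogonal_transformation
  proof
    show "linear R"
      by (rule linearI) (auto simp: R_def vec_eq_iff forall_2 algebra_simps)
    show "\<forall>v. norm (R v) = norm v"
      using ER nE c by (metis norm_mult mult_1)
  qed
  fix l u :: complex assume le: "\<And>b. b \<in> Basis \<Longrightarrow> l \<bullet> b \<le> u \<bullet> b"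
  define V where "V = ?E -` box l u"
  define W where "W = R -` V"
  have Rinj: "surj R"
    using R orthogonal_transformation_surj by blast
  have Weq: "W = ?E -` ((\<lambda>z. c * z) -` box l u)"
    using ER by (auto simp: W_def V_def)
  have Wm: "W \<in> sets borel" "V \<in> sets borel"
    unfolding V_def Weq using measurable_sets[of ?E borel borel] measurable_sets[of "\<lambda>z. c * z" borel borel "box l u"]
    by auto
  have "emeasure (distr lborel borel (\<lambda>z. c * z)) (box l u) = emeasure lborel ((\<lambda>z. c * z) -` box l u)"
    by (subst emeasure_distr) auto
  also have "\<dots> = emeasure (distr lborel borel ?E) ((\<lambda>z. c * z) -` box l u)"
    by (simp only: lborel_complex_eq_distr[symmetric])
  also have "\<dots> = emeasure lborel W"
    using measurable_sets[of "\<lambda>z. c * z" borel borel "box l u"]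
    by (subst emeasure_distr) (auto simp: Weq)
  also have "\<dots> = emeasure lborel V"
  proof -
    have bV: "bounded V"
    proof -
      obtain B where "\<And>z. z \<in> box l u \<Longrightarrow> norm z \<le> B"
        using bounded_box[of l u] unfolding bounded_iff by blast
      then show ?thesis
        unfolding bounded_iff V_def by (intro exI[of _ B]) (auto simp: nE[symmetric])
    qed
    have Vl: "V \<in> lmeasurable"
      using bV Wm by (intro bounded_set_imp_lmeasurable) auto
    have "R ` W = V" using Rinj by (auto simp: W_def)
    have bW: "bounded W"
      using bV ER nE c unfolding bounded_iff W_def by (metis norm_mult mult_1 vimage_eq)
    then have Wl: "W \<in> lmeasurable"
      using Wm by (intro bounded_set_imp_lmeasurable) auto
    have "measure lebesgue V = measure lebesgue W"
      using measure_orthogonal_image[OF R Wl] \<open>R ` W = V\<close> by simp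
    then have "emeasure lebesgue V = emeasure lebesgue W"
      using Vl Wl by (simp add: emeasure_eq_measure2 fmeasurableD2 emeasure_eq_ennreal_measure)
    then show ?thesis using Wm by simp
  qed
  also have "\<dots> = emeasure (distr lborel borel ?E) (box l u)"
    by (subst emeasure_distr) (auto simp: V_def)
  also have "\<dots> = emeasure lborel (box l u)"
    by (simp only: lborel_complex_eq_distr[symmetric])
  also have "\<dots> = (\<Prod>b\<in>Basis. (u - l) \<bullet> b)"
    using le by (rule emeasure_lborel_box)
  finally show "emeasure (distr lborel borel (\<lambda>z. c * z)) (box l u) = (\<Prod>b\<in>Basis. (u - l) \<bullet> b)" .
qed simp

text \<open>
  Under \<open>|z|\<^sup>2\<close> the area of a disc becomes \<open>\<pi>\<close> times length, because the disc with
  \<open>|z|\<^sup>2 < u\<close> has area \<open>\<pi>u\<close>.  It suffices to compare the two measures on half-lines.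
\<close>
lemma lborel_radial:
  assumes R: "R > 0"
  shows "distr (restrict_space lborel (ball (0::complex) R)) borel (\<lambda>z. (cmod z)\<^sup>2)
       = density lborel (\<lambda>u. ennreal (pi * indicator {0..R\<^sup>2} u))"
    (is "?M = ?N")
proof (rule measure_eqI_lessThan)
  have eN: "emeasure ?N {x<..} = ennreal (pi * (R\<^sup>2 - max 0 (min x (R\<^sup>2))))" for x
  proof -
    have "emeasure ?N {x<..} = (\<integral>\<^sup>+ u. ennreal (pi * indicator {0..R\<^sup>2} u) * indicator {x<..} u \<partial>lborel)"
      by (rule emeasure_density) auto
    also have "\<dots> = (\<integral>\<^sup>+ u. ennreal pi * indicator ({0..R\<^sup>2} \<inter> {x<..}) u \<partial>lborel)"
      by (intro nn_integral_cong) (auto simp: indicator_def)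
    also have "\<dots> = ennreal pi * emeasure lborel ({0..R\<^sup>2} \<inter> {x<..})"
      by (rule nn_integral_cmult_indicator) auto
    also have "emeasure lborel ({0..R\<^sup>2} \<inter> {x<..}) = ennreal (R\<^sup>2 - max 0 (min x (R\<^sup>2)))"
    proof (cases "x < 0")
      case True
      then have "{0..R\<^sup>2} \<inter> {x<..} = {0..R\<^sup>2}" by auto
      moreover have "x \<le> R\<^sup>2" using True zero_le_power2[of R] by linarith
      ultimately show ?thesis using True by (simp add: min_def max_def)
    next
      case False
      then have "{0..R\<^sup>2} \<inter> {x<..} = {x<..R\<^sup>2}" by auto
      then show ?thesis using False by (cases "x \<le> R\<^sup>2") (auto simp: min_def max_def)
    qed
    finally show ?thesis by (simp add: ennreal_mult'')
  qed
  have meas: "(\<lambda>z. (cmod z)\<^sup>2) \<in> measurable (restrict_space lborel (ball (0::complex) R)) borel"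
    by (intro measurable_restrict_space1) measurable
  have vol: "emeasure lborel (ball (0::complex) t) = ennreal (pi * t\<^sup>2)"
     "emeasure lborel (cball (0::complex) t) = ennreal (pi * t\<^sup>2)" if "t \<ge> 0" for t
    using that by (simp_all add: emeasure_ball emeasure_cball unit_ball_vol_2 DIM_complex)
  have eM: "emeasure ?M {x<..} = ennreal (pi * (R\<^sup>2 - max 0 (min x (R\<^sup>2))))" for x
  proof -
    have "emeasure ?M {x<..} = emeasure (restrict_space lborel (ball (0::complex) R)) {z \<in> ball 0 R. x < (cmod z)\<^sup>2}"
      by (subst emeasure_distr[OF meas]) (auto intro!: arg_cong2[where f = emeasure] simp: space_restrict_space)
    also have "\<dots> = emeasure lborel {z \<in> ball (0::complex) R. x < (cmod z)\<^sup>2}"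
      by (intro emeasure_restrict_space) auto
    also have "\<dots> = ennreal (pi * (R\<^sup>2 - max 0 (min x (R\<^sup>2))))"
    proof (cases "x < 0")
      case True
      then have "x < (cmod z)\<^sup>2" for z using zero_le_power2[of "cmod z"] by linarith
      then have "{z \<in> ball (0::complex) R. x < (cmod z)\<^sup>2} = ball 0 R" by auto
      moreover have "x \<le> R\<^sup>2" using True zero_le_power2[of R] by linarith
      ultimately show ?thesis using True R vol(1)[of R] by (simp add: min_def max_def)
    next
      case False
      show ?thesis
      proof (cases "x < R\<^sup>2")
        case True
        have lt: "x < (cmod z)\<^sup>2 \<longleftrightarrow> sqrt x < cmod z" for z
          using False real_less_lsqrt real_sqrt_less_iff[of x "(cmod z)\<^sup>2"] by simp
        have sx: "0 \<le> sqrt x" "sqrt x < R" "(sqrt x)\<^sup>2 = x"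
          using False True R real_less_lsqrt[of R x] by auto
        have "{z \<in> ball (0::complex) R. x < (cmod z)\<^sup>2} = ball 0 R - cball 0 (sqrt x)"
          by (auto simp: lt)
        moreover have "emeasure lborel (ball (0::complex) R - cball 0 (sqrt x))
            = emeasure lborel (ball (0::complex) R) - emeasure lborel (cball (0::complex) (sqrt x))"
          using sx vol(2)[of "sqrt x"] by (intro emeasure_Diff) auto
        ultimately show ?thesis
          using vol(1)[of R] vol(2)[of "sqrt x"] R sx False True
          by (simp add: ennreal_minus right_diff_distrib min_def max_def)
      next
        case F: False
        have "(cmod z)\<^sup>2 < R\<^sup>2" if "cmod z < R" for z
          using that by (intro power_strict_mono) auto
        then have E: "{z \<in> ball (0::complex) R. x < (cmod z)\<^sup>2} = {}"
          using F by (force simp: not_less)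
        have "max 0 (min x (R\<^sup>2)) = R\<^sup>2" using F by simp
        then show ?thesis unfolding E by simp
      qed
    qed
    finally show ?thesis .
  qed
  show "emeasure ?M {x<..} = emeasure ?N {x<..}" for x
    by (simp only: eM eN)
  show "emeasure ?M {x<..} < \<infinity>" for x
    by (simp only: eM) simp
qed simp_all

text \<open>
  A substitute for polar coordinates: by rotation invariance and Fubini's theorem \<open>F\<close> may be replaced by
  its mean over circles, which is a function of \<open>|z|\<^sup>2\<close> alone.
\<close>
lemma disc_integral_of_circle_means:
  fixes F :: "complex \<Rightarrow> complex" and m :: "real \<Rightarrow> complex"
  assumes R: "R > 0" and F: "continuous_on (cball 0 R) F" and m: "continuous_on {0..R\<^sup>2} m"
    and mean: "\<And>z. z \<in> ball 0 R \<Longrightarrow>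
      ((\<lambda>x. F (exp (2 * of_real pi * \<i> * of_real x) * z)) has_integral m ((cmod z)\<^sup>2)) {0..1}"
  shows "(LINT z:ball 0 R|lborel. F z) = of_real pi * integral {0..R\<^sup>2} m"
proof -
  define G where "G z = indicator (ball 0 R) z *\<^sub>R F z" for z
  define c where "c x = exp (2 * of_real pi * \<i> * complex_of_real x)" for x
  have nc: "cmod (c x) = 1" for x
    by (simp add: c_def)
  have [measurable]: "c \<in> borel_measurable borel"
    unfolding c_def by (intro borel_measurable_continuous_onI continuous_intros)
  have "continuous_on (ball 0 R) F"
    using F by (rule continuous_on_subset) auto
  then have [measurable]: "G \<in> borel_measurable borel"
    unfolding G_def using borel_measurable_continuous_on_indicator[of "ball 0 R" F] by simp
  obtain K where "\<forall>y\<in>F ` cball 0 R. cmod y \<le> K"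
    using compact_imp_bounded[OF compact_continuous_image[OF F compact_cball]]
    unfolding bounded_iff by blast
  then have K: "cmod (F z) \<le> K" if "z \<in> cball 0 R" for z
    using that by blast
  have GK: "cmod (G z) \<le> K" for z
  proof -
    have "0 \<le> K" using order_trans[OF norm_ge_zero K[of 0]] R by simp
    then show ?thesis using K[of z] by (simp add: G_def indicator_def)
  qed
  have rot: "(LINT z|lborel. G (c x * z)) = (LINT z|lborel. G z)" for x
  proof -
    have "(LINT z|lborel. G z) = (LINT z|distr lborel borel (\<lambda>z. c x * z). G z)"
      using lborel_complex_rotation[OF nc[of x]] by simp
    also have "\<dots> = (LINT z|lborel. G (c x * z))"
      by (rule integral_distr) measurable
    finally show ?thesis by simp
  qed
  have int: "integrable (lborel \<Otimes>\<^sub>M lborel) (\<lambda>(x, z). indicator {0..1::real} x *\<^sub>R G (c x * z))"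
  proof (rule integrableI_bounded_set[where A = "{0..1} \<times> ball 0 R" and B = K])
    show "emeasure (lborel \<Otimes>\<^sub>M lborel) ({0..1::real} \<times> ball (0::complex) R) < \<infinity>"
      using emeasure_bounded_finite[of "ball (0::complex) R"]
      by (subst lborel.emeasure_pair_measure_Times) (auto simp: ennreal_mult_less_top)
    show "AE p in lborel \<Otimes>\<^sub>M lborel. p \<in> {0..1} \<times> ball 0 R \<longrightarrow>
        norm (case p of (x, z) \<Rightarrow> indicator {0..1::real} x *\<^sub>R G (c x * z)) \<le> K"
      using GK by auto
    show "AE p in lborel \<Otimes>\<^sub>M lborel. p \<notin> {0..1} \<times> ball 0 R \<longrightarrow>
        (case p of (x, z) \<Rightarrow> indicator {0..1::real} x *\<^sub>R G (c x * z)) = 0"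
      by (intro AE_I2) (auto simp: G_def norm_mult nc indicator_def)
  qed measurable
  have "(LINT z:ball 0 R|lborel. F z) = (LINT z|lborel. G z)"
    by (simp add: set_lebesgue_integral_def G_def)
  also have "\<dots> = (LINT x|lborel. indicator {0..1::real} x *\<^sub>R (LINT z|lborel. G z))"
    by simp
  also have "\<dots> = (LINT x|lborel. LINT z|lborel. indicator {0..1::real} x *\<^sub>R G (c x * z))"
    by (simp add: rot)
  also have "\<dots> = (LINT z|lborel. LINT x|lborel. indicator {0..1::real} x *\<^sub>R G (c x * z))"
    by (rule lborel_pair.Fubini_integral[OF int, symmetric])
  also have "\<dots> = (LINT z|lborel. indicator (ball 0 R) z *\<^sub>R m ((cmod z)\<^sup>2))"
  proof (intro Bochner_Integration.integral_cong refl)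
    fix z :: complex
    show "(LINT x|lborel. indicator {0..1::real} x *\<^sub>R G (c x * z)) = indicator (ball 0 R) z *\<^sub>R m ((cmod z)\<^sup>2)"
    proof (cases "z \<in> ball 0 R")
      case False
      then show ?thesis by (simp add: G_def norm_mult nc)
    next
      case True
      have Fz: "continuous_on {0..1} (\<lambda>x. F (c x * z))"
        by (rule continuous_on_compose2[OF F])
           (use True in \<open>auto simp: c_def norm_mult intro!: continuous_intros\<close>)
      have "(LINT x|lborel. indicator {0..1::real} x *\<^sub>R G (c x * z)) = (LINT x:{0..1}|lborel. F (c x * z))"
        using True by (simp add: set_lebesgue_integral_def G_def norm_mult nc)
      also have "\<dots> = integral {0..1} (\<lambda>x. F (c x * z))"
        by (intro set_borel_integral_eq_integral borel_integrable_atLeastAtMost' Fz)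
      also have "\<dots> = m ((cmod z)\<^sup>2)"
        using mean[OF True] by (auto simp: c_def)
      finally show ?thesis using True by simp
    qed
  qed
  also have "\<dots> = (LINT z|restrict_space lborel (ball (0::complex) R). indicator {0..R\<^sup>2} ((cmod z)\<^sup>2) *\<^sub>R m ((cmod z)\<^sup>2))"
  proof -
    have "(cmod z)\<^sup>2 \<le> R\<^sup>2" if "cmod z < R" for z
      using that by (intro power_mono) auto
    then show ?thesis
      by (subst integral_restrict_space)
         (auto intro!: Bochner_Integration.integral_cong simp: indicator_def set_lebesgue_integral_def)
  qed
  also have "\<dots> = (LINT u|distr (restrict_space lborel (ball (0::complex) R)) borel (\<lambda>z. (cmod z)\<^sup>2). indicator {0..R\<^sup>2} u *\<^sub>R m u)"
    using m by (intro integral_distr[symmetric] measurable_restrict_space1 borel_measurable_continuous_on_indicator) auto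
  also have "\<dots> = (LINT u|lborel. (pi * indicator {0..R\<^sup>2} u) *\<^sub>R (indicator {0..R\<^sup>2} u *\<^sub>R m u))"
    unfolding lborel_radial[OF R]
    using m borel_measurable_continuous_on_indicator[of "{0..R\<^sup>2}" m] by (intro integral_density) auto
  also have "\<dots> = (LINT u|lborel. of_real pi * (indicator {0..R\<^sup>2} u *\<^sub>R m u))"
    by (intro Bochner_Integration.integral_cong) (auto simp: indicator_def scaleR_conv_of_real)
  also have "\<dots> = of_real pi * (LINT u:{0..R\<^sup>2}|lborel. m u)"
    unfolding set_lebesgue_integral_def by (rule Bochner_Integration.integral_mult_right_zero)
  also have "(LINT u:{0..R\<^sup>2}|lborel. m u) = integral {0..R\<^sup>2} m"
    by (intro set_borel_integral_eq_integral borel_integrable_atLeastAtMost' m)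
  finally show ?thesis .
qed

text \<open>
  This is Cauchy's formula for the derivative of \<open>u P(u)\<close> at \<open>b\<close>; the factor
  \<open>exp(2\<pi>ix)\<^sup>2\<close> absorbs the speed of the circle and the factor \<open>u\<close>.
\<close>
lemma circle_mean_double_pole:
  fixes P :: "complex \<Rightarrow> complex"
  assumes cont: "continuous_on (cball 0 1) P" and hol: "P holomorphic_on ball 0 1" and b: "cmod b < 1"
  shows "((\<lambda>x. P (exp (2 * of_real pi * \<i> * of_real x)) * (exp (2 * of_real pi * \<i> * of_real x))\<^sup>2
            / (exp (2 * of_real pi * \<i> * of_real x) - b)\<^sup>2) has_integral (P b + b * deriv P b)) {0..1}"
proof -
  have b': "b \<in> ball 0 1" using b by simp
  define f where "f u = u * P u" for u
  have f: "continuous_on (cball 0 1) f" "f holomorphic_on ball 0 1"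
    unfolding f_def using cont hol by (auto intro!: continuous_intros holomorphic_intros)
  note C = Cauchy_derivative_integral_circlepath[OF f b']
  have "(f has_field_derivative (P b + b * deriv P b)) (at b)"
    unfolding f_def
    using holomorphic_derivI[OF hol open_ball b'] by (auto intro!: derivative_eq_intros)
  then have eq: "1 / (2 * of_real pi * \<i>) * contour_integral (circlepath 0 1) (\<lambda>u. f u / (u - b)\<^sup>2) = P b + b * deriv P b"
    using C(2) DERIV_unique by blast
  have "((\<lambda>u. f u / (u - b)\<^sup>2) has_contour_integral (2 * of_real pi * \<i> * (P b + b * deriv P b))) (circlepath 0 1)"
    using has_contour_integral_integral[OF C(1)] unfolding eq[symmetric] by simp
  then have "((\<lambda>x. f (circlepath 0 1 x) / (circlepath 0 1 x - b)\<^sup>2 * (2 * of_real pi * \<i> * 1 * exp (2 * of_real pi * \<i> * of_real x)))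
       has_integral (2 * of_real pi * \<i> * (P b + b * deriv P b))) {0..1}"
    unfolding has_contour_integral_def
    by (rule has_integral_eq[rotated]) (simp add: vector_derivative_circlepath01)
  from has_integral_mult_right[OF this, of "1 / (2 * of_real pi * \<i>)"]
  have "((\<lambda>x. (1 / (2 * of_real pi * \<i>)) * (f (circlepath 0 1 x) / (circlepath 0 1 x - b)\<^sup>2 * (2 * of_real pi * \<i> * 1 * exp (2 * of_real pi * \<i> * of_real x))))
       has_integral (P b + b * deriv P b)) {0..1}"
    by simp
  moreover have "(1 / c) * (E * X / Y * (c * 1 * E)) = X * E\<^sup>2 / Y" if "c \<noteq> 0" for c E X Y :: complex
    using that by (simp add: power2_eq_square)
  from this[of "2 * of_real pi * \<i>"]
  have "(1 / (2 * of_real pi * \<i>)) * (E * X / Y * (2 * of_real pi * \<i> * 1 * E)) = X * E\<^sup>2 / Y" for E X Y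
    by simp
  ultimately show ?thesis
    by (simp only: circlepath f_def) (simp only: add_0 mult_1 of_real_1)
qed

lemma circle_mean_value:
  fixes P :: "complex \<Rightarrow> complex"
  assumes "continuous_on (cball 0 1) P" "P holomorphic_on ball 0 1"
  shows "((\<lambda>x. P (exp (2 * of_real pi * \<i> * of_real x))) has_integral P 0) {0..1}"
  using circle_mean_double_pole[OF assms, of 0] by simp

text \<open>
  The reproducing formula of the disc of radius \<open>\<rho>\<close>, for the kernel of the unit disc.  On the circle
  through \<open>z\<close> one has \<open>cnj v = 1/v\<close> for the rotation parameter \<open>v\<close>, which turns the
  antiholomorphic kernel into a double pole at \<open>cnj z a\<close>.  The circle mean at \<open>u = |z|\<^sup>2\<close> is
  therefore the derivative of \<open>u g(ua)\<close>, and it integrates to \<open>\<rho>\<^sup>2 g(\<rho>\<^sup>2a)\<close>.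
\<close>
lemma disc_reproducing:
  fixes g :: "complex \<Rightarrow> complex"
  assumes \<rho>: "0 < \<rho>" "\<rho> \<le> 1" and a: "cmod a < 1"
    and cont: "continuous_on (cball 0 \<rho>) g" and hol: "g holomorphic_on ball 0 \<rho>"
  shows "(LINT y:ball 0 \<rho>|lborel. g y / (1 - cnj y * a)\<^sup>2) = of_real (pi * \<rho>\<^sup>2) * g (of_real (\<rho>\<^sup>2) * a)"
proof -
  define m where "m u = g (of_real u * a) + of_real u * a * deriv g (of_real u * a)" for u :: real
  have in_ball: "of_real u * a \<in> ball 0 \<rho>" if "u \<in> {0..\<rho>\<^sup>2}" for u
  proof -
    have "\<rho>\<^sup>2 \<le> \<rho>" using \<rho> by (simp add: power2_eq_square mult_left_le)
    then have "\<bar>u\<bar> \<le> \<rho>" using that by auto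
    then have "cmod (of_real u * a) \<le> \<rho> * cmod a" by (auto simp: norm_mult intro: mult_right_mono)
    also have "\<dots> < \<rho>" using \<rho> a by simp
    finally show ?thesis by simp
  qed
  have hd: "deriv g holomorphic_on ball 0 \<rho>"
    using hol by (intro holomorphic_deriv) auto
  have contm: "continuous_on {0..\<rho>\<^sup>2} m"
    unfolding m_def
    by (intro continuous_intros continuous_on_compose2[OF holomorphic_on_imp_continuous_on[OF hol]]
        continuous_on_compose2[OF holomorphic_on_imp_continuous_on[OF hd]])
       (use in_ball in auto)
  have ne: "1 - cnj y * a \<noteq> 0" if "cmod y \<le> 1" for y
  proof
    assume "1 - cnj y * a = 0"
    then have "cmod (cnj y * a) = 1" by (metis eq_iff_diff_eq_0 norm_one)
    moreover have "cmod (cnj y * a) \<le> 1 * cmod a"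
      using that unfolding norm_mult by (intro mult_right_mono) auto
    ultimately show False using a by simp
  qed
  have "(LINT y:ball 0 \<rho>|lborel. g y / (1 - cnj y * a)\<^sup>2) = of_real pi * integral {0..\<rho>\<^sup>2} m"
  proof (rule disc_integral_of_circle_means[OF \<rho>(1) _ contm])
    show "continuous_on (cball 0 \<rho>) (\<lambda>y. g y / (1 - cnj y * a)\<^sup>2)"
      using ne \<rho> by (intro continuous_intros cont) auto
    fix z :: complex assume z: "z \<in> ball 0 \<rho>"
    define b where "b = cnj z * a"
    define P where "P v = g (v * z)" for v
    have vz: "v * z \<in> ball 0 \<rho>" if "v \<in> cball 0 1" for v
    proof -
      have "cmod (v * z) \<le> 1 * cmod z" using that unfolding norm_mult by (intro mult_right_mono) auto
      then show ?thesis using z by simp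
    qed
    have P: "continuous_on (cball 0 1) P" "P holomorphic_on ball 0 1"
      unfolding P_def using vz
      by (auto intro!: continuous_on_compose2[OF holomorphic_on_imp_continuous_on[OF hol]] continuous_intros
          holomorphic_on_compose_gen[OF _ hol, unfolded o_def] holomorphic_intros)
    have "cmod b \<le> 1 * cmod a"
      using z \<rho> unfolding b_def norm_mult by (intro mult_right_mono) auto
    then have b: "cmod b < 1" using a by simp
    have bz: "b * z = of_real ((cmod z)\<^sup>2) * a"
      unfolding b_def complex_norm_square by simp
    have "(P has_field_derivative deriv g (b * z) * z) (at b)"
      unfolding P_def using holomorphic_derivI[OF hol open_ball vz[of b]] b
      by (auto intro!: DERIV_chain'[where g = g] derivative_eq_intros)
    then have "P b + b * deriv P b = m ((cmod z)\<^sup>2)"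
      unfolding m_def bz[symmetric] by (simp add: DERIV_imp_deriv P_def)
    moreover have "P v * v\<^sup>2 / (v - b)\<^sup>2 = g (v * z) / (1 - cnj (v * z) * a)\<^sup>2" if "cmod v = 1" for v
    proof -
      have "v * cnj v = 1" using that by (simp add: complex_norm_square[symmetric])
      then have "v - b = v * (1 - cnj (v * z) * a)"
        by (simp add: b_def algebra_simps)
      moreover have "v \<noteq> 0" using that by auto
      ultimately show ?thesis by (simp add: power_mult_distrib P_def)
    qed
    ultimately show "((\<lambda>x. g (exp (2 * of_real pi * \<i> * of_real x) * z)
          / (1 - cnj (exp (2 * of_real pi * \<i> * of_real x) * z) * a)\<^sup>2) has_integral m ((cmod z)\<^sup>2)) {0..1}"
      using circle_mean_double_pole[OF P b] by (simp add: P_def)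
  qed
  also have "integral {0..\<rho>\<^sup>2} m = of_real (\<rho>\<^sup>2) * g (of_real (\<rho>\<^sup>2) * a)"
  proof -
    have "(m has_integral (of_real (\<rho>\<^sup>2) * g (of_real (\<rho>\<^sup>2) * a) - of_real 0 * g (of_real 0 * a))) {0..\<rho>\<^sup>2}"
    proof (rule fundamental_theorem_of_calculus)
      fix u assume u: "u \<in> {0..\<rho>\<^sup>2}"
      have "((\<lambda>w. g (w * a)) has_field_derivative deriv g (of_real u * a) * a) (at (of_real u))"
        by (rule DERIV_chain'[where f = "\<lambda>w. w * a" and g = g,
              OF _ holomorphic_derivI[OF hol open_ball in_ball[OF u]]])
           (auto intro!: derivative_eq_intros)
      from DERIV_mult[OF DERIV_ident this]
      have "((\<lambda>w. w * g (w * a)) has_field_derivative m u) (at (of_real u))"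
        by (simp add: m_def algebra_simps)
      then show "((\<lambda>u. of_real u * g (of_real u * a)) has_vector_derivative m u) (at u within {0..\<rho>\<^sup>2})"
        by (rule has_vector_derivative_real_field)
    qed simp
    then show ?thesis by (simp add: integral_unique)
  qed
  finally show ?thesis by simp
qed

section \<open>The reproducing formula on a polydisc\<close>

lemma measurable_PiM_to_vec:
  "(\<lambda>x. \<chi> k. if k \<in> I then x k else c k)
     \<in> measurable (Pi\<^sub>M I (\<lambda>_. lborel)) (borel :: (complex ^ 'n::finite) measure)"
proof (subst borel_measurable_euclidean_space, rule ballI)
  fix e :: "complex ^ 'n" assume "e \<in> Basis"
  then obtain i b where e: "e = axis i b" by (auto simp: Basis_vec_def)
  have "(\<lambda>x. (if i \<in> I then x i else c i) \<bullet> b) \<in> borel_measurable (Pi\<^sub>M I (\<lambda>_. lborel))"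
  proof (cases "i \<in> I")
    case True
    have "(\<lambda>x. x i) \<in> measurable (Pi\<^sub>M I (\<lambda>_. lborel :: complex measure)) lborel"
      using True by (rule measurable_component_singleton)
    moreover have "(\<lambda>y. y \<bullet> b) \<in> borel_measurable (lborel :: complex measure)"
      by simp
    ultimately have "(\<lambda>x. x i \<bullet> b) \<in> borel_measurable (Pi\<^sub>M I (\<lambda>_. lborel))"
      by (rule measurable_compose)
    then show ?thesis using True by simp
  qed simp
  then show "(\<lambda>x. (\<chi> k. if k \<in> I then x k else c k) \<bullet> e) \<in> borel_measurable (Pi\<^sub>M I (\<lambda>_. lborel))"
    by (simp add: e inner_axis)
qed

interpretation lborel_product: product_sigma_finite "\<lambda>_::'n. lborel :: complex measure"
  by standard

text \<open>
  Iterated integration over the coordinates of a vector becomes available through the product measure.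
\<close>
lemma lborel_vec_eq_distr_PiM:
  "(lborel :: (complex ^ 'n::finite) measure)
    = distr (Pi\<^sub>M UNIV (\<lambda>_. lborel)) borel (\<lambda>x. \<chi> i. x i)"
proof (rule lborel_eqI)
  have meas: "(\<lambda>x. \<chi> i. x i) \<in> measurable (Pi\<^sub>M UNIV (\<lambda>_. lborel)) (borel :: (complex ^ 'n) measure)"
    using measurable_PiM_to_vec[of UNIV] by simp
  fix l u :: "complex ^ 'n" assume le: "\<And>b. b \<in> Basis \<Longrightarrow> l \<bullet> b \<le> u \<bullet> b"
  have le': "l $ i \<bullet> b \<le> u $ i \<bullet> b" if "b \<in> Basis" for i b
    using le[of "axis i b"] that by (auto simp: inner_axis Basis_vec_def)
  have "(\<lambda>x. \<chi> i. x i) -` box l u \<inter> space (Pi\<^sub>M UNIV (\<lambda>_. lborel)) = (\<Pi>\<^sub>E i\<in>UNIV. box (l $ i) (u $ i))"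
    by (auto simp: space_PiM PiE_iff mem_box Basis_vec_def inner_axis)
  then have "emeasure (distr (Pi\<^sub>M UNIV (\<lambda>_. lborel)) borel (\<lambda>x. \<chi> i. x i)) (box l u)
      = (\<Prod>i\<in>UNIV. emeasure lborel (box (l $ i) (u $ i)))"
    by (subst emeasure_distr[OF meas]) (simp_all add: lborel_product.emeasure_PiM)
  also have "\<dots> = (\<Prod>i\<in>UNIV. ennreal (\<Prod>b\<in>Basis. (u $ i - l $ i) \<bullet> b))"
    using le' by (intro prod.cong refl emeasure_lborel_box) auto
  also have "\<dots> = ennreal (\<Prod>i\<in>UNIV. \<Prod>b\<in>Basis. (u $ i - l $ i) \<bullet> b)"
    using le' by (intro prod_ennreal prod_nonneg) (auto simp: inner_diff_left)
  also have "(\<Prod>i\<in>UNIV. \<Prod>b\<in>Basis. (u $ i - l $ i) \<bullet> b) = (\<Prod>b\<in>Basis. (u - l) \<bullet> b)"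
  proof -
    have "(\<Prod>b\<in>Basis. (u - l) \<bullet> b) = (\<Prod>x\<in>UNIV \<times> Basis. (u - l) \<bullet> (case x of (i, b) \<Rightarrow> axis i b))"
    proof (rule prod.reindex_cong)
      show "inj_on (\<lambda>(i, b). axis i b) ((UNIV :: 'n set) \<times> (Basis :: complex set))"
        by (auto simp: inj_on_def axis_eq_axis)
      show "(Basis :: (complex ^ 'n) set) = (\<lambda>(i, b). axis i b) ` (UNIV \<times> Basis)"
        by (auto simp: Basis_vec_def)
    qed simp
    also have "\<dots> = (\<Prod>i\<in>UNIV. \<Prod>b\<in>Basis. (u - l) \<bullet> axis i b)"
      by (subst prod.cartesian_product) (simp add: case_prod_unfold)
    finally show ?thesis by (simp add: inner_axis)
  qed
  finally show "emeasure (distr (Pi\<^sub>M UNIV (\<lambda>_. lborel)) borel (\<lambda>x. \<chi> i. x i)) (box l u)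
      = ennreal (\<Prod>b\<in>Basis. (u - l) \<bullet> b)" .
qed simp

text \<open>
  The one-variable formula is applied to one coordinate after the other.  The induction is over the set
  \<open>I\<close> of coordinates that still have to be integrated; the others are already evaluated at
  \<open>\<rho>\<^sup>2a\<^sub>k\<close>.
\<close>
lemma polydisc_reproducing:
  fixes F :: "complex ^ 'n::finite \<Rightarrow> complex" and a :: "complex ^ 'n"
  assumes \<rho>: "0 < \<rho>" "\<rho> \<le> 1" and a: "\<And>k. cmod (a $ k) < 1"
    and cont: "continuous_on {x. \<forall>k. x $ k \<in> cball 0 \<rho>} F"
    and hol: "\<And>x k. (\<And>j. x $ j \<in> ball 0 \<rho>) \<Longrightarrow>
      (\<lambda>u. F (\<chi> j. if j = k then u else x $ j)) holomorphic_on ball 0 \<rho>"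
  shows "(LINT x:{x. \<forall>k. x $ k \<in> ball 0 \<rho>}|lborel. F x / (\<Prod>k\<in>UNIV. (1 - cnj (x $ k) * a $ k)\<^sup>2))
       = of_real ((pi * \<rho>\<^sup>2) ^ CARD('n)) * F (\<chi> k. of_real (\<rho>\<^sup>2) * a $ k)"
proof -
  define K where "K = {x :: complex ^ 'n. \<forall>k. x $ k \<in> cball 0 \<rho>}"
  define c where "c k = of_real (\<rho>\<^sup>2) * a $ k" for k
  define h where "h k y = indicator (ball 0 \<rho>) y *\<^sub>R (1 / (1 - cnj y * a $ k)\<^sup>2)" for k y
  \<comment> \<open>Cutting \<open>F\<close> off outside the closed polydisc makes it measurable and bounded everywhere.\<close>
  define G where "G x = indicator K x *\<^sub>R F x" for x
  define v where "v I x = (\<chi> k. if k \<in> I then x k else c k)" for I x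
  have \<rho>2: "\<rho>\<^sup>2 \<le> \<rho>" using \<rho> by (simp add: power2_eq_square mult_left_le)
  have c: "c k \<in> ball 0 \<rho>" for k
  proof -
    have "cmod (c k) \<le> \<rho> * cmod (a $ k)"
      using \<rho>2 by (auto simp: c_def norm_mult norm_power intro: mult_right_mono)
    also have "\<dots> < \<rho>" using \<rho> a[of k] by simp
    finally show ?thesis by simp
  qed
  have den: "1 - cmod (a $ k) \<le> cmod (1 - cnj y * a $ k)" if "y \<in> cball 0 \<rho>" for y k
  proof -
    have "cmod (cnj y * a $ k) \<le> 1 * cmod (a $ k)"
      using that \<rho> unfolding norm_mult by (intro mult_right_mono) auto
    then show ?thesis
      using norm_triangle_ineq2[of 1 "cnj y * a $ k"] by simp
  qed
  have den0: "1 - cnj y * a $ k \<noteq> 0" if "y \<in> cball 0 \<rho>" for y k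
    using den[OF that, of k] a[of k] by auto
  have hm: "h k \<in> borel_measurable borel" for k
  proof -
    have "continuous_on (ball 0 \<rho>) (\<lambda>y. 1 / (1 - cnj y * a $ k)\<^sup>2)"
      using den0 by (intro continuous_intros) auto
    then show ?thesis unfolding h_def
      by (intro borel_measurable_continuous_on_indicator) auto
  qed
  have hb: "cmod (h k y) \<le> 1 / (1 - cmod (a $ k))\<^sup>2" for k y
  proof (cases "y \<in> ball 0 \<rho>")
    case True
    then have "(1 - cmod (a $ k))\<^sup>2 \<le> (cmod (1 - cnj y * a $ k))\<^sup>2"
      using den[of y k] a[of k] by (intro power_mono) auto
    then show ?thesis
      using True a[of k] by (simp add: h_def norm_divide norm_power frac_le)
  qed (simp add: h_def)
  have "K = (\<Inter>k. {x. cmod (x $ k) \<le> \<rho>})" by (auto simp: K_def)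
  then have Kcl: "closed K"
    by (auto intro!: closed_INT closed_Collect_le continuous_intros)
  have "bounded K"
  proof -
    have "norm x \<le> (\<Sum>k\<in>(UNIV::'n set). \<rho>)" if "x \<in> K" for x
    proof -
      have "norm x \<le> (\<Sum>k\<in>UNIV. norm (x $ k))"
        unfolding norm_vec_def by (rule L2_set_le_sum) auto
      also have "\<dots> \<le> (\<Sum>k\<in>(UNIV::'n set). \<rho>)"
        using that by (intro sum_mono) (auto simp: K_def)
      finally show ?thesis .
    qed
    then show ?thesis unfolding bounded_iff by blast
  qed
  then have "compact (F ` K)"
    using cont Kcl by (intro compact_continuous_image) (auto simp: K_def compact_eq_bounded_closed)
  then obtain C where C: "\<forall>y\<in>F ` K. cmod y \<le> C"
    using compact_imp_bounded bounded_iff by blast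
  have Gb: "cmod (G x) \<le> max C 0" for x
  proof (cases "x \<in> K")
    case True
    then show ?thesis using C by (auto simp: G_def intro: order_trans max.cobounded1)
  qed (simp add: G_def)
  have Gm: "G \<in> borel_measurable borel"
    unfolding G_def using cont Kcl
    by (intro borel_measurable_continuous_on_indicator) (auto simp: K_def)
  have vm: "v I \<in> measurable (Pi\<^sub>M I (\<lambda>_. lborel)) borel" for I
    unfolding v_def by (rule measurable_PiM_to_vec)
  have meas: "(\<lambda>x. (\<Prod>k\<in>I. h k (x k)) * G (v I x)) \<in> borel_measurable (Pi\<^sub>M I (\<lambda>_. lborel))" for I
  proof (intro borel_measurable_times borel_measurable_prod)
    show "(\<lambda>x. G (v I x)) \<in> borel_measurable (Pi\<^sub>M I (\<lambda>_. lborel))"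
      by (rule measurable_compose[OF vm Gm])
    fix k assume "k \<in> I"
    then have "(\<lambda>x. x k) \<in> measurable (Pi\<^sub>M I (\<lambda>_. lborel :: complex measure)) lborel"
      by (rule measurable_component_singleton)
    moreover have "h k \<in> borel_measurable lborel" using hm[of k] by simp
    ultimately show "(\<lambda>x. h k (x k)) \<in> borel_measurable (Pi\<^sub>M I (\<lambda>_. lborel))"
      by (rule measurable_compose)
  qed
  have int: "integrable (Pi\<^sub>M I (\<lambda>_. lborel)) (\<lambda>x. (\<Prod>k\<in>I. h k (x k)) * G (v I x))" for I
  proof (rule integrableI_bounded_set[where A = "\<Pi>\<^sub>E k\<in>I. ball 0 \<rho>"
        and B = "(\<Prod>k\<in>I. 1 / (1 - cmod (a $ k))\<^sup>2) * max C 0"])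
    have fin: "finite I" by simp
    show "(\<Pi>\<^sub>E k\<in>I. ball 0 \<rho>) \<in> sets (Pi\<^sub>M I (\<lambda>_. lborel :: complex measure))"
      by (intro sets_PiM_I_finite) auto
    have "emeasure (Pi\<^sub>M I (\<lambda>_. lborel :: complex measure)) (\<Pi>\<^sub>E k\<in>I. ball 0 \<rho>)
        = (\<Prod>k\<in>I. emeasure lborel (ball (0::complex) \<rho>))"
      by (intro lborel_product.emeasure_PiM) auto
    also have "\<dots> < \<infinity>"
      using emeasure_bounded_finite[of "ball (0::complex) \<rho>"] by (auto simp: less_top ennreal_prod_eq_top power_less_top_ennreal)
    finally show "emeasure (Pi\<^sub>M I (\<lambda>_. lborel :: complex measure)) (\<Pi>\<^sub>E k\<in>I. ball 0 \<rho>) < \<infinity>" .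
    show "AE x in Pi\<^sub>M I (\<lambda>_. lborel). x \<in> (\<Pi>\<^sub>E k\<in>I. ball 0 \<rho>) \<longrightarrow>
        norm ((\<Prod>k\<in>I. h k (x k)) * G (v I x)) \<le> (\<Prod>k\<in>I. 1 / (1 - cmod (a $ k))\<^sup>2) * max C 0"
      using hb Gb unfolding norm_mult prod_norm[symmetric]
      by (intro AE_I2 impI mult_mono prod_mono prod_nonneg) auto
    show "AE x in Pi\<^sub>M I (\<lambda>_. lborel). x \<notin> (\<Pi>\<^sub>E k\<in>I. ball 0 \<rho>) \<longrightarrow>
        (\<Prod>k\<in>I. h k (x k)) * G (v I x) = 0"
    proof (intro AE_I2 impI)
      fix x assume "x \<in> space (Pi\<^sub>M I (\<lambda>_. lborel :: complex measure))" "x \<notin> (\<Pi>\<^sub>E k\<in>I. ball 0 \<rho>)"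
      then obtain k where "k \<in> I" "x k \<notin> ball 0 \<rho>" by (auto simp: space_PiM PiE_iff)
      then have "h k (x k) = 0" by (simp add: h_def)
      then show "(\<Prod>k\<in>I. h k (x k)) * G (v I x) = 0"
        using fin \<open>k \<in> I\<close> by (auto intro: prod_zero)
    qed
  qed (use meas in auto)
  have main: "(\<integral>x. (\<Prod>k\<in>I. h k (x k)) * G (v I x) \<partial>Pi\<^sub>M I (\<lambda>_. lborel))
      = of_real ((pi * \<rho>\<^sup>2) ^ card I) * F (\<chi> k. c k)" for I
  proof (induction I rule: infinite_finite_induct)
    case (infinite I)
    then show ?case by simp
  next
    case empty
    have "(\<chi> k. c k) \<in> K" using c by (simp add: K_def less_imp_le)
    then show ?case by (simp add: PiM_empty lebesgue_integral_count_space_finite v_def G_def)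
  next
    case (insert i I)
    have "(\<integral>x. (\<Prod>k\<in>insert i I. h k (x k)) * G (v (insert i I) x) \<partial>Pi\<^sub>M (insert i I) (\<lambda>_. lborel))
        = (\<integral>x. \<integral>y. (\<Prod>k\<in>insert i I. h k ((x(i := y)) k)) * G (v (insert i I) (x(i := y))) \<partial>lborel
             \<partial>Pi\<^sub>M I (\<lambda>_. lborel))"
      by (rule lborel_product.product_integral_insert[OF insert.hyps int])
    also have "\<dots> = (\<integral>x. of_real (pi * \<rho>\<^sup>2) * ((\<Prod>k\<in>I. h k (x k)) * G (v I x)) \<partial>Pi\<^sub>M I (\<lambda>_. lborel))"
    proof (intro Bochner_Integration.integral_cong refl)
      fix x :: "'n \<Rightarrow> complex"
      define w where "w y = (\<chi> k. if k = i then y else v I x $ k)" for y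
      have "(\<Prod>k\<in>I. h k ((x(i := y)) k)) = (\<Prod>k\<in>I. h k (x k))" for y
        using insert.hyps by (intro prod.cong) auto
      moreover have "v (insert i I) (x(i := y)) = w y" for y
        by (auto simp: v_def w_def vec_eq_iff)
      ultimately have "(\<Prod>k\<in>insert i I. h k ((x(i := y)) k)) * G (v (insert i I) (x(i := y)))
          = (\<Prod>k\<in>I. h k (x k)) * (h i y * G (w y))" for y
        using insert.hyps by (simp add: mult.assoc mult.left_commute del: fun_upd_apply)
           (simp add: mult.assoc)
      then have "(\<integral>y. (\<Prod>k\<in>insert i I. h k ((x(i := y)) k)) * G (v (insert i I) (x(i := y))) \<partial>lborel)
          = (\<integral>y. (\<Prod>k\<in>I. h k (x k)) * (h i y * G (w y)) \<partial>lborel)"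
        by presburger
      also have "\<dots> = (\<Prod>k\<in>I. h k (x k)) * (\<integral>y. h i y * G (w y) \<partial>lborel)"
        by (rule Bochner_Integration.integral_mult_right_zero)
      also have "\<dots> = of_real (pi * \<rho>\<^sup>2) * ((\<Prod>k\<in>I. h k (x k)) * G (v I x))"
      proof (cases "\<forall>k\<in>I. x k \<in> ball 0 \<rho>")
        case False
        then obtain k where "k \<in> I" "h k (x k) = 0" by (auto simp: h_def)
        then have "(\<Prod>k\<in>I. h k (x k)) = 0" using insert.hyps by (auto intro: prod_zero)
        then show ?thesis by simp
      next
        case True
        have vx: "v I x $ j \<in> ball 0 \<rho>" for j
          using True c[of j] by (simp add: v_def)
        have wK: "w y \<in> K" if "y \<in> cball 0 \<rho>" for y
          using that vx by (auto simp: w_def K_def less_imp_le)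
        have "(\<integral>y. h i y * G (w y) \<partial>lborel) = (LINT y:ball 0 \<rho>|lborel. F (w y) / (1 - cnj y * a $ i)\<^sup>2)"
          unfolding set_lebesgue_integral_def using wK
          by (intro Bochner_Integration.integral_cong refl) (auto simp: h_def G_def indicator_def)
        also have "\<dots> = of_real (pi * \<rho>\<^sup>2) * F (w (of_real (\<rho>\<^sup>2) * a $ i))"
        proof (rule disc_reproducing[OF \<rho> a])
          show "continuous_on (cball 0 \<rho>) (\<lambda>y. F (w y))"
          proof (rule continuous_on_compose2[OF cont])
            show "continuous_on (cball 0 \<rho>) w"
              unfolding w_def
            proof (rule continuous_on_vec_lambda)
              show "continuous_on (cball 0 \<rho>) (\<lambda>y. if k = i then y else v I x $ k)" for k
                by (cases "k = i") (auto intro!: continuous_intros)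
            qed
            show "w ` cball 0 \<rho> \<subseteq> {x. \<forall>k. x $ k \<in> cball 0 \<rho>}"
              using wK by (auto simp: K_def)
          qed
          show "(\<lambda>y. F (w y)) holomorphic_on ball 0 \<rho>"
            unfolding w_def using vx by (intro hol) auto
        qed
        also have "w (of_real (\<rho>\<^sup>2) * a $ i) = v I x"
          using insert.hyps by (auto simp: w_def v_def c_def vec_eq_iff)
        also have "F (v I x) = G (v I x)"
          using vx by (simp add: G_def K_def less_imp_le)
        finally show ?thesis by simp
      qed
      finally show "(\<integral>y. (\<Prod>k\<in>insert i I. h k ((x(i := y)) k)) * G (v (insert i I) (x(i := y))) \<partial>lborel)
          = of_real (pi * \<rho>\<^sup>2) * ((\<Prod>k\<in>I. h k (x k)) * G (v I x))" .
    qed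
    also have "\<dots> = of_real (pi * \<rho>\<^sup>2) * (\<integral>x. (\<Prod>k\<in>I. h k (x k)) * G (v I x) \<partial>Pi\<^sub>M I (\<lambda>_. lborel))"
      by (rule Bochner_Integration.integral_mult_right_zero)
    also have "\<dots> = of_real ((pi * \<rho>\<^sup>2) ^ card (insert i I)) * F (\<chi> k. c k)"
      using insert.hyps by (simp add: insert.IH)
    finally show ?case .
  qed
  define Y where "Y x = (\<Prod>k\<in>UNIV. h k (x $ k)) * G x" for x
  have Ym: "Y \<in> borel_measurable borel"
    unfolding Y_def
    by (intro borel_measurable_times borel_measurable_prod Gm measurable_compose[OF _ hm]
        borel_measurable_continuous_onI continuous_intros)
  have "(LINT x:{x. \<forall>k. x $ k \<in> ball 0 \<rho>}|lborel. F x / (\<Prod>k\<in>UNIV. (1 - cnj (x $ k) * a $ k)\<^sup>2))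
      = (\<integral>x. Y x \<partial>lborel)"
    unfolding set_lebesgue_integral_def
  proof (intro Bochner_Integration.integral_cong refl)
    fix x :: "complex ^ 'n"
    show "indicator {x. \<forall>k. x $ k \<in> ball 0 \<rho>} x *\<^sub>R (F x / (\<Prod>k\<in>UNIV. (1 - cnj (x $ k) * a $ k)\<^sup>2)) = Y x"
    proof (cases "\<forall>k. x $ k \<in> ball 0 \<rho>")
      case True
      then have "x \<in> K" by (simp add: K_def less_imp_le)
      with True show ?thesis
        by (simp add: Y_def h_def G_def prod_dividef)
    next
      case False
      then obtain k where "x $ k \<notin> ball 0 \<rho>" by blast
      then have "h k (x $ k) = 0" by (simp add: h_def)
      then have "(\<Prod>k\<in>UNIV. h k (x $ k)) = 0" by (auto intro: prod_zero)
      with False show ?thesis by (simp add: Y_def)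
    qed
  qed
  also have "\<dots> = (\<integral>x. Y (v UNIV x) \<partial>Pi\<^sub>M UNIV (\<lambda>_. lborel))"
  proof -
    have "v UNIV = (\<lambda>x. \<chi> i. x i)" by (auto simp: v_def)
    then have "(lborel :: (complex ^ 'n) measure) = distr (Pi\<^sub>M UNIV (\<lambda>_. lborel)) borel (v UNIV)"
      using lborel_vec_eq_distr_PiM by simp
    then have "(\<integral>x. Y x \<partial>lborel) = (\<integral>x. Y x \<partial>distr (Pi\<^sub>M UNIV (\<lambda>_. lborel)) borel (v UNIV))"
      by simp
    also have "\<dots> = (\<integral>x. Y (v UNIV x) \<partial>Pi\<^sub>M UNIV (\<lambda>_. lborel))"
      by (rule integral_distr[OF vm Ym])
    finally show ?thesis .
  qed
  also have "\<dots> = (\<integral>x. (\<Prod>k\<in>UNIV. h k (x k)) * G (v UNIV x) \<partial>Pi\<^sub>M UNIV (\<lambda>_. lborel))"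
    by (simp add: Y_def v_def)
  also have "\<dots> = of_real ((pi * \<rho>\<^sup>2) ^ CARD('n)) * F (\<chi> k. c k)"
    by (rule main)
  finally show ?thesis by (simp add: c_def)
qed

section \<open>The domain and its polydisc slices\<close>

lemma Omega_iff:
  fixes w :: "complex ^ 'n::finite"
  assumes r: "r > 0"
  shows "(z, w) \<in> Omega r \<longleftrightarrow> cmod z < 1 \<and> (\<forall>k. cmod (w $ k) < (1 - (cmod z)\<^sup>2) powr (1 / r))"
proof -
  have eq: "(cmod z)\<^sup>2 + x powr r < 1 \<longleftrightarrow> cmod z < 1 \<and> x < (1 - (cmod z)\<^sup>2) powr (1 / r)" if x: "x \<ge> 0" for x
  proof (cases "cmod z < 1")
    case False
    then have "(cmod z)\<^sup>2 \<ge> 1" by (simp add: one_le_power)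
    then show ?thesis using False powr_ge_zero[of x r] by linarith
  next
    case True
    then have y: "1 - (cmod z)\<^sup>2 > 0" by (simp add: power_less_one_iff)
    have "x powr r < 1 - (cmod z)\<^sup>2 \<longleftrightarrow> x < (1 - (cmod z)\<^sup>2) powr (1 / r)"
    proof
      assume "x powr r < 1 - (cmod z)\<^sup>2"
      then have "(x powr r) powr (1 / r) < (1 - (cmod z)\<^sup>2) powr (1 / r)"
        using r by (intro powr_less_mono2) auto
      then show "x < (1 - (cmod z)\<^sup>2) powr (1 / r)"
        using r x by (simp add: powr_powr)
    next
      assume "x < (1 - (cmod z)\<^sup>2) powr (1 / r)"
      then have "x powr r < ((1 - (cmod z)\<^sup>2) powr (1 / r)) powr r"
        using r x by (intro powr_less_mono2) auto
      then show "x powr r < 1 - (cmod z)\<^sup>2"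
        using r y by (simp add: powr_powr)
    qed
    then show ?thesis using True by auto
  qed
  show ?thesis unfolding Omega_def using eq by auto
qed

lemma Omega_in_polydisc:
  assumes "r > 0" "p \<in> Omega r"
  shows "cmod (fst p) < 1" "cmod (snd p $ k) < 1"
proof -
  have *: "cmod (fst p) < 1" "cmod (snd p $ k) < (1 - (cmod (fst p))\<^sup>2) powr (1 / r)"
    using assms Omega_iff[OF assms(1), of "fst p" "snd p"] by auto
  show "cmod (fst p) < 1" by fact
  have "(1 - (cmod (fst p))\<^sup>2) powr (1 / r) \<le> 1"
    using *(1) assms(1) by (intro powr_le1) (auto simp: power_le_one)
  with *(2) show "cmod (snd p $ k) < 1" by simp
qed

lemma open_Omega:
  assumes "r > 0" shows "open (Omega r :: (complex \<times> (complex ^ 'n::finite)) set)"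
proof -
  have "(Omega r :: (complex \<times> (complex ^ 'n)) set)
      = (\<Inter>k. {p. (cmod (fst p))\<^sup>2 + cmod (snd p $ k) powr r < 1})"
    by (auto simp: Omega_def)
  also have "open \<dots>"
    using assms by (intro open_INT open_Collect_less continuous_intros ballI continuous_on_powr') auto
  finally show ?thesis .
qed

lemma bounded_Omega:
  assumes "r > 0" shows "bounded (Omega r :: (complex \<times> (complex ^ 'n::finite)) set)"
proof -
  have "norm p \<le> 1 + (\<Sum>k\<in>(UNIV::'n set). 1)" if p: "p \<in> Omega r" for p :: "complex \<times> (complex ^ 'n)"
  proof -
    have "norm p \<le> norm (fst p) + norm (snd p)"
      using norm_Pair_le[of "fst p" "snd p"] by simp
    also have "norm (snd p) \<le> (\<Sum>k\<in>UNIV. norm (snd p $ k))"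
      unfolding norm_vec_def by (rule L2_set_le_sum) auto
    also have "\<dots> \<le> (\<Sum>k\<in>(UNIV::'n set). 1)"
      using Omega_in_polydisc(2)[OF assms p] by (intro sum_mono) (auto simp: less_imp_le)
    finally show ?thesis using Omega_in_polydisc(1)[OF assms p] by simp
  qed
  then show ?thesis unfolding bounded_iff by blast
qed

text \<open>
  This is \<open>\<pi>^n\<close> times the Bergman kernel of the unit polydisc, as a function that is constant in the
  first coordinate.
\<close>
definition polydisc_kernel ::
    "complex ^ 'n::finite \<Rightarrow> complex \<times> (complex ^ 'n) \<Rightarrow> complex" where
  "polydisc_kernel \<zeta> p = (\<Prod>k\<in>UNIV. inverse ((1 - snd p $ k * cnj (\<zeta> $ k))\<^sup>2))"

lemma one_minus_mult_ge:
  assumes "cmod a \<le> 1"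
  shows "1 - cmod b \<le> cmod (1 - a * b)"
proof -
  have "cmod (a * b) \<le> 1 * cmod b"
    using assms unfolding norm_mult by (intro mult_right_mono) auto
  then show ?thesis using norm_triangle_ineq2[of 1 "a * b"] by simp
qed

lemma one_minus_mult_nonzero:
  assumes "cmod a \<le> 1" "cmod b < 1"
  shows "1 - a * b \<noteq> 0"
  using one_minus_mult_ge[OF assms(1), of b] assms(2) by auto

lemma bounded_holomorphic_in_bergman_space:
  assumes D: "open D" "emeasure lborel D < \<infinity>" and f: "holomorphic_sev f D"
    and K: "\<And>p. p \<in> D \<Longrightarrow> cmod (f p) \<le> K"
  shows "f \<in> bergman_space D"
proof -
  have "continuous_on D (\<lambda>p. (cmod (f p))\<^sup>2)"
    using holomorphic_sev_imp_continuous_on[OF f] by (intro continuous_intros)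
  then have m: "(\<lambda>p. indicator D p *\<^sub>R (cmod (f p))\<^sup>2) \<in> borel_measurable borel"
    using D(1) by (intro borel_measurable_continuous_on_indicator) auto
  have "set_integrable lborel D (\<lambda>p. (cmod (f p))\<^sup>2)"
    unfolding set_integrable_def
  proof (rule integrableI_bounded_set[where A = D and B = "K\<^sup>2"])
    have "(cmod (f p))\<^sup>2 \<le> K\<^sup>2" if "p \<in> D" for p
      using K[OF that] by (intro power_mono) auto
    then show "AE p in lborel. p \<in> D \<longrightarrow> norm (indicator D p *\<^sub>R (cmod (f p))\<^sup>2) \<le> K\<^sup>2"
      by auto
  qed (use D m in auto)
  then show ?thesis using f by (simp add: bergman_space_def)
qed

lemma holomorphic_polydisc_kernel:
  fixes \<zeta> :: "complex ^ 'n::finite"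
  assumes "r > 0" and \<zeta>: "\<And>k. cmod (\<zeta> $ k) < 1"
  shows "holomorphic_sev (polydisc_kernel \<zeta>) (Omega r)"
proof -
  have "holomorphic_sev (\<lambda>p :: complex \<times> (complex ^ 'n). inverse ((1 + snd p $ k * (- cnj (\<zeta> $ k))) * (1 + snd p $ k * (- cnj (\<zeta> $ k))))) (Omega r)" for k
  proof (intro holomorphic_sev_inverse holomorphic_sev_mult holomorphic_sev_add holomorphic_sev_const
      holomorphic_sev_coordinate)
    fix p :: "complex \<times> (complex ^ 'n)" assume "p \<in> Omega r"
    then have "1 - snd p $ k * cnj (\<zeta> $ k) \<noteq> 0"
      using Omega_in_polydisc(2)[OF assms(1), of p k] \<zeta>[of k] by (intro one_minus_mult_nonzero) auto
    then show "(1 + snd p $ k * (- cnj (\<zeta> $ k))) * (1 + snd p $ k * (- cnj (\<zeta> $ k))) \<noteq> 0" by simp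
  qed
  then have "holomorphic_sev (\<lambda>p :: complex \<times> (complex ^ 'n). inverse ((1 - snd p $ k * cnj (\<zeta> $ k))\<^sup>2)) (Omega r)" for k
    by (simp add: power2_eq_square)
  then show ?thesis
    unfolding polydisc_kernel_def[abs_def] by (intro holomorphic_sev_prod) auto
qed

lemma polydisc_kernel_bounded:
  fixes \<zeta> :: "complex ^ 'n::finite"
  assumes r: "r > 0" and \<zeta>: "\<And>k. cmod (\<zeta> $ k) < 1" and p: "p \<in> Omega r"
  shows "cmod (polydisc_kernel \<zeta> p) \<le> (\<Prod>k\<in>UNIV. inverse ((1 - cmod (\<zeta> $ k))\<^sup>2))"
proof -
  have "cmod (polydisc_kernel \<zeta> p) = (\<Prod>k\<in>UNIV. inverse ((cmod (1 - snd p $ k * cnj (\<zeta> $ k)))\<^sup>2))"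
    by (simp add: polydisc_kernel_def norm_inverse norm_power flip: prod_norm)
  also have "\<dots> \<le> (\<Prod>k\<in>UNIV. inverse ((1 - cmod (\<zeta> $ k))\<^sup>2))"
  proof (intro prod_mono conjI le_imp_inverse_le power_mono)
    show "1 - cmod (\<zeta> $ k) \<le> cmod (1 - snd p $ k * cnj (\<zeta> $ k))" for k
      using one_minus_mult_ge[of "snd p $ k" "cnj (\<zeta> $ k)"] Omega_in_polydisc(2)[OF r p, of k] by simp
    show "0 < (1 - cmod (\<zeta> $ k))\<^sup>2" "0 \<le> 1 - cmod (\<zeta> $ k)" for k using \<zeta>[of k] by auto
  qed auto
  finally show ?thesis .
qed

lemma emeasure_Omega_finite:
  "r > 0 \<Longrightarrow> emeasure lborel (Omega r :: (complex \<times> (complex ^ 'n::finite)) set) < \<infinity>"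
  using emeasure_bounded_finite[OF bounded_Omega] by simp

lemma polydisc_kernel_in_bergman_space:
  fixes \<zeta> :: "complex ^ 'n::finite"
  assumes r: "r > 0" and \<zeta>: "\<And>k. cmod (\<zeta> $ k) < 1"
  shows "polydisc_kernel \<zeta> \<in> bergman_space (Omega r)"
  using bounded_holomorphic_in_bergman_space[OF open_Omega[OF r] emeasure_Omega_finite[OF r]
      holomorphic_polydisc_kernel[OF r \<zeta>] polydisc_kernel_bounded[OF r \<zeta>]] .

text \<open>
  These domains exhaust \<open>Omega r\<close> as \<open>\<tau>\<close> tends to 1.  Their slices have closures inside
  \<open>Omega r\<close>, so a Bergman function is bounded and continuous up to the boundary of each slice, while on
  the slices of \<open>Omega r\<close> itself it might not even be integrable.
\<close>
definition inner_domain :: "real \<Rightarrow> real \<Rightarrow> (complex \<times> (complex ^ 'n::finite)) set" where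
  "inner_domain r \<tau> = {(z, w). cmod z < \<tau> \<and> (\<forall>k. cmod (w $ k) < \<tau> * (1 - (cmod z)\<^sup>2) powr (1 / r))}"

lemma inner_domain_subset:
  assumes r: "r > 0" and \<tau>: "0 < \<tau>" "\<tau> < 1"
  shows "inner_domain r \<tau> \<subseteq> (Omega r :: (complex \<times> (complex ^ 'n::finite)) set)"
proof
  fix p :: "complex \<times> (complex ^ 'n)" assume "p \<in> inner_domain r \<tau>"
  then obtain z w where p: "p = (z, w)" "cmod z < \<tau>" "\<And>k. cmod (w $ k) < \<tau> * (1 - (cmod z)\<^sup>2) powr (1 / r)"
    by (auto simp: inner_domain_def)
  have "\<tau> * (1 - (cmod z)\<^sup>2) powr (1 / r) \<le> (1 - (cmod z)\<^sup>2) powr (1 / r)"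
    using \<tau> by (intro mult_left_le_one_le) auto
  then show "p \<in> Omega r"
    unfolding p(1) Omega_iff[OF r] using p(2,3) \<tau> by (auto intro: less_le_trans)
qed

lemma open_inner_domain:
  assumes \<tau>: "0 < \<tau>" "\<tau> < 1"
  shows "open (inner_domain r \<tau> :: (complex \<times> (complex ^ 'n::finite)) set)"
proof -
  define \<rho> where "\<rho> z = \<tau> * (1 - (cmod z)\<^sup>2) powr (1 / r)" for z
  have "(inner_domain r \<tau> :: (complex \<times> (complex ^ 'n)) set)
      = (fst -` ball 0 \<tau>) \<inter> (\<Inter>k. {p \<in> fst -` ball 0 \<tau>. cmod (snd p $ k) < \<rho> (fst p)})"
    by (auto simp: inner_domain_def \<rho>_def)
  also have "open \<dots>"
  proof (intro open_Int open_INT ballI)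
    show o: "open (fst -` ball (0::complex) \<tau> :: (complex \<times> (complex ^ 'n)) set)"
      by (intro open_vimage continuous_intros) auto
    fix k :: 'n
    have "1 - (cmod z)\<^sup>2 \<noteq> 0" if "cmod z < \<tau>" for z
      using that \<tau> power_less_one_iff[of "cmod z" 2] by auto
    then have "continuous_on (fst -` ball (0::complex) \<tau>) (\<lambda>p::complex \<times> (complex ^ 'n). \<rho> (fst p) - cmod (snd p $ k))"
      unfolding \<rho>_def by (intro continuous_intros) auto
    from continuous_open_preimage[OF this o, of "{0<..}"]
    show "open {p \<in> fst -` ball (0::complex) \<tau>. cmod ((snd p :: complex ^ 'n) $ k) < \<rho> (fst p)}"
      by (simp add: Int_def vimage_def)
  qed simp
  finally show ?thesis .
qed

text \<open>
  Integrate over \<open>w\<close> first.  The polydisc formula leaves \<open>s^n f(z, s\<zeta>)\<close> with \<open>s\<close> the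
  squared radius of the slice, a function of \<open>|z|\<^sup>2\<close>.  On each circle in \<open>z\<close> this \<open>s\<close> is
  constant, so the circle mean of \<open>f\<close> is its value at \<open>z = 0\<close>.
\<close>
lemma inner_domain_integral:
  fixes f :: "complex \<times> (complex ^ 'n::finite) \<Rightarrow> complex" and \<zeta> :: "complex ^ 'n"
  assumes r: "r > 0" and \<tau>: "0 < \<tau>" "\<tau> < 1" and \<zeta>: "\<And>k. cmod (\<zeta> $ k) < 1"
    and f: "f \<in> bergman_space (Omega r)"
  shows "(LINT p:inner_domain r \<tau>|lborel. f p * cnj (polydisc_kernel \<zeta> p))
       = of_real (pi ^ (CARD('n) + 1)) * integral {0..\<tau>\<^sup>2} (\<lambda>u.
           of_real ((\<tau>\<^sup>2 * (1 - u) powr (2 / r)) ^ CARD('n))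
             * f (0, \<chi> k. of_real (\<tau>\<^sup>2 * (1 - u) powr (2 / r)) * \<zeta> $ k))"
proof -
  define \<rho> where "\<rho> z = \<tau> * (1 - (cmod z)\<^sup>2) powr (1 / r)" for z
  define s where "s u = \<tau>\<^sup>2 * (1 - u) powr (2 / r)" for u :: real
  have \<rho>s: "(\<rho> z)\<^sup>2 = s ((cmod z)\<^sup>2)" if "cmod z < 1" for z
  proof -
    have "((1 - (cmod z)\<^sup>2) powr (1 / r))\<^sup>2 = (1 - (cmod z)\<^sup>2) powr (2 / r)"
      by (simp add: power2_eq_square flip: powr_add)
    then show ?thesis by (simp add: \<rho>_def s_def power_mult_distrib)
  qed
  have q: "0 < (1 - (cmod z)\<^sup>2) powr (1 / r)" "(1 - (cmod z)\<^sup>2) powr (1 / r) \<le> 1" if "cmod z < 1" for z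
  proof -
    have "(cmod z)\<^sup>2 < 1" using that by (simp add: power_less_one_iff)
    then show "0 < (1 - (cmod z)\<^sup>2) powr (1 / r)" "(1 - (cmod z)\<^sup>2) powr (1 / r) \<le> 1"
      using r by (auto intro!: powr_le1)
  qed
  have \<rho>: "0 < \<rho> z" "\<rho> z < (1 - (cmod z)\<^sup>2) powr (1 / r)" "\<rho> z \<le> 1" if "cmod z < 1" for z
    using q[OF that] \<tau> by (auto simp: \<rho>_def intro: mult_le_one)
  have inO: "(z, w) \<in> Omega r" if "cmod z < 1" "\<And>k. cmod (w $ k) \<le> \<rho> z" for z and w :: "complex ^ 'n"
    unfolding Omega_iff[OF r] using that \<rho>[OF that(1)] by (auto intro: le_less_trans)
  note sub = inner_domain_subset[OF r \<tau>, where ?'n = 'n]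
  have contf: "continuous_on (Omega r) f"
    using f by (auto simp: bergman_space_def intro: holomorphic_sev_imp_continuous_on)
  have holf: "holomorphic_sev f (Omega r)" using f by (simp add: bergman_space_def)
  have sz: "cmod (of_real (s ((cmod z)\<^sup>2)) * \<zeta> $ k) \<le> \<rho> z" if "cmod z < 1" for z k
  proof -
    have "s ((cmod z)\<^sup>2) * cmod (\<zeta> $ k) \<le> (\<rho> z)\<^sup>2 * 1"
      unfolding \<rho>s[OF that, symmetric] using \<zeta>[of k] by (intro mult_left_mono) (auto simp: less_imp_le)
    also have "\<dots> \<le> \<rho> z" using \<rho>[OF that] by (simp add: power2_eq_square mult_left_le)
    finally show ?thesis using \<rho>s[OF that] zero_le_power2[of "\<rho> z"] by (simp add: norm_mult)
  qed
  note opn = open_inner_domain[OF \<tau>, where ?'n = 'n and r = r]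
  define g where "g p = f p * cnj (polydisc_kernel \<zeta> p)" for p
  have "set_integrable lborel (Omega r) g"
    unfolding g_def[abs_def]
    by (intro bergman_space_integrable open_Omega r f polydisc_kernel_in_bergman_space \<zeta>)
  then have "set_integrable lborel (inner_domain r \<tau>) g"
    by (rule set_integrable_subset) (use opn sub in auto)
  then have int: "integrable (lborel \<Otimes>\<^sub>M lborel) (\<lambda>p. indicator (inner_domain r \<tau>) p *\<^sub>R g p)"
    by (simp add: set_integrable_def lborel_prod)
  have "(LINT p:inner_domain r \<tau>|lborel. g p)
      = (LINT z|lborel. LINT w|lborel. indicator (inner_domain r \<tau>) (z, w) *\<^sub>R g (z, w))"
    unfolding set_lebesgue_integral_def lborel_prod[symmetric] by (rule lborel_pair.integral_fst'[OF int, symmetric])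
  also have "\<dots> = (LINT z|lborel. indicator (ball 0 \<tau>) z *\<^sub>R (of_real (pi ^ CARD('n)) *
       (of_real (s ((cmod z)\<^sup>2) ^ CARD('n)) * f (z, \<chi> k. of_real (s ((cmod z)\<^sup>2)) * \<zeta> $ k))))"
  proof (intro Bochner_Integration.integral_cong refl)
    fix z :: complex
    show "(LINT w|lborel. indicator (inner_domain r \<tau>) (z, w) *\<^sub>R g (z, w))
      = indicator (ball 0 \<tau>) z *\<^sub>R (of_real (pi ^ CARD('n)) *
       (of_real (s ((cmod z)\<^sup>2) ^ CARD('n)) * f (z, \<chi> k. of_real (s ((cmod z)\<^sup>2)) * \<zeta> $ k)))"
    proof (cases "cmod z < \<tau>")
      case False
      then show ?thesis by (simp add: inner_domain_def)
    next
      case True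
      then have z1: "cmod z < 1" using \<tau> by simp
      have "(LINT w|lborel. indicator (inner_domain r \<tau>) (z, w) *\<^sub>R g (z, w))
          = (LINT w:{w. \<forall>k. w $ k \<in> ball 0 (\<rho> z)}|lborel. f (z, w) / (\<Prod>k\<in>UNIV. (1 - cnj (w $ k) * \<zeta> $ k)\<^sup>2))"
        unfolding set_lebesgue_integral_def using True
        by (intro Bochner_Integration.integral_cong refl)
           (auto simp: indicator_def inner_domain_def \<rho>_def g_def polydisc_kernel_def divide_inverse
             simp flip: prod_inversef)
      also have "\<dots> = of_real ((pi * (\<rho> z)\<^sup>2) ^ CARD('n)) * f (z, \<chi> k. of_real ((\<rho> z)\<^sup>2) * \<zeta> $ k)"
      proof (rule polydisc_reproducing[OF \<rho>(1)[OF z1] \<rho>(3)[OF z1] \<zeta>])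
        show "continuous_on {x. \<forall>k. x $ k \<in> cball 0 (\<rho> z)} (\<lambda>w. f (z, w))"
          by (rule continuous_on_compose2[OF contf]) (auto intro!: continuous_intros inO z1)
        fix x :: "complex ^ 'n" and k
        assume x: "\<And>j. x $ j \<in> ball 0 (\<rho> z)"
        define b where "b = (z, \<chi> j. if j = k then 0 else x $ j)"
        have eq: "(z, \<chi> j. if j = k then u else x $ j) = b + cscale u (0, axis k 1)" for u
          by (auto simp: b_def cscale_def vec_eq_iff axis_def)
        have "(\<lambda>u. f (b + cscale u (0, axis k 1))) field_differentiable at u"
          if "u \<in> ball 0 (\<rho> z)" for u
        proof (rule holomorphic_sev_along_line[OF holf])
          show "b + cscale u (0, axis k 1) \<in> Omega r"
            unfolding eq[symmetric] using that x by (intro inO z1) (auto simp: less_imp_le)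
        qed
        then show "(\<lambda>u. f (z, \<chi> j. if j = k then u else x $ j)) holomorphic_on ball 0 (\<rho> z)"
          unfolding eq by (auto simp: holomorphic_on_def intro: field_differentiable_at_within)
      qed
      finally show ?thesis using True by (simp add: \<rho>s[OF z1] power_mult_distrib)
    qed
  qed
  also have "\<dots> = of_real (pi ^ CARD('n)) * (LINT z:ball 0 \<tau>|lborel.
       of_real (s ((cmod z)\<^sup>2) ^ CARD('n)) * f (z, \<chi> k. of_real (s ((cmod z)\<^sup>2)) * \<zeta> $ k))"
    unfolding set_lebesgue_integral_def mult_scaleR_right[symmetric]
    by (rule Bochner_Integration.integral_mult_right_zero)
  also have "(LINT z:ball 0 \<tau>|lborel.
       of_real (s ((cmod z)\<^sup>2) ^ CARD('n)) * f (z, \<chi> k. of_real (s ((cmod z)\<^sup>2)) * \<zeta> $ k))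
     = of_real pi * integral {0..\<tau>\<^sup>2} (\<lambda>u. of_real (s u ^ CARD('n)) * f (0, \<chi> k. of_real (s u) * \<zeta> $ k))"
  proof (rule disc_integral_of_circle_means[OF \<tau>(1)])
    have \<tau>2: "\<tau>\<^sup>2 < 1" using \<tau> by (simp add: power_less_one_iff)
    have sz0: "(0, \<chi> k. of_real (s u) * \<zeta> $ k) \<in> Omega r" if "u \<in> {0..\<tau>\<^sup>2}" for u
    proof (rule inO)
      have u: "u = (cmod (of_real (sqrt u)))\<^sup>2" "cmod (complex_of_real (sqrt u)) < 1"
        using that \<tau>2 by auto
      have "\<rho> (of_real (sqrt u)) \<le> \<rho> 0"
        unfolding \<rho>_def using \<tau> r u that by (intro mult_left_mono powr_mono2) auto
      then show "cmod ((\<chi> k. of_real (s u) * \<zeta> $ k) $ k) \<le> \<rho> 0" for k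
        using sz[OF u(2), of k] u(1) by simp
    qed simp
    have cs: "continuous_on {0..\<tau>\<^sup>2} s"
      unfolding s_def using \<tau>2 by (intro continuous_intros) auto
    show "continuous_on {0..\<tau>\<^sup>2} (\<lambda>u. of_real (s u ^ CARD('n)) * f (0, \<chi> k. of_real (s u) * \<zeta> $ k))"
      using sz0 by (intro continuous_intros cs continuous_on_compose2[OF contf] continuous_on_vec_lambda) auto
    have cs': "continuous_on (cball 0 \<tau>) (\<lambda>z. s ((cmod z)\<^sup>2))"
      by (rule continuous_on_compose2[OF cs]) (auto intro!: continuous_intros power_mono)
    show "continuous_on (cball 0 \<tau>) (\<lambda>z. of_real (s ((cmod z)\<^sup>2) ^ CARD('n)) * f (z, \<chi> k. of_real (s ((cmod z)\<^sup>2)) * \<zeta> $ k))"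
    proof (intro continuous_intros cs' continuous_on_compose2[OF contf] continuous_on_vec_lambda)
      have "(z, \<chi> k. of_real (s ((cmod z)\<^sup>2)) * \<zeta> $ k) \<in> Omega r" if "cmod z \<le> \<tau>" for z :: complex
        using that \<tau> sz[of z] by (intro inO) auto
      then show "(\<lambda>z. (z, \<chi> k. of_real (s ((cmod z)\<^sup>2)) * \<zeta> $ k)) ` cball 0 \<tau> \<subseteq> Omega r"
        by auto
    qed
    fix z :: complex assume z: "z \<in> ball 0 \<tau>"
    then have z1: "cmod z < 1" using \<tau> by simp
    let ?w = "\<chi> k. of_real (s ((cmod z)\<^sup>2)) * \<zeta> $ k"
    have vz: "(v * z, ?w) \<in> Omega r" if "v \<in> cball 0 1" for v
    proof (rule inO)
      have "cmod (v * z) \<le> 1 * cmod z"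
        using that unfolding norm_mult by (intro mult_right_mono) auto
      then have le: "cmod (v * z) \<le> cmod z" by simp
      then show "cmod (v * z) < 1" using z1 by simp
      have "\<rho> z \<le> \<rho> (v * z)"
        unfolding \<rho>_def using \<tau> r le z1
        by (intro mult_left_mono powr_mono2) (auto intro!: power_mono simp: power_le_one)
      then show "cmod (?w $ k) \<le> \<rho> (v * z)" for k
        using sz[OF z1, of k] by simp
    qed
    define P where "P v = of_real (s ((cmod z)\<^sup>2) ^ CARD('n)) * f (v * z, ?w)" for v
    have "continuous_on (cball 0 1) P"
      unfolding P_def using vz by (intro continuous_intros continuous_on_compose2[OF contf]) auto
    moreover have "P holomorphic_on ball 0 1"
    proof -
      have eq: "(v * z, ?w) = (0, ?w) + cscale v (z, 0)" for v
        by (simp add: cscale_def)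
      have "(\<lambda>v. f ((0, ?w) + cscale v (z, 0))) field_differentiable at v" if "v \<in> ball 0 1" for v
        using vz[of v] that unfolding eq by (intro holomorphic_sev_along_line[OF holf]) auto
      then have "(\<lambda>v. f (v * z, ?w)) holomorphic_on ball 0 1"
        unfolding eq by (auto simp: holomorphic_on_def intro: field_differentiable_at_within)
      then show ?thesis unfolding P_def by (intro holomorphic_intros)
    qed
    ultimately have "((\<lambda>x. P (exp (2 * of_real pi * \<i> * of_real x))) has_integral P 0) {0..1}"
      by (rule circle_mean_value)
    then show "((\<lambda>x. of_real (s ((cmod (exp (2 * of_real pi * \<i> * of_real x) * z))\<^sup>2) ^ CARD('n))
          * f (exp (2 * of_real pi * \<i> * of_real x) * z,
               \<chi> k. of_real (s ((cmod (exp (2 * of_real pi * \<i> * of_real x) * z))\<^sup>2)) * \<zeta> $ k))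
        has_integral of_real (s ((cmod z)\<^sup>2) ^ CARD('n)) * f (0, ?w)) {0..1}"
      by (simp add: P_def norm_mult)
  qed
  finally show ?thesis by (simp add: g_def s_def mult.assoc)
qed

section \<open>Pairing with the polydisc kernel\<close>

lemma Omega_slice_continuous:
  fixes f :: "complex \<times> (complex ^ 'n::finite) \<Rightarrow> complex"
  assumes r: "r > 0" and \<zeta>: "\<And>k. cmod (\<zeta> $ k) < 1" and f: "f \<in> bergman_space (Omega r)"
  shows "continuous_on {0..1} (\<lambda>s. of_real (s ^ m) * f (0, \<chi> k. of_real s * \<zeta> $ k))"
proof -
  have contf: "continuous_on (Omega r) f"
    using f by (auto simp: bergman_space_def intro: holomorphic_sev_imp_continuous_on)
  have *: "\<bar>s\<bar> * cmod (\<zeta> $ k) < 1" if "s \<in> {0..1}" for s k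
  proof -
    have "\<bar>s\<bar> * cmod (\<zeta> $ k) \<le> 1 * cmod (\<zeta> $ k)"
      using that by (intro mult_right_mono) auto
    then show ?thesis using \<zeta>[of k] by simp
  qed
  show ?thesis
  proof (intro continuous_intros continuous_on_compose2[OF contf] continuous_on_vec_lambda)
    show "(\<lambda>s. (0, \<chi> k. of_real s * \<zeta> $ k)) ` {0..1} \<subseteq> Omega r"
      using * by (auto simp: Omega_iff[OF r] norm_mult)
  qed
qed

text \<open>
  Both sides of the formula for the inner domains converge by dominated convergence: the left one because
  \<open>f cnj H\<close> is integrable over \<open>Omega r\<close>, the right one because \<open>G\<close> is bounded.
\<close>
lemma polydisc_kernel_pairing:
  fixes f :: "complex \<times> (complex ^ 'n::finite) \<Rightarrow> complex" and \<zeta> :: "complex ^ 'n"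
  assumes r: "r > 0" and \<zeta>: "\<And>k. cmod (\<zeta> $ k) < 1" and f: "f \<in> bergman_space (Omega r)"
  shows "l2_inner (Omega r) f (polydisc_kernel \<zeta>)
       = of_real (pi ^ (CARD('n) + 1)) * integral {0..1} (\<lambda>u.
           of_real (((1 - u) powr (2 / r)) ^ CARD('n))
             * f (0, \<chi> k. of_real ((1 - u) powr (2 / r)) * \<zeta> $ k))"
proof -
  define L where "L j = 1 - inverse (real (Suc (Suc j)))" for j
  have L: "0 < L j" "L j < 1" "(L j)\<^sup>2 < 1" for j
  proof -
    have "0 < inverse (real (Suc (Suc j)))" "inverse (real (Suc (Suc j))) < 1"
      by (auto simp: inverse_less_1_iff simp del: of_nat_Suc)
    then show "0 < L j" "L j < 1" by (auto simp: L_def)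
    then show "(L j)\<^sup>2 < 1" by (simp add: power_less_one_iff)
  qed
  have limL: "L \<longlonglongrightarrow> 1"
    unfolding L_def[abs_def]
    using tendsto_diff[OF tendsto_const[of 1] LIMSEQ_Suc[OF LIMSEQ_inverse_real_of_nat]] by simp
  define G where "G s = of_real (s ^ CARD('n)) * f (0, \<chi> k. of_real s * \<zeta> $ k)" for s :: real
  define g where "g p = f p * cnj (polydisc_kernel \<zeta> p)" for p
  have fin: "integral {0..(L j)\<^sup>2} (\<lambda>u. G ((L j)\<^sup>2 * (1 - u) powr (2 / r)))
      = (LINT u|lborel. indicator {0..(L j)\<^sup>2} u *\<^sub>R G ((L j)\<^sup>2 * (1 - u) powr (2 / r)))"
     "integrable lborel (\<lambda>u. indicator {0..(L j)\<^sup>2} u *\<^sub>R G ((L j)\<^sup>2 * (1 - u) powr (2 / r)))"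
    if contG: "continuous_on {0..1} G" for j
  proof -
    have "continuous_on {0..(L j)\<^sup>2} (\<lambda>u. (L j)\<^sup>2 * (1 - u) powr (2 / r))"
      using L(3)[of j] by (intro continuous_intros) auto
    then have "continuous_on {0..(L j)\<^sup>2} (\<lambda>u. G ((L j)\<^sup>2 * (1 - u) powr (2 / r)))"
      using L[of j] r
      by (intro continuous_on_compose2[OF contG]) (auto intro!: mult_le_one powr_le1)
    then have i: "set_integrable lborel {0..(L j)\<^sup>2} (\<lambda>u. G ((L j)\<^sup>2 * (1 - u) powr (2 / r)))"
      by (rule borel_integrable_atLeastAtMost')
    then show "integrable lborel (\<lambda>u. indicator {0..(L j)\<^sup>2} u *\<^sub>R G ((L j)\<^sup>2 * (1 - u) powr (2 / r)))"
      by (simp add: set_integrable_def)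
    show "integral {0..(L j)\<^sup>2} (\<lambda>u. G ((L j)\<^sup>2 * (1 - u) powr (2 / r)))
      = (LINT u|lborel. indicator {0..(L j)\<^sup>2} u *\<^sub>R G ((L j)\<^sup>2 * (1 - u) powr (2 / r)))"
      using set_borel_integral_eq_integral(2)[OF i] by (simp add: set_lebesgue_integral_def)
  qed
  have contG: "continuous_on {0..1} G"
    unfolding G_def by (rule Omega_slice_continuous[OF r \<zeta> f])
  have intg: "integrable lborel (\<lambda>p. indicator (Omega r) p *\<^sub>R g p)"
    using bergman_space_integrable[OF open_Omega[OF r] f polydisc_kernel_in_bergman_space[OF r \<zeta>]]
    by (simp add: set_integrable_def g_def)
  have sub: "inner_domain r (L j) \<subseteq> (Omega r :: (complex \<times> (complex ^ 'n)) set)" for j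
    using inner_domain_subset[OF r L(1,2)] .
  have lim1: "(\<lambda>j. LINT p|lborel. indicator (inner_domain r (L j)) p *\<^sub>R g p)
      \<longlonglongrightarrow> (LINT p|lborel. indicator (Omega r) p *\<^sub>R g p)"
  proof (rule integral_dominated_convergence[where w = "\<lambda>p. norm (indicator (Omega r) p *\<^sub>R g p)"])
    show "(\<lambda>p. indicator (Omega r) p *\<^sub>R g p) \<in> borel_measurable lborel"
      using intg by auto
    show "(\<lambda>p. indicator (inner_domain r (L j)) p *\<^sub>R g p) \<in> borel_measurable lborel" for j
    proof -
      have "set_integrable lborel (inner_domain r (L j)) g"
        by (rule set_integrable_subset[where A = "Omega r"])
           (use intg sub borel_open[OF open_inner_domain[OF L(1)[of j] L(2)[of j]]] in \<open>auto simp: set_integrable_def\<close>)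
      then show ?thesis by (auto simp: set_integrable_def)
    qed
    show "integrable lborel (\<lambda>p. norm (indicator (Omega r) p *\<^sub>R g p))"
      using intg by (rule integrable_norm)
    show "AE p in lborel. norm (indicator (inner_domain r (L j)) p *\<^sub>R g p) \<le> norm (indicator (Omega r) p *\<^sub>R g p)" for j
      using sub[of j] by (intro AE_I2) (auto simp: indicator_def)
    show "AE p in lborel. (\<lambda>j. indicator (inner_domain r (L j)) p *\<^sub>R g p) \<longlonglongrightarrow> indicator (Omega r) p *\<^sub>R g p"
    proof (intro AE_I2)
      fix p :: "complex \<times> (complex ^ 'n)"
      show "(\<lambda>j. indicator (inner_domain r (L j)) p *\<^sub>R g p) \<longlonglongrightarrow> indicator (Omega r) p *\<^sub>R g p"
      proof (cases "p \<in> Omega r")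
        case False
        then have "p \<notin> inner_domain r (L j)" for j using sub by blast
        then show ?thesis using False by simp
      next
        case True
        obtain z w where p: "p = (z, w)" by (cases p)
        define q where "q = (1 - (cmod z)\<^sup>2) powr (1 / r)"
        have zw: "cmod z < 1" "\<And>k. cmod (w $ k) < q"
          using True Omega_iff[OF r, of z w] by (auto simp: p q_def)
        have "(\<lambda>j. L j * q) \<longlonglongrightarrow> 1 * q" by (intro tendsto_intros limL)
        then have "\<forall>\<^sub>F j in sequentially. cmod (w $ k) < L j * q" for k
          using zw(2)[of k] by (auto dest: order_tendstoD(1))
        then have "\<forall>\<^sub>F j in sequentially. \<forall>k. cmod (w $ k) < L j * q"
          by (rule eventually_all_finite)
        moreover have "\<forall>\<^sub>F j in sequentially. cmod z < L j"
          using order_tendstoD(1)[OF limL zw(1)] .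
        ultimately have "\<forall>\<^sub>F j in sequentially. p \<in> inner_domain r (L j)"
          by eventually_elim (auto simp: inner_domain_def p q_def)
        then have "\<forall>\<^sub>F j in sequentially. indicator (inner_domain r (L j)) p *\<^sub>R g p = indicator (Omega r) p *\<^sub>R g p"
          using True by (auto elim: eventually_mono)
        then show ?thesis by (rule tendsto_eventually)
      qed
    qed
  qed
  obtain C where C: "\<And>s. s \<in> {0..1} \<Longrightarrow> cmod (G s) \<le> C"
    using compact_imp_bounded[OF compact_continuous_image[OF contG compact_Icc]]
    unfolding bounded_iff by blast
  have sin: "(L j)\<^sup>2 * (1 - u) powr (2 / r) \<in> {0..1}" "(1 - u) powr (2 / r) \<in> {0..1}" if "u \<in> {0..1}" for j u
    using that L[of j] r by (auto intro!: mult_le_one powr_le1)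
  have contG1: "continuous_on {0..1} (\<lambda>u. G ((1 - u) powr (2 / r)))"
    using r sin by (intro continuous_on_compose2[OF contG] continuous_on_powr' continuous_intros) auto
  have lim2: "(\<lambda>j. LINT u|lborel. indicator {0..(L j)\<^sup>2} u *\<^sub>R G ((L j)\<^sup>2 * (1 - u) powr (2 / r)))
      \<longlonglongrightarrow> (LINT u|lborel. indicator {0..1} u *\<^sub>R G ((1 - u) powr (2 / r)))"
  proof (rule integral_dominated_convergence[where w = "\<lambda>u. indicator {0..1} u * C"])
    show "(\<lambda>u. indicator {0..1} u *\<^sub>R G ((1 - u) powr (2 / r))) \<in> borel_measurable lborel"
      using contG1 borel_measurable_continuous_on_indicator[of "{0..1::real}"] by auto
    show "(\<lambda>u. indicator {0..(L j)\<^sup>2} u *\<^sub>R G ((L j)\<^sup>2 * (1 - u) powr (2 / r))) \<in> borel_measurable lborel" for j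
      using fin(2)[OF contG, of j] by (rule borel_measurable_integrable)
    show "integrable lborel (\<lambda>u::real. indicator {0..1} u * C)"
      by simp
    show "AE u in lborel. norm (indicator {0..(L j)\<^sup>2} u *\<^sub>R G ((L j)\<^sup>2 * (1 - u) powr (2 / r))) \<le> indicator {0..1} u * C" for j
      using C sin(1)[of _ j] L(3)[of j] order_trans[OF norm_ge_zero C[of 0]]
      by (intro AE_I2) (auto simp: indicator_def)
    show "AE u in lborel. (\<lambda>j. indicator {0..(L j)\<^sup>2} u *\<^sub>R G ((L j)\<^sup>2 * (1 - u) powr (2 / r)))
        \<longlonglongrightarrow> indicator {0..1} u *\<^sub>R G ((1 - u) powr (2 / r))"
    proof (intro AE_I2)
      fix u :: real
      consider "u < 0 \<or> u > 1" | "u = 1" | "0 \<le> u" "u < 1" by linarith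
      then show "(\<lambda>j. indicator {0..(L j)\<^sup>2} u *\<^sub>R G ((L j)\<^sup>2 * (1 - u) powr (2 / r)))
        \<longlonglongrightarrow> indicator {0..1} u *\<^sub>R G ((1 - u) powr (2 / r))"
      proof cases
        case 1
        then have "u \<notin> {0..(L j)\<^sup>2}" "u \<notin> {0..1}" for j using L(3)[of j] by auto
        then show ?thesis by simp
      next
        case 2
        \<comment> \<open>The limit at this endpoint is right because \<open>G 0 = 0\<close>.\<close>
        then show ?thesis by (simp add: G_def power_0_left)
      next
        case 3
        have L2: "(\<lambda>j. (L j)\<^sup>2) \<longlonglongrightarrow> 1\<^sup>2" by (intro tendsto_intros limL)
        then have ev: "\<forall>\<^sub>F j in sequentially. u < (L j)\<^sup>2"
          using 3 by (auto dest: order_tendstoD(1))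
        have "(\<lambda>j. (L j)\<^sup>2 * (1 - u) powr (2 / r)) \<longlonglongrightarrow> 1\<^sup>2 * (1 - u) powr (2 / r)"
          by (intro tendsto_intros L2)
        then have "(\<lambda>j. G ((L j)\<^sup>2 * (1 - u) powr (2 / r))) \<longlonglongrightarrow> G ((1 - u) powr (2 / r))"
          using 3 sin by (intro continuous_on_tendsto_compose[OF contG]) auto
        moreover have "\<forall>\<^sub>F j in sequentially. G ((L j)\<^sup>2 * (1 - u) powr (2 / r))
            = indicator {0..(L j)\<^sup>2} u *\<^sub>R G ((L j)\<^sup>2 * (1 - u) powr (2 / r))"
          using ev by eventually_elim (use 3 in auto)
        ultimately have "(\<lambda>j. indicator {0..(L j)\<^sup>2} u *\<^sub>R G ((L j)\<^sup>2 * (1 - u) powr (2 / r)))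
            \<longlonglongrightarrow> G ((1 - u) powr (2 / r))"
          by (rule Lim_transform_eventually)
        then show ?thesis using 3 by simp
      qed
    qed
  qed
  have "(LINT p|lborel. indicator (inner_domain r (L j)) p *\<^sub>R g p)
      = of_real (pi ^ (CARD('n) + 1))
        * (LINT u|lborel. indicator {0..(L j)\<^sup>2} u *\<^sub>R G ((L j)\<^sup>2 * (1 - u) powr (2 / r)))" for j
    using inner_domain_integral[OF r L(1,2)[of j] \<zeta> f]
    unfolding fin(1)[OF contG, symmetric] by (simp add: set_lebesgue_integral_def g_def G_def)
  then have "(\<lambda>j. LINT p|lborel. indicator (inner_domain r (L j)) p *\<^sub>R g p)
      \<longlonglongrightarrow> of_real (pi ^ (CARD('n) + 1)) * (LINT u|lborel. indicator {0..1} u *\<^sub>R G ((1 - u) powr (2 / r)))"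
    using tendsto_mult_left[OF lim2] by presburger
  from LIMSEQ_unique[OF lim1 this]
  have "l2_inner (Omega r) f (polydisc_kernel \<zeta>)
      = of_real (pi ^ (CARD('n) + 1)) * (LINT u:{0..1}|lborel. G ((1 - u) powr (2 / r)))"
    by (simp add: l2_inner_def set_lebesgue_integral_def g_def)
  also have "(LINT u:{0..1}|lborel. G ((1 - u) powr (2 / r))) = integral {0..1} (\<lambda>u. G ((1 - u) powr (2 / r)))"
    by (intro set_borel_integral_eq_integral borel_integrable_atLeastAtMost' contG1)
  finally show ?thesis by (simp add: G_def)
qed

section \<open>Differentiating in the dilation parameter\<close>

lemma has_vector_derivative_imp_sequence:
  fixes f :: "real \<Rightarrow> 'a::real_normed_vector"
  assumes "(f has_vector_derivative D) (at x within S)"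
    and X: "\<And>j. X j \<in> S - {x}" "X \<longlonglongrightarrow> x"
  shows "(\<lambda>j. (1 / (X j - x)) *\<^sub>R (f (X j) - f x)) \<longlonglongrightarrow> D"
proof -
  have "((\<lambda>y. (1 / norm (y - x)) *\<^sub>R (f y - (f x + (y - x) *\<^sub>R D))) \<longlongrightarrow> 0) (at x within S)"
    using assms(1) unfolding has_vector_derivative_def has_derivative_within by blast
  then have "(\<lambda>j. (1 / norm (X j - x)) *\<^sub>R (f (X j) - (f x + (X j - x) *\<^sub>R D))) \<longlonglongrightarrow> 0"
    using X unfolding tendsto_at_iff_sequentially by (auto simp: comp_def)
  then have "(\<lambda>j. norm ((1 / norm (X j - x)) *\<^sub>R (f (X j) - (f x + (X j - x) *\<^sub>R D)))) \<longlonglongrightarrow> 0"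
    by (rule tendsto_norm_zero)
  moreover have "norm ((1 / norm (X j - x)) *\<^sub>R (f (X j) - (f x + (X j - x) *\<^sub>R D)))
      = norm ((1 / (X j - x)) *\<^sub>R (f (X j) - f x) - D)" for j
  proof -
    have "(1 / d) *\<^sub>R (a - b) - D = (1 / d) *\<^sub>R (a - (b + d *\<^sub>R D))" if "d \<noteq> 0" for d a b
      using that by (simp add: scaleR_diff_right scaleR_add_right)
    moreover have "X j - x \<noteq> 0" using X(1)[of j] by auto
    ultimately show ?thesis by simp
  qed
  ultimately have "(\<lambda>j. norm ((1 / (X j - x)) *\<^sub>R (f (X j) - f x) - D)) \<longlonglongrightarrow> 0" by simp
  then show ?thesis by (simp add: LIM_zero_cancel tendsto_norm_zero_iff)
qed

lemma integral_rescaled: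
  fixes \<Gamma> :: "real \<Rightarrow> complex"
  assumes \<Gamma>: "continuous_on {0..1} \<Gamma>" and c: "0 < c" "c \<le> 1"
  shows "integral {0..1} (\<lambda>u. \<Gamma> (c * (1 - u))) = (1 / c) *\<^sub>R integral {0..c} \<Gamma>"
proof -
  define \<Phi> where "\<Phi> x = integral {0..x} \<Gamma>" for x
  have "((\<lambda>u. \<Gamma> (c * (1 - u))) has_integral (- (1 / c)) *\<^sub>R \<Phi> (c * (1 - 1)) - (- (1 / c)) *\<^sub>R \<Phi> (c * (1 - 0))) {0..1}"
  proof (rule fundamental_theorem_of_calculus)
    fix u :: real assume u: "u \<in> {0..1}"
    have im: "(\<lambda>u. c * (1 - u)) ` {0..1} \<subseteq> {0..1}"
    proof (rule image_subsetI)
      fix u :: real assume "u \<in> {0..1}"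
      then show "c * (1 - u) \<in> {0..1}"
        using c mult_mono[of c 1 "1 - u" 1] by auto
    qed
    have "((\<lambda>u. c * (1 - u)) has_vector_derivative (- c)) (at u within {0..1})"
      by (auto intro!: derivative_eq_intros simp: has_real_derivative_iff_has_vector_derivative[symmetric])
    moreover have "(\<Phi> has_vector_derivative \<Gamma> (c * (1 - u))) (at (c * (1 - u)) within (\<lambda>u. c * (1 - u)) ` {0..1})"
      unfolding \<Phi>_def
    proof (rule has_vector_derivative_within_subset[OF integral_has_vector_derivative[OF \<Gamma>] im])
      show "c * (1 - u) \<in> {0..1}" using im u by blast
    qed
    ultimately have "((\<Phi> \<circ> (\<lambda>u. c * (1 - u))) has_vector_derivative (- c) *\<^sub>R \<Gamma> (c * (1 - u))) (at u within {0..1})"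
      by (rule vector_diff_chain_within)
    then have "((\<lambda>u. (- (1 / c)) *\<^sub>R (\<Phi> \<circ> (\<lambda>u. c * (1 - u))) u) has_vector_derivative (- (1 / c)) *\<^sub>R ((- c) *\<^sub>R \<Gamma> (c * (1 - u)))) (at u within {0..1})"
      by (rule bounded_linear.has_vector_derivative[OF bounded_linear_scaleR_right])
    then show "((\<lambda>u. (- (1 / c)) *\<^sub>R \<Phi> (c * (1 - u))) has_vector_derivative \<Gamma> (c * (1 - u))) (at u within {0..1})"
      using c by (simp add: o_def)
  qed simp
  then show ?thesis by (simp add: \<Phi>_def integral_unique)
qed

text \<open>
  With \<open>\<Gamma>(x) = G(x^(2/r))\<close> and \<open>\<Phi>(x)\<close> the integral of \<open>\<Gamma>\<close> from 0 to
  \<open>x\<close>, rescaling gives \<open>B(\<sigma>) = \<sigma>^(-r/2) \<Phi>(\<sigma>^(r/2))\<close>, and the product rule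
  applies.  The interval starts at \<open>1/2\<close> only to stay away from the singular point 0.
\<close>
lemma dilated_integral_has_vector_derivative:
  fixes G :: "real \<Rightarrow> complex"
  assumes G: "continuous_on {0..1} G" and r: "r > 0"
  defines "B \<equiv> \<lambda>\<sigma>. integral {0..1} (\<lambda>u. G (\<sigma> * (1 - u) powr (2 / r)))"
  shows "(B has_vector_derivative (r / 2) *\<^sub>R (G 1 - B 1)) (at 1 within {1/2..1})"
proof -
  define \<Gamma> where "\<Gamma> x = G (x powr (2 / r))" for x
  define \<Phi> where "\<Phi> x = integral {0..x} \<Gamma>" for x
  have \<Gamma>: "continuous_on {0..1} \<Gamma>"
    unfolding \<Gamma>_def using r
    by (intro continuous_on_compose2[OF G] continuous_on_powr' continuous_intros) (auto intro!: powr_le1)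
  have B: "B \<sigma> = (\<sigma> powr (- (r / 2))) *\<^sub>R \<Phi> (\<sigma> powr (r / 2))" if \<sigma>: "0 < \<sigma>" "\<sigma> \<le> 1" for \<sigma>
  proof -
    have "B \<sigma> = integral {0..1} (\<lambda>u. \<Gamma> (\<sigma> powr (r / 2) * (1 - u)))"
      unfolding B_def
    proof (rule integral_cong)
      fix u :: real assume "u \<in> {0..1}"
      then show "G (\<sigma> * (1 - u) powr (2 / r)) = \<Gamma> (\<sigma> powr (r / 2) * (1 - u))"
        using r \<sigma> by (simp add: \<Gamma>_def powr_mult powr_powr)
    qed
    also have "\<dots> = (1 / \<sigma> powr (r / 2)) *\<^sub>R \<Phi> (\<sigma> powr (r / 2))"
      unfolding \<Phi>_def using r \<sigma> by (intro integral_rescaled \<Gamma>) (auto intro!: powr_le1)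
    finally show ?thesis by (simp add: powr_minus_divide)
  qed
  have im: "(\<lambda>\<sigma>. \<sigma> powr (r / 2)) ` {1/2..1} \<subseteq> {0..1::real}"
    using r by (auto intro!: powr_le1)
  have d1: "((\<lambda>\<sigma>. \<sigma> powr (r / 2)) has_vector_derivative (r / 2)) (at 1 within {1/2..1})"
    by (auto intro!: derivative_eq_intros simp: has_real_derivative_iff_has_vector_derivative[symmetric])
  have "(\<Phi> has_vector_derivative \<Gamma> (1 powr (r / 2))) (at (1 powr (r / 2)) within (\<lambda>\<sigma>. \<sigma> powr (r / 2)) ` {1/2..1})"
    unfolding \<Phi>_def using im
    by (intro has_vector_derivative_within_subset[OF integral_has_vector_derivative[OF \<Gamma>]]) auto
  from vector_diff_chain_within[OF d1 this]
  have d2: "((\<lambda>\<sigma>. \<Phi> (\<sigma> powr (r / 2))) has_vector_derivative (r / 2) *\<^sub>R \<Gamma> 1) (at 1 within {1/2..1})"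
    by (simp add: o_def)
  have d3: "((\<lambda>\<sigma>. \<sigma> powr (- (r / 2))) has_field_derivative (- (r / 2))) (at 1 within {1/2..1})"
    by (auto intro!: derivative_eq_intros)
  have "((\<lambda>\<sigma>. (\<sigma> powr (- (r / 2))) *\<^sub>R \<Phi> (\<sigma> powr (r / 2))) has_vector_derivative
      (1 powr (- (r / 2))) *\<^sub>R ((r / 2) *\<^sub>R \<Gamma> 1) + (- (r / 2)) *\<^sub>R \<Phi> (1 powr (r / 2))) (at 1 within {1/2..1})"
    by (rule has_vector_derivative_scaleR[OF d3 d2])
  also have "(1 powr (- (r / 2))) *\<^sub>R ((r / 2) *\<^sub>R \<Gamma> 1) + (- (r / 2)) *\<^sub>R \<Phi> (1 powr (r / 2)) = (r / 2) *\<^sub>R (G 1 - B 1)"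
    using B[of 1] by (simp add: \<Gamma>_def scaleR_diff_right)
  finally show ?thesis
    by (rule has_vector_derivative_transform[rotated 2]) (auto simp: B)
qed

lemma dilation_factor_has_field_derivative:
  fixes u \<nu> :: complex
  assumes "1 - u * \<nu> \<noteq> 0"
  shows "((\<lambda>u. u * inverse ((1 - u * \<nu>)\<^sup>2)) has_field_derivative (1 + u * \<nu>) * inverse ((1 - u * \<nu>) ^ 3)) (at u)"
proof -
  have "inverse (x\<^sup>2) = x * inverse (x ^ 3)" "x * inverse ((x\<^sup>2)\<^sup>2) = inverse (x ^ 3)" if "x \<noteq> 0" for x :: complex
    using that by (simp_all add: field_simps eval_nat_numeral)
  note * = this(1)[OF assms] and ** = this(2)[OF assms]
  have "((\<lambda>u. u * inverse ((1 - u * \<nu>)\<^sup>2)) has_field_derivative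
      inverse ((1 - u * \<nu>)\<^sup>2) + u * (2 * \<nu> * ((1 - u * \<nu>) * inverse (((1 - u * \<nu>)\<^sup>2)\<^sup>2)))) (at u)"
    using assms by (auto intro!: derivative_eq_intros simp: power2_eq_square divide_inverse mult_ac)
  also have "inverse ((1 - u * \<nu>)\<^sup>2) + u * (2 * \<nu> * ((1 - u * \<nu>) * inverse (((1 - u * \<nu>)\<^sup>2)\<^sup>2)))
      = (1 + u * \<nu>) * inverse ((1 - u * \<nu>) ^ 3)"
    unfolding ** unfolding * by (simp add: algebra_simps)
  finally show ?thesis .
qed

text \<open>
  The derivative of \<open>dilated_kernel\<close> below with respect to its last argument, taken at 1.
\<close>
definition dilation_derivative ::
    "complex ^ 'n::finite \<Rightarrow> complex \<times> (complex ^ 'n) \<Rightarrow> complex" where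
  "dilation_derivative \<zeta> p = polydisc_kernel \<zeta> p *
     (\<Sum>k\<in>UNIV. (1 + snd p $ k * cnj (\<zeta> $ k)) * inverse (1 - snd p $ k * cnj (\<zeta> $ k)))"

text \<open>
  For real \<open>u\<close> this is \<open>u^n\<close> times the polydisc kernel at \<open>u\<zeta>\<close>.  The power is
  distributed over the factors, and \<open>u\<close> is complex, so that the dependence on \<open>u\<close> is holomorphic.
\<close>
definition dilated_kernel ::
    "complex ^ 'n::finite \<Rightarrow> complex \<times> (complex ^ 'n) \<Rightarrow> complex \<Rightarrow> complex" where
  "dilated_kernel \<zeta> p u =
     (\<Prod>k\<in>UNIV. u * inverse ((1 - u * (snd p $ k * cnj (\<zeta> $ k)))\<^sup>2))"

lemma dilated_kernel_eq:
  "dilated_kernel \<zeta> p (of_real \<sigma>)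
     = of_real (\<sigma> ^ CARD('n)) * polydisc_kernel (\<chi> k. of_real \<sigma> * \<zeta> $ k) (p :: complex \<times> (complex ^ 'n::finite))"
  by (simp add: dilated_kernel_def polydisc_kernel_def prod.distrib mult_ac)

text \<open>
  The constant is uniform in \<open>p\<close>, which provides the dominating function for differentiation under the
  integral sign.
\<close>
lemma dilated_kernel_lipschitz:
  fixes \<zeta> :: "complex ^ 'n::finite"
  assumes \<zeta>: "\<And>k. cmod (\<zeta> $ k) < 1"
  shows "\<exists>M\<ge>0. \<forall>p u v. (\<forall>k. cmod (snd p $ k) \<le> 1) \<longrightarrow> cmod u \<le> 1 \<longrightarrow> cmod v \<le> 1 \<longrightarrow>
            cmod (dilated_kernel \<zeta> p u - dilated_kernel \<zeta> p v) \<le> M * cmod (u - v)"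
proof -
  define \<delta> where "\<delta> k = 1 - cmod (\<zeta> $ k)" for k
  have \<delta>: "\<delta> k > 0" for k using \<zeta>[of k] by (simp add: \<delta>_def)
  define M where "M = (\<Sum>k\<in>UNIV. (2 * inverse (\<delta> k ^ 3)) * (\<Prod>j\<in>UNIV - {k}. inverse ((\<delta> j)\<^sup>2)))"
  have M: "M \<ge> 0"
    unfolding M_def using \<delta> by (intro sum_nonneg mult_nonneg_nonneg prod_nonneg) (auto simp: less_imp_le)
  have "cmod (dilated_kernel \<zeta> p u - dilated_kernel \<zeta> p v) \<le> M * cmod (u - v)"
    if p: "\<forall>k. cmod (snd p $ k) \<le> 1" and uv: "cmod u \<le> 1" "cmod v \<le> 1" for p u v
  proof -
    define \<nu> where "\<nu> k = snd p $ k * cnj (\<zeta> $ k)" for k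
    have u\<nu>: "\<delta> k \<le> cmod (1 - z * \<nu> k)" "cmod (1 + z * \<nu> k) \<le> 2" "1 - z * \<nu> k \<noteq> 0" if z: "cmod z \<le> 1" for z k
    proof -
      have "cmod (z * snd p $ k) \<le> 1" using z p by (simp add: norm_mult mult_le_one)
      from one_minus_mult_ge[OF this, of "cnj (\<zeta> $ k)"] show 1: "\<delta> k \<le> cmod (1 - z * \<nu> k)"
        by (simp add: \<delta>_def \<nu>_def mult.assoc)
      show "1 - z * \<nu> k \<noteq> 0" using 1 \<delta>[of k] by auto
      have "cmod (z * \<nu> k) \<le> 1"
        using z p \<zeta>[of k] by (simp add: \<nu>_def norm_mult mult_le_one less_imp_le)
      then show "cmod (1 + z * \<nu> k) \<le> 2" using norm_triangle_ineq[of 1 "z * \<nu> k"] by simp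
    qed
    define D where "D z = (\<Sum>k\<in>UNIV. ((1 + z * \<nu> k) * inverse ((1 - z * \<nu> k) ^ 3))
       * (\<Prod>j\<in>UNIV - {k}. z * inverse ((1 - z * \<nu> j)\<^sup>2)))" for z
    show ?thesis
    proof (rule field_differentiable_bound[where S = "cball 0 1" and f' = D])
      fix z :: complex assume "z \<in> cball 0 1"
      then have z: "cmod z \<le> 1" by simp
      show "(dilated_kernel \<zeta> p has_field_derivative D z) (at z within cball 0 1)"
        unfolding dilated_kernel_def[abs_def] D_def \<nu>_def[symmetric]
        by (rule has_field_derivative_at_within, rule has_field_derivative_prod[where
              f = "\<lambda>k u. u * inverse ((1 - u * \<nu> k)\<^sup>2)" and
              f' = "\<lambda>k. (1 + z * \<nu> k) * inverse ((1 - z * \<nu> k) ^ 3)"],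
            rule dilation_factor_has_field_derivative, rule u\<nu>(3)[OF z])
      have "cmod (D z) \<le> (\<Sum>k\<in>UNIV. cmod (((1 + z * \<nu> k) * inverse ((1 - z * \<nu> k) ^ 3))
         * (\<Prod>j\<in>UNIV - {k}. z * inverse ((1 - z * \<nu> j)\<^sup>2))))"
        unfolding D_def by (rule norm_sum)
      also have "\<dots> \<le> M"
        unfolding M_def norm_mult norm_inverse norm_power prod_norm[symmetric]
      proof (intro sum_mono mult_mono prod_mono conjI)
        fix k j
        show "inverse (cmod (1 - z * \<nu> k) ^ 3) \<le> inverse (\<delta> k ^ 3)"
          using u\<nu>(1)[OF z] \<delta>[of k] by (intro le_imp_inverse_le power_mono) auto
        have "inverse ((cmod (1 - z * \<nu> j))\<^sup>2) \<le> inverse ((\<delta> j)\<^sup>2)"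
          using u\<nu>(1)[OF z] \<delta>[of j] by (intro le_imp_inverse_le power_mono) auto
        then show "cmod z * inverse ((cmod (1 - z * \<nu> j))\<^sup>2) \<le> inverse ((\<delta> j)\<^sup>2)"
          using z mult_mono[of "cmod z" 1] by fastforce
      qed (use u\<nu>(2)[OF z] \<delta> in \<open>auto intro!: prod_nonneg mult_nonneg_nonneg simp: less_imp_le\<close>)
      finally show "cmod (D z) \<le> M" .
    qed (use uv in auto)
  qed
  with M show ?thesis by blast
qed

lemma dilated_kernel_has_field_derivative:
  fixes \<zeta> :: "complex ^ 'n::finite"
  assumes \<zeta>: "\<And>k. cmod (\<zeta> $ k) < 1" and p: "\<And>k. cmod (snd p $ k) \<le> 1"
  shows "(dilated_kernel \<zeta> p has_field_derivative dilation_derivative \<zeta> p) (at 1)"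
proof -
  define \<nu> where "\<nu> k = snd p $ k * cnj (\<zeta> $ k)" for k
  have ne: "1 - \<nu> k \<noteq> 0" for k
    using one_minus_mult_nonzero[OF p[of k], of "cnj (\<zeta> $ k)"] \<zeta>[of k] by (simp add: \<nu>_def)
  have "a * inverse (x ^ 3) / (1 * inverse (x\<^sup>2)) = a * inverse x" if "x \<noteq> 0" for a x :: complex
    using that by (simp add: field_simps eval_nat_numeral)
  from this[OF ne]
  have eq: "(1 + \<nu> k) * inverse ((1 - \<nu> k) ^ 3) / (1 * inverse ((1 - \<nu> k)\<^sup>2)) = (1 + \<nu> k) * inverse (1 - \<nu> k)" for k
    .
  have "((\<lambda>u. \<Prod>k\<in>UNIV. u * inverse ((1 - u * \<nu> k)\<^sup>2)) has_field_derivative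
      (\<Prod>k\<in>UNIV. 1 * inverse ((1 - 1 * \<nu> k)\<^sup>2)) *
      (\<Sum>k\<in>UNIV. (1 + 1 * \<nu> k) * inverse ((1 - 1 * \<nu> k) ^ 3) / (1 * inverse ((1 - 1 * \<nu> k)\<^sup>2)))) (at 1)"
    by (rule has_field_derivative_prod'[where f = "\<lambda>k u. u * inverse ((1 - u * \<nu> k)\<^sup>2)" and
          f' = "\<lambda>k. (1 + 1 * \<nu> k) * inverse ((1 - 1 * \<nu> k) ^ 3)"])
       (use ne in \<open>auto intro!: dilation_factor_has_field_derivative[of 1, simplified]\<close>)
  then show ?thesis
    unfolding dilated_kernel_def[abs_def] dilation_derivative_def polydisc_kernel_def \<nu>_def[symmetric]
    using eq by simp
qed

lemma dilation_derivative_in_bergman_space: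
  fixes \<zeta> :: "complex ^ 'n::finite"
  assumes r: "r > 0" and \<zeta>: "\<And>k. cmod (\<zeta> $ k) < 1"
  shows "dilation_derivative \<zeta> \<in> bergman_space (Omega r)"
proof (rule bounded_holomorphic_in_bergman_space[OF open_Omega[OF r] emeasure_Omega_finite[OF r]])
  have ne: "1 - snd p $ k * cnj (\<zeta> $ k) \<noteq> 0" "cmod (snd p $ k) < 1" if "p \<in> Omega r" for p k
    using Omega_in_polydisc(2)[OF r that, of k] \<zeta>[of k]
      one_minus_mult_nonzero[of "snd p $ k" "cnj (\<zeta> $ k)"] by simp_all
  have "holomorphic_sev (\<lambda>p :: complex \<times> (complex ^ 'n). \<Sum>k\<in>UNIV. (1 + snd p $ k * cnj (\<zeta> $ k))
      * inverse (1 + snd p $ k * (- cnj (\<zeta> $ k)))) (Omega r)"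
    using ne by (intro holomorphic_sev_sum holomorphic_sev_mult holomorphic_sev_inverse holomorphic_sev_add
        holomorphic_sev_const holomorphic_sev_coordinate) auto
  then show "holomorphic_sev (dilation_derivative \<zeta>) (Omega r)"
    unfolding dilation_derivative_def[abs_def]
    using holomorphic_polydisc_kernel[OF r \<zeta>] by (auto intro: holomorphic_sev_mult)
  fix p :: "complex \<times> (complex ^ 'n)" assume p: "p \<in> Omega r"
  have "cmod (\<Sum>k\<in>UNIV. (1 + snd p $ k * cnj (\<zeta> $ k)) * inverse (1 - snd p $ k * cnj (\<zeta> $ k)))
      \<le> (\<Sum>k\<in>UNIV. 2 * inverse (1 - cmod (\<zeta> $ k)))"
  proof (rule sum_norm_le)
    fix k
    have "cmod (snd p $ k * cnj (\<zeta> $ k)) \<le> 1"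
      using ne(2)[OF p, of k] \<zeta>[of k] by (simp add: norm_mult mult_le_one less_imp_le)
    then have "cmod (1 + snd p $ k * cnj (\<zeta> $ k)) \<le> 2"
      using norm_triangle_ineq[of 1 "snd p $ k * cnj (\<zeta> $ k)"] by simp
    moreover have "inverse (cmod (1 - snd p $ k * cnj (\<zeta> $ k))) \<le> inverse (1 - cmod (\<zeta> $ k))"
      using one_minus_mult_ge[of "snd p $ k" "cnj (\<zeta> $ k)"] ne(2)[OF p, of k] \<zeta>[of k]
      by (intro le_imp_inverse_le) auto
    ultimately show "cmod ((1 + snd p $ k * cnj (\<zeta> $ k)) * inverse (1 - snd p $ k * cnj (\<zeta> $ k)))
        \<le> 2 * inverse (1 - cmod (\<zeta> $ k))"
      unfolding norm_mult norm_inverse by (intro mult_mono) auto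
  qed
  then show "cmod (dilation_derivative \<zeta> p) \<le> (\<Prod>k\<in>UNIV. inverse ((1 - cmod (\<zeta> $ k))\<^sup>2))
      * (\<Sum>k\<in>UNIV. 2 * inverse (1 - cmod (\<zeta> $ k)))"
    unfolding dilation_derivative_def norm_mult
    by (intro mult_mono polydisc_kernel_bounded[OF r \<zeta> p] prod_nonneg) auto
qed

text \<open>
  Differentiation of \<open>\<langle>f, \<sigma>^n H\<^bsub>\<sigma>\<zeta>\<^esub>\<rangle> = \<pi>^(n+1) B(\<sigma>)\<close> at \<open>\<sigma> = 1\<close>.
  On the left the derivative is taken under the integral, along a sequence of difference quotients; on the
  right it is known.
\<close>
lemma dilation_derivative_pairing:
  fixes f :: "complex \<times> (complex ^ 'n::finite) \<Rightarrow> complex" and \<zeta> :: "complex ^ 'n"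
  assumes r: "r > 0" and \<zeta>: "\<And>k. cmod (\<zeta> $ k) < 1" and f: "f \<in> bergman_space (Omega r)"
  shows "l2_inner (Omega r) f (dilation_derivative \<zeta>)
       = of_real (r / 2) * (of_real (pi ^ (CARD('n) + 1)) * f (0, \<zeta>) - l2_inner (Omega r) f (polydisc_kernel \<zeta>))"
proof -
  define N where "N = complex_of_real (pi ^ (CARD('n) + 1))"
  define G where "G s = of_real (s ^ CARD('n)) * f (0, \<chi> k. of_real s * \<zeta> $ k)" for s :: real
  define B where "B \<sigma> = integral {0..1} (\<lambda>u. G (\<sigma> * (1 - u) powr (2 / r)))" for \<sigma> :: real
  have contG: "continuous_on {0..1} G"
    unfolding G_def by (rule Omega_slice_continuous[OF r \<zeta> f])
  have dil: "l2_inner (Omega r) f (\<lambda>p. dilated_kernel \<zeta> p (of_real \<sigma>)) = N * B \<sigma>"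
     and dilA: "(\<lambda>p. dilated_kernel \<zeta> p (of_real \<sigma>)) \<in> bergman_space (Omega r)"
    if \<sigma>: "\<sigma> \<in> {0..1}" for \<sigma>
  proof -
    define \<xi> where "\<xi> = (\<chi> k. of_real \<sigma> * \<zeta> $ k)"
    have \<xi>: "cmod (\<xi> $ k) < 1" for k
      using mult_left_le_one_le[of "cmod (\<zeta> $ k)" \<sigma>] \<sigma> \<zeta>[of k] by (simp add: \<xi>_def norm_mult)
    have "l2_inner (Omega r) f (\<lambda>p. dilated_kernel \<zeta> p (of_real \<sigma>))
        = of_real (\<sigma> ^ CARD('n)) * l2_inner (Omega r) f (polydisc_kernel \<xi>)"
      unfolding dilated_kernel_eq \<xi>_def[symmetric] l2_inner_scale_right by simp
    also have "\<dots> = N * (of_real (\<sigma> ^ CARD('n)) * integral {0..1} (\<lambda>u.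
           of_real (((1 - u) powr (2 / r)) ^ CARD('n))
             * f (0, \<chi> k. of_real ((1 - u) powr (2 / r)) * \<xi> $ k)))"
      using polydisc_kernel_pairing[OF r \<xi> f] by (simp add: N_def mult_ac)
    also have "of_real (\<sigma> ^ CARD('n)) * integral {0..1} (\<lambda>u.
           of_real (((1 - u) powr (2 / r)) ^ CARD('n))
             * f (0, \<chi> k. of_real ((1 - u) powr (2 / r)) * \<xi> $ k)) = B \<sigma>"
      unfolding B_def integral_mult_right[symmetric]
      by (simp add: G_def \<xi>_def power_mult_distrib mult_ac)
    finally show "l2_inner (Omega r) f (\<lambda>p. dilated_kernel \<zeta> p (of_real \<sigma>)) = N * B \<sigma>" .
    show "(\<lambda>p. dilated_kernel \<zeta> p (of_real \<sigma>)) \<in> bergman_space (Omega r)"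
      unfolding dilated_kernel_eq \<xi>_def[symmetric]
      by (intro bergman_space_scale polydisc_kernel_in_bergman_space r \<xi>)
  qed
  have H1: "(\<lambda>p. dilated_kernel \<zeta> p 1) = polydisc_kernel \<zeta>"
    using dilated_kernel_eq[of \<zeta> _ 1] by (simp add: fun_eq_iff)
  define L where "L j = 1 - inverse (real (Suc (Suc j)))" for j
  have L: "L j \<in> {1/2..1} - {1}" for j
  proof -
    have "inverse (real (Suc (Suc j))) \<le> inverse 2"
      by (intro le_imp_inverse_le) auto
    moreover have "0 < inverse (real (Suc (Suc j)))" by simp
    ultimately show ?thesis unfolding L_def by auto
  qed
  have limL: "L \<longlonglongrightarrow> 1"
    unfolding L_def[abs_def]
    using tendsto_diff[OF tendsto_const[of 1] LIMSEQ_Suc[OF LIMSEQ_inverse_real_of_nat]] by simp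
  have L01: "L j \<in> {0..1}" for j using L[of j] by auto
  define q where "q j p = of_real (1 / (L j - 1)) * (dilated_kernel \<zeta> p (of_real (L j)) - dilated_kernel \<zeta> p 1)" for j p
  have one: "(1::real) \<in> {0..1}" by simp
  have qf: "l2_inner (Omega r) f (q j) = N * ((1 / (L j - 1)) *\<^sub>R (B (L j) - B 1))" for j
    unfolding q_def[abs_def] l2_inner_scale_right
    using l2_inner_diff_right[OF open_Omega[OF r] dilA[OF L01[of j]] dilA[OF one] f]
    by (simp add: dil[OF L01[of j]] dil[OF one, simplified] scaleR_conv_of_real algebra_simps)
  have "(\<lambda>j. (1 / (L j - 1)) *\<^sub>R (B (L j) - B 1)) \<longlonglongrightarrow> (r / 2) *\<^sub>R (G 1 - B 1)"
    by (rule has_vector_derivative_imp_sequence[OF _ L limL])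
       (use dilated_integral_has_vector_derivative[OF contG r] in \<open>simp add: B_def\<close>)
  then have lim1: "(\<lambda>j. l2_inner (Omega r) f (q j)) \<longlonglongrightarrow> N * ((r / 2) *\<^sub>R (G 1 - B 1))"
    unfolding qf by (rule tendsto_mult_left)
  obtain M where M: "M \<ge> 0" "\<And>p u v. \<forall>k. cmod (snd p $ k) \<le> 1 \<Longrightarrow> cmod u \<le> 1 \<Longrightarrow> cmod v \<le> 1 \<Longrightarrow>
      cmod (dilated_kernel \<zeta> p u - dilated_kernel \<zeta> p v) \<le> M * cmod (u - v)"
    using dilated_kernel_lipschitz[OF \<zeta>] by blast
  have inP: "cmod (snd p $ k) \<le> 1" if "p \<in> Omega r" for p :: "complex \<times> (complex ^ 'n)" and k
    using Omega_in_polydisc(2)[OF r that, of k] by simp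
  have qb: "cmod (q j p) \<le> M" if p: "p \<in> Omega r" for j p
  proof -
    have d: "L j - 1 < 0" using L[of j] by auto
    have "cmod (of_real (L j) - 1) = \<bar>L j - 1\<bar>"
      by (metis norm_of_real of_real_1 of_real_diff)
    then have "cmod (dilated_kernel \<zeta> p (of_real (L j)) - dilated_kernel \<zeta> p 1) \<le> M * \<bar>L j - 1\<bar>"
      using M(2)[of p "of_real (L j)" 1] inP[OF p] L01[of j] by simp
    then show ?thesis
      using d unfolding q_def norm_mult norm_of_real by (simp add: field_simps abs_if)
  qed
  have qlim: "(\<lambda>j. q j p) \<longlonglongrightarrow> dilation_derivative \<zeta> p" if p: "p \<in> Omega r" for p
  proof -
    have "((\<lambda>\<sigma>. dilated_kernel \<zeta> p (of_real \<sigma>)) has_vector_derivative dilation_derivative \<zeta> p) (at 1 within {1/2..1})"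
      using dilated_kernel_has_field_derivative[OF \<zeta> inP[OF p]]
      by (intro has_vector_derivative_real_field) simp
    from has_vector_derivative_imp_sequence[OF this L limL]
    show ?thesis by (simp add: q_def scaleR_conv_of_real)
  qed
  have f1: "set_integrable lborel (Omega r) f"
  proof -
    have "(\<lambda>p. 1) \<in> bergman_space (Omega r :: (complex \<times> (complex ^ 'n)) set)"
      by (rule bounded_holomorphic_in_bergman_space[OF open_Omega[OF r] emeasure_Omega_finite[OF r]
            holomorphic_sev_const, where K = 1]) simp
    from bergman_space_integrable[OF open_Omega[OF r] f this] show ?thesis by simp
  qed
  have qA: "q j \<in> bergman_space (Omega r)" for j
    unfolding q_def[abs_def]
    using dilA[OF L01[of j]] dilA[OF one]
    by (intro bergman_space_scale bergman_space_diff open_Omega r) simp_all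
  have lim2: "(\<lambda>j. l2_inner (Omega r) f (q j)) \<longlonglongrightarrow> l2_inner (Omega r) f (dilation_derivative \<zeta>)"
    unfolding l2_inner_def set_lebesgue_integral_def
  proof (rule integral_dominated_convergence[where w = "\<lambda>p. norm (indicator (Omega r) p *\<^sub>R f p) * M"])
    show "(\<lambda>p. indicator (Omega r) p *\<^sub>R (f p * cnj (dilation_derivative \<zeta> p))) \<in> borel_measurable lborel"
      using bergman_space_integrable[OF open_Omega[OF r] f dilation_derivative_in_bergman_space[OF r \<zeta>]]
      unfolding set_integrable_def by (rule borel_measurable_integrable)
    show "(\<lambda>p. indicator (Omega r) p *\<^sub>R (f p * cnj (q j p))) \<in> borel_measurable lborel" for j
      using bergman_space_integrable[OF open_Omega[OF r] f qA[of j]]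
      unfolding set_integrable_def by (rule borel_measurable_integrable)
    show "integrable lborel (\<lambda>p. norm (indicator (Omega r) p *\<^sub>R f p) * M)"
      using f1 unfolding set_integrable_def by (intro integrable_mult_left integrable_norm)
    show "AE p in lborel. norm (indicator (Omega r) p *\<^sub>R (f p * cnj (q j p))) \<le> norm (indicator (Omega r) p *\<^sub>R f p) * M" for j
      using qb by (intro AE_I2) (auto simp: indicator_def norm_mult intro: mult_left_mono)
    have "(\<lambda>j. indicator (Omega r) p *\<^sub>R (f p * cnj (q j p))) \<longlonglongrightarrow> indicator (Omega r) p *\<^sub>R (f p * cnj (dilation_derivative \<zeta> p))" for p
    proof (cases "p \<in> Omega r")
      case True
      then show ?thesis by (intro tendsto_intros qlim)
    qed simp
    then show "AE p in lborel. (\<lambda>j. indicator (Omega r) p *\<^sub>R (f p * cnj (q j p)))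
        \<longlonglongrightarrow> indicator (Omega r) p *\<^sub>R (f p * cnj (dilation_derivative \<zeta> p))"
      by simp
  qed
  have "l2_inner (Omega r) f (dilation_derivative \<zeta>) = N * ((r / 2) *\<^sub>R (G 1 - B 1))"
    using LIMSEQ_unique[OF lim2 lim1] .
  also have "\<dots> = of_real (r / 2) * (N * G 1 - l2_inner (Omega r) f (polydisc_kernel \<zeta>))"
  proof -
    have pk: "l2_inner (Omega r) f (polydisc_kernel \<zeta>) = N * B 1"
      using dil[OF one] H1 by simp
    show ?thesis
      unfolding pk scaleR_conv_of_real right_diff_distrib by (simp only: mult.left_commute)
  qed
  also have "G 1 = f (0, \<zeta>)" by (simp add: G_def)
  finally show ?thesis by (simp add: N_def)
qed

section \<open>The Bergman kernel\<close>

definition Omega_kernel ::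
    "real \<Rightarrow> complex ^ 'n::finite \<Rightarrow> complex \<times> (complex ^ 'n) \<Rightarrow> complex" where
  "Omega_kernel r \<zeta> p = of_real (1 / pi ^ (CARD('n) + 1))
     * (polydisc_kernel \<zeta> p + of_real (2 / r) * dilation_derivative \<zeta> p)"

lemma Omega_kernel_in_bergman_space:
  fixes \<zeta> :: "complex ^ 'n::finite"
  assumes r: "r > 0" and \<zeta>: "\<And>k. cmod (\<zeta> $ k) < 1"
  shows "Omega_kernel r \<zeta> \<in> bergman_space (Omega r)"
  unfolding Omega_kernel_def[abs_def]
  by (intro bergman_space_scale bergman_space_add open_Omega r polydisc_kernel_in_bergman_space
      dilation_derivative_in_bergman_space \<zeta>)

text \<open>
  The weight \<open>2/r\<close> is the one for which the two terms \<open>\<langle>f, H\<^sub>\<zeta>\<rangle>\<close> cancel.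
\<close>
lemma Omega_kernel_reproducing:
  fixes f :: "complex \<times> (complex ^ 'n::finite) \<Rightarrow> complex"
  assumes r: "r > 0" and \<zeta>: "\<And>k. cmod (\<zeta> $ k) < 1" and f: "f \<in> bergman_space (Omega r)"
  shows "l2_inner (Omega r) f (Omega_kernel r \<zeta>) = f (0, \<zeta>)"
proof -
  define N where "N = complex_of_real (pi ^ (CARD('n) + 1))"
  have N: "N \<noteq> 0" "cnj N = N" by (simp_all add: N_def)
  have "l2_inner (Omega r) f (Omega_kernel r \<zeta>)
      = (1 / N) * (l2_inner (Omega r) f (polydisc_kernel \<zeta>)
          + of_real (2 / r) * l2_inner (Omega r) f (dilation_derivative \<zeta>))"
    unfolding Omega_kernel_def[abs_def] l2_inner_scale_right
      l2_inner_add_right[OF open_Omega[OF r] polydisc_kernel_in_bergman_space[OF r \<zeta>]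
        bergman_space_scale[OF dilation_derivative_in_bergman_space[OF r \<zeta>]] f]
    by (simp add: N_def)
  also have "\<dots> = f (0, \<zeta>)"
    unfolding dilation_derivative_pairing[OF r \<zeta> f] N_def[symmetric]
    using r N by (simp add: field_simps)
  finally show ?thesis .
qed

theorem theorem5p1:
  fixes r :: real and w \<zeta> :: "complex ^ 'n::finite" and \<nu> :: "'n \<Rightarrow> complex"
  assumes "r > 0"
    and "\<forall>k. w $ k \<in> ball 0 1"
    and "\<forall>k. \<zeta> $ k \<in> ball 0 1"
    and "\<forall>k. \<nu> k = w $ k * cnj (\<zeta> $ k)"
  shows "of_real pi ^ (CARD('n) + 1) * bergman_kernel (Omega r) (0, w) (0, \<zeta>) =
           (\<Prod>k\<in>UNIV. (1 - \<nu> k) powi (-2)) +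
           (\<Sum>k\<in>UNIV. 2 * (1 + \<nu> k) /
              (of_real r * (\<Prod>j\<in>UNIV. (1 - \<nu> j)\<^sup>2) * (1 - \<nu> k)))
       \<and> ((\<forall>i j. \<nu> i = \<nu> j) \<longrightarrow>
           (\<forall>i. of_real pi ^ (CARD('n) + 1) * bergman_kernel (Omega r) (0, w) (0, \<zeta>) =
             ((2 * of_nat CARD('n) - of_real r) * \<nu> i + 2 * of_nat CARD('n) + of_real r) /
             (of_real r * (1 - \<nu> i) ^ (2 * CARD('n) + 1))))"
proof -
  have r: "r > 0" by fact
  have w: "\<And>k. cmod (w $ k) < 1" and \<zeta>: "\<And>k. cmod (\<zeta> $ k) < 1"
    using assms(2,3) by auto
  have \<nu>: "\<nu> k = w $ k * cnj (\<zeta> $ k)" for k using assms(4) by blast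
  have ne: "1 - \<nu> k \<noteq> 0" for k
    unfolding \<nu> using w[of k] \<zeta>[of k] by (intro one_minus_mult_nonzero) auto
  obtain B :: "(complex \<times> (complex ^ 'n) \<Rightarrow> complex) set"
    where B: "complete_orthonormal_basis (Omega r) B"
    using complete_orthonormal_basis_exists[OF open_Omega[OF r] emeasure_Omega_finite[OF r]] by blast
  have "bergman_kernel (Omega r) (0, w) (0, \<zeta>) = Omega_kernel r \<zeta> (0, w)"
    by (rule bergman_kernel_eq_reproducing[OF open_Omega[OF r] B, where k\<^sub>p = "Omega_kernel r w"])
       (simp_all add: Omega_kernel_in_bergman_space Omega_kernel_reproducing r w \<zeta>)
  then have K: "of_real pi ^ (CARD('n) + 1) * bergman_kernel (Omega r) (0, w) (0, \<zeta>)
      = polydisc_kernel \<zeta> (0, w) + of_real (2 / r) * dilation_derivative \<zeta> (0, w)"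
    by (simp add: Omega_kernel_def)
  have H: "polydisc_kernel \<zeta> (0, w) = inverse (\<Prod>k\<in>UNIV. (1 - \<nu> k)\<^sup>2)"
    using prod_inversef[of "\<lambda>k. (1 - \<nu> k)\<^sup>2" UNIV] by (simp add: polydisc_kernel_def o_def flip: \<nu>)
  have S: "dilation_derivative \<zeta> (0, w) = inverse (\<Prod>k\<in>UNIV. (1 - \<nu> k)\<^sup>2) * (\<Sum>k\<in>UNIV. (1 + \<nu> k) * inverse (1 - \<nu> k))"
    unfolding dilation_derivative_def H by (simp flip: \<nu>)
  have first: "of_real pi ^ (CARD('n) + 1) * bergman_kernel (Omega r) (0, w) (0, \<zeta>) =
           (\<Prod>k\<in>UNIV. (1 - \<nu> k) powi (-2)) +
           (\<Sum>k\<in>UNIV. 2 * (1 + \<nu> k) /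
              (of_real r * (\<Prod>j\<in>UNIV. (1 - \<nu> j)\<^sup>2) * (1 - \<nu> k)))"
  proof -
    have "(\<Prod>k\<in>UNIV. (1 - \<nu> k) powi (-2)) = inverse (\<Prod>k\<in>UNIV. (1 - \<nu> k)\<^sup>2)"
      using prod_inversef[of "\<lambda>k. (1 - \<nu> k)\<^sup>2" UNIV] by (simp add: power_int_minus o_def)
    moreover have "of_real (2 / r) * dilation_derivative \<zeta> (0, w)
        = (\<Sum>k\<in>UNIV. 2 * (1 + \<nu> k) / (of_real r * (\<Prod>j\<in>UNIV. (1 - \<nu> j)\<^sup>2) * (1 - \<nu> k)))"
      unfolding S sum_distrib_left
      by (intro sum.cong refl) (simp add: divide_inverse mult_ac)
    ultimately show ?thesis unfolding K H by simp
  qed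
  moreover have "of_real pi ^ (CARD('n) + 1) * bergman_kernel (Omega r) (0, w) (0, \<zeta>) =
             ((2 * of_nat CARD('n) - of_real r) * \<nu> i + 2 * of_nat CARD('n) + of_real r) /
             (of_real r * (1 - \<nu> i) ^ (2 * CARD('n) + 1))" if eq: "\<forall>i j. \<nu> i = \<nu> j" for i
  proof -
    obtain c where c: "\<nu> = (\<lambda>k. c)" using eq by (metis ext)
    then have ci: "\<nu> i = c" by simp
    have d: "1 - \<nu> i \<noteq> 0" by (rule ne)
    have "of_real pi ^ (CARD('n) + 1) * bergman_kernel (Omega r) (0, w) (0, \<zeta>)
        = inverse ((1 - \<nu> i) ^ (2 * CARD('n)))
          + of_real (2 / r) * (inverse ((1 - \<nu> i) ^ (2 * CARD('n))) * (of_nat CARD('n) * ((1 + \<nu> i) * inverse (1 - \<nu> i))))"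
      unfolding K H S ci unfolding c by (simp add: power_mult)
    also have "\<dots> = ((2 * of_nat CARD('n) - of_real r) * \<nu> i + 2 * of_nat CARD('n) + of_real r) /
             (of_real r * (1 - \<nu> i) ^ (2 * CARD('n) + 1))"
      using d r by (simp add: field_simps)
    finally show ?thesis .
  qed
  ultimately show ?thesis by blast
qed

end
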